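(* Let $(\mathfrak g,\delta)$ be a Lie bialgebra with a family $\mathbf r=\{r^{(c)}\}_{c\in C}$ of classical r-matrices for $\delta$. Then for any $n\ge2$ and any transitive $\mathbf c:\{(i,j):1\le i<j\le n\}\to C$, the element $$j_{\mathbf c}=j_{\mathbf c}(\mathbf r)=\sum_{1\le i<j\le n}(r^{(\mathbf c(i,j))})_{j,n+i}\in\mathfrak g^{\oplus n}\otimes\mathfrak g^{\oplus n}\subset U(\mathfrak g)^{\otimes n}\otimes U(\mathfrak g)^{\otimes n}$$ is a classical Drinfeld twist for $(\mathfrak g^{\oplus n},\delta_{\mathfrak g^{\oplus n}})$, where $\delta_{\mathfrak g^{\oplus n}}$ is the standard (direct sum) Lie cobracket on $\mathfrak g^{\oplus n}$.
   Context: The base field $\Bbbk$ has characteristic zero. For a Lie algebra $\mathfrak l$, $\Delta:U(\mathfrak l)\to U(\mathfrak l)\otimes U(\mathfrak l)$ is the standard comultiplication; $\mathfrak l\otimes\mathfrak l\subset U(\mathfrak l)\otimes U(\mathfrak l)$; $\tau_{i,j}$ swaps tensor factors $i$ and $j$. For $x=\sum_t a_t\otimes b_t\in\mathfrak l\otimes\mathfrak l$ and distinct $i,j$, $x_{i,j}\in U(\mathfrak l)^{\otimes m}$ has $a_t$ in position $i$, $b_t$ in position $j$ and $1$ elsewhere (summed over $t$). A Lie cobracket on $\mathfrak l$ is a linear map $\delta:\mathfrak l\to\mathfrak l\otimes\mathfrak l$ with $\delta([x,y])=[\delta(x),\Delta(y)]-[\delta(y),\Delta(x)]$, $\tau_{1,2}\circ\delta=-\delta$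 and $(\mathrm{id}+\tau_{1,2}\tau_{2,3}+\tau_{2,3}\tau_{1,2})\circ(\delta\otimes\mathrm{id})\circ\delta=0$; $(\mathfrak l,\delta)$ is then a Lie bialgebra. For $s\in\mathfrak l\otimes\mathfrak l$ put $[[s,s]]=[s_{1,2}+s_{1,3},\,s_{1,3}+s_{2,3}]\in U(\mathfrak l)^{\otimes3}$. A classical r-matrix for $(\mathfrak l,\delta)$ is $r\in\mathfrak l\otimes\mathfrak l$ with $\delta(x)=[r,\Delta(x)]$ for all $x\in\mathfrak l$ and $[[r,r]]=0$. For $j\in\mathfrak l\otimes\mathfrak l$ put $j^-=j-\tau_{1,2}(j)$. A classical Drinfeld twist for a Lie bialgebra $(\mathfrak l,\delta)$ is $j\in\mathfrak l\otimes\mathfrak l$ such that $$(\delta\otimes\mathrm{id})(j^-)-(\mathrm{id}\otimes\delta)(j^-)-\tau_{2,3}(\delta\otimes\mathrm{id})(j^-)+[[j^-,j^-]]=0.$$ $U(\mathfrak g^{\oplus n})=U(\mathfrak g)^{\otimes n}$, so $\mathfrak g^{\oplus n}\otimes\mathfrak g^{\oplus n}\subset U(\mathfrak g)^{\otimes2n}$, with positions $1,\dots,n$ for the first factor and $n+1,\dots,2n$ for the second; the standard cobracket is $\delta_{\mathfrak g^{\oplus n}}(x_1,\dots,x_n)=\sum_i\delta(x_i)_{i,n+i}$. $\mathbf c$ is transitive if $\mathbf c(i,k)\in\{\mathbf c(i,j),\mathbf c(j,k)\}$ for all $1\le i<j<k\le n$. *)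

theory Defs
  imports
    "HOL-Algebra.QuotRing"
    "HOL-Algebra.Module"
    "HOL-Algebra.Algebraic_Closure_Type"
    "HOL-Library.Poly_Mapping"
    "HOL-Analysis.Finite_Cartesian_Product"
begin

(* Conventions.  The base field is a type 'k of class field_char_0.  A Lie algebra is a whole
   type 'g with a scalar multiplication sc :: 'k => 'g => 'g and a bracket br.  Quotient
   objects (enveloping algebras, tensor powers) are module records of HOL-Algebra whose
   elements are cosets; the zero of such a quotient is the coset of 0, not the number 0. *)

section \<open>Tensor powers\<close>

definition fscale :: "'k::field \<Rightarrow> ('x \<Rightarrow>\<^sub>0 'k) \<Rightarrow> ('x \<Rightarrow>\<^sub>0 'k)" where
  "fscale c p = Poly_Mapping.map (\<lambda>a. c * a) p"

definition tuples :: "('k, 'v) module \<Rightarrow> nat \<Rightarrow> 'v list set" where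
  "tuples A m = {xs. length xs = m \<and> set xs \<subseteq> carrier A}"

(* Free vector space on the m-tuples of elements of A, multiplied by bilinear extension of the
   componentwise product of A. *)
definition formal_sums :: "('k::field, 'v) module \<Rightarrow> nat \<Rightarrow> ('v list \<Rightarrow>\<^sub>0 'k) ring" where
  "formal_sums A m = \<lparr>
     carrier = {p. Poly_Mapping.keys p \<subseteq> tuples A m},
     monoid.mult = (\<lambda>p q. \<Sum>xs\<in>Poly_Mapping.keys p. \<Sum>ys\<in>Poly_Mapping.keys q.
        Poly_Mapping.single (map2 (\<lambda>a b. a \<otimes>\<^bsub>A\<^esub> b) xs ys)
          (Poly_Mapping.lookup p xs * Poly_Mapping.lookup q ys)),
     one = Poly_Mapping.single (replicate m \<one>\<^bsub>A\<^esub>) 1,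
     ring.zero = 0,
     add = (+) \<rparr>"

definition tensor_rel :: "('k::field, 'v) module \<Rightarrow> nat \<Rightarrow> ('v list \<Rightarrow>\<^sub>0 'k) set" where
  "tensor_rel A m = Modules.module.span fscale
     ({Poly_Mapping.single (xs[i := a \<oplus>\<^bsub>A\<^esub> b]) 1
         - Poly_Mapping.single (xs[i := a]) 1 - Poly_Mapping.single (xs[i := b]) 1
       | xs i a b. xs \<in> tuples A m \<and> i < m \<and> a \<in> carrier A \<and> b \<in> carrier A}
    \<union> {Poly_Mapping.single (xs[i := c \<odot>\<^bsub>A\<^esub> a]) 1 - Poly_Mapping.single (xs[i := a]) c
       | xs i a c. xs \<in> tuples A m \<and> i < m \<and> a \<in> carrier A})"

(* A^{\<otimes>m}.  If A is an algebra, this is the tensor power with its usual algebra structure; if A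
   is just a vector space, only carrier, zero, add and smult are meaningful. *)
definition tensor_power :: "('k::field, 'v) module \<Rightarrow> nat \<Rightarrow> ('k, ('v list \<Rightarrow>\<^sub>0 'k) set) module" where
  "tensor_power A m = (let F = formal_sums A m; N = tensor_rel A m; Q = F Quot N in \<lparr>
     carrier = carrier Q,
     monoid.mult = monoid.mult Q,
     one = \<one>\<^bsub>Q\<^esub>,
     ring.zero = \<zero>\<^bsub>Q\<^esub>,
     add = add Q,
     module.smult = (\<lambda>c t. (\<Union>p\<in>t. a_r_coset F N (fscale c p))) \<rparr>)"

definition pure_tensor :: "('k::field, 'v) module \<Rightarrow> 'v list \<Rightarrow> ('v list \<Rightarrow>\<^sub>0 'k) set" where
  "pure_tensor A xs =
     tensor_rel A (length xs) +>\<^bsub>formal_sums A (length xs)\<^esub> Poly_Mapping.single xs 1"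

(* The linear map out of a tensor power sending x_1 \<otimes> ... \<otimes> x_m to f [x_1, ..., x_m].  It is
   independent of the chosen representative when f is multilinear, as in all uses below. *)
definition tensor_lift ::
    "('k::field, 'w) module \<Rightarrow> ('v list \<Rightarrow> 'w) \<Rightarrow> ('v list \<Rightarrow>\<^sub>0 'k) set \<Rightarrow> 'w" where
  "tensor_lift M f t = (let p = (SOME p. p \<in> t) in
     finsum M (\<lambda>xs. Poly_Mapping.lookup p xs \<odot>\<^bsub>M\<^esub> f xs) (Poly_Mapping.keys p))"

(* \<tau>_{i,j} on A^{\<otimes>m}; positions are counted from 1. *)
definition tensor_swap ::
    "('k::field, 'v) module \<Rightarrow> nat \<Rightarrow> nat \<Rightarrow> nat \<Rightarrow> ('v list \<Rightarrow>\<^sub>0 'k) set \<Rightarrow> ('v list \<Rightarrow>\<^sub>0 'k) set" where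
  "tensor_swap A m i j = tensor_lift (tensor_power A m)
     (\<lambda>xs. pure_tensor A (xs[i - 1 := xs ! (j - 1), j - 1 := xs ! (i - 1)]))"

definition commutator :: "('a, 'b) ring_scheme \<Rightarrow> 'a \<Rightarrow> 'a \<Rightarrow> 'a" where
  "commutator R a b = a \<otimes>\<^bsub>R\<^esub> b \<ominus>\<^bsub>R\<^esub> b \<otimes>\<^bsub>R\<^esub> a"


section \<open>Lie algebras and universal enveloping algebras\<close>

locale lie_algebra = vector_space sc
  for sc :: "'k::field_char_0 \<Rightarrow> 'g::ab_group_add \<Rightarrow> 'g" +
  fixes br :: "'g \<Rightarrow> 'g \<Rightarrow> 'g"
  assumes br_add_left: "br (x + y) z = br x z + br y z"
    and br_add_right: "br x (y + z) = br x y + br x z"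
    and br_scale_left: "br (sc c x) y = sc c (br x y)"
    and br_scale_right: "br x (sc c y) = sc c (br x y)"
    and br_self: "br x x = 0"
    and jacobi: "br x (br y z) + br y (br z x) + br z (br x y) = 0"

(* The underlying vector space, as input for tensor_power.  The bracket is stored as the product;
   a Lie algebra has no unit, so the field one is a dummy. *)
definition lie_module ::
    "('k \<Rightarrow> 'g::ab_group_add \<Rightarrow> 'g) \<Rightarrow> ('g \<Rightarrow> 'g \<Rightarrow> 'g) \<Rightarrow> ('k, 'g) module" where
  "lie_module sc br = \<lparr> carrier = UNIV, monoid.mult = br, one = 0, ring.zero = 0, add = (+),
     module.smult = sc \<rparr>"

(* The free monoid on 'g, written additively so that Poly_Mapping makes 'g fmonoid =>0 'k the free
   associative unital algebra on the set 'g. *)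
datatype 'g fmonoid = FM "'g list"

instantiation fmonoid :: (type) monoid_add
begin
definition zero_fmonoid :: "'g fmonoid" where
  "zero_fmonoid = FM []"
fun plus_fmonoid :: "'g fmonoid \<Rightarrow> 'g fmonoid \<Rightarrow> 'g fmonoid" where
  "plus_fmonoid (FM u) (FM v) = FM (u @ v)"
instance
proof
  fix a b c :: "'g fmonoid"
  show "a + b + c = a + (b + c)" by (cases a; cases b; cases c) simp
  show "0 + a = a" by (cases a) (simp add: zero_fmonoid_def)
  show "a + 0 = a" by (cases a) (simp add: zero_fmonoid_def)
qed
end

type_synonym ('k, 'g) env = "('g fmonoid \<Rightarrow>\<^sub>0 'k) set"
type_synonym ('k, 'g) tensor = "('g list \<Rightarrow>\<^sub>0 'k) set"
type_synonym ('k, 'g) env_tensor = "(('k, 'g) env list \<Rightarrow>\<^sub>0 'k) set"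

definition free_gen :: "'g \<Rightarrow> 'g fmonoid \<Rightarrow>\<^sub>0 'k::field" where
  "free_gen x = Poly_Mapping.single (FM [x]) 1"

(* The first two families of generators cut the free algebra on the set 'g down to the tensor
   algebra of the vector space 'g. *)
definition env_ideal ::
    "('k::field \<Rightarrow> 'g::ab_group_add \<Rightarrow> 'g) \<Rightarrow> ('g \<Rightarrow> 'g \<Rightarrow> 'g) \<Rightarrow> ('g fmonoid \<Rightarrow>\<^sub>0 'k) set" where
  "env_ideal sc br = Idl\<^bsub>ring_of_type_algebra\<^esub>
     (range (\<lambda>(x, y). free_gen (x + y) - free_gen x - free_gen y)
    \<union> range (\<lambda>(c, x). free_gen (sc c x) - Poly_Mapping.single 0 c * free_gen x)
    \<union> range (\<lambda>(x, y). free_gen x * free_gen y - free_gen y * free_gen x - free_gen (br x y)))"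

definition env_class ::
    "('k::field \<Rightarrow> 'g::ab_group_add \<Rightarrow> 'g) \<Rightarrow> ('g \<Rightarrow> 'g \<Rightarrow> 'g) \<Rightarrow> ('g fmonoid \<Rightarrow>\<^sub>0 'k) \<Rightarrow> ('k, 'g) env" where
  "env_class sc br p = env_ideal sc br +>\<^bsub>ring_of_type_algebra\<^esub> p"

definition env_alg ::
    "('k::field \<Rightarrow> 'g::ab_group_add \<Rightarrow> 'g) \<Rightarrow> ('g \<Rightarrow> 'g \<Rightarrow> 'g) \<Rightarrow> ('k, ('k, 'g) env) module" where
  "env_alg sc br = (let Q = ring_of_type_algebra Quot env_ideal sc br in \<lparr>
     carrier = carrier Q,
     monoid.mult = monoid.mult Q,
     one = \<one>\<^bsub>Q\<^esub>,
     ring.zero = \<zero>\<^bsub>Q\<^esub>,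
     add = add Q,
     module.smult = (\<lambda>c u. env_class sc br (Poly_Mapping.single 0 c) \<otimes>\<^bsub>Q\<^esub> u) \<rparr>)"

definition env_incl ::
    "('k::field \<Rightarrow> 'g::ab_group_add \<Rightarrow> 'g) \<Rightarrow> ('g \<Rightarrow> 'g \<Rightarrow> 'g) \<Rightarrow> 'g \<Rightarrow> ('k, 'g) env" where
  "env_incl sc br x = env_class sc br (free_gen x)"

definition env_power ::
    "('k::field \<Rightarrow> 'g::ab_group_add \<Rightarrow> 'g) \<Rightarrow> ('g \<Rightarrow> 'g \<Rightarrow> 'g) \<Rightarrow> nat \<Rightarrow>
     ('k, ('k, 'g) env_tensor) module" where
  "env_power sc br m = tensor_power (env_alg sc br) m"

definition lie_power ::
    "('k::field \<Rightarrow> 'g::ab_group_add \<Rightarrow> 'g) \<Rightarrow> ('g \<Rightarrow> 'g \<Rightarrow> 'g) \<Rightarrow> nat \<Rightarrow> ('k, ('k, 'g) tensor) module" where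
  "lie_power sc br m = tensor_power (lie_module sc br) m"

(* The canonical map from the m-th tensor power of the Lie algebra to that of its enveloping
   algebra (an inclusion, by Poincare-Birkhoff-Witt). *)
definition power_incl ::
    "('k::field \<Rightarrow> 'g::ab_group_add \<Rightarrow> 'g) \<Rightarrow> ('g \<Rightarrow> 'g \<Rightarrow> 'g) \<Rightarrow> nat \<Rightarrow>
     ('k, 'g) tensor \<Rightarrow> ('k, 'g) env_tensor" where
  "power_incl sc br m = tensor_lift (env_power sc br m)
     (\<lambda>xs. pure_tensor (env_alg sc br) (map (env_incl sc br) xs))"

(* The comultiplication on the Lie algebra: the standard comultiplication of the enveloping algebra
   is the algebra homomorphism taking these values on generators, and no other values are used. *)
definition comult ::
    "('k::field \<Rightarrow> 'g::ab_group_add \<Rightarrow> 'g) \<Rightarrow> ('g \<Rightarrow> 'g \<Rightarrow> 'g) \<Rightarrow> 'g \<Rightarrow> ('k, 'g) env_tensor" where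
  "comult sc br x = (let U = env_alg sc br in
     pure_tensor U [env_incl sc br x, \<one>\<^bsub>U\<^esub>]
       \<oplus>\<^bsub>env_power sc br 2\<^esub> pure_tensor U [\<one>\<^bsub>U\<^esub>, env_incl sc br x])"

(* t_{i,j} in the m-th tensor power of the enveloping algebra, positions counted from 1. *)
definition place ::
    "('k::field \<Rightarrow> 'g::ab_group_add \<Rightarrow> 'g) \<Rightarrow> ('g \<Rightarrow> 'g \<Rightarrow> 'g) \<Rightarrow> nat \<Rightarrow> nat \<Rightarrow> nat \<Rightarrow>
     ('k, 'g) tensor \<Rightarrow> ('k, 'g) env_tensor" where
  "place sc br m i j = tensor_lift (env_power sc br m)
     (\<lambda>xs. pure_tensor (env_alg sc br)
        (map (\<lambda>p. if p = i then env_incl sc br (xs ! 0)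
                  else if p = j then env_incl sc br (xs ! 1)
                  else \<one>\<^bsub>env_alg sc br\<^esub>) [1..<Suc m]))"

(* [[s,s]] *)
definition cyb ::
    "('k::field \<Rightarrow> 'g::ab_group_add \<Rightarrow> 'g) \<Rightarrow> ('g \<Rightarrow> 'g \<Rightarrow> 'g) \<Rightarrow>
     ('k, 'g) tensor \<Rightarrow> ('k, 'g) env_tensor" where
  "cyb sc br s = commutator (env_power sc br 3)
     (place sc br 3 1 2 s \<oplus>\<^bsub>env_power sc br 3\<^esub> place sc br 3 1 3 s)
     (place sc br 3 1 3 s \<oplus>\<^bsub>env_power sc br 3\<^esub> place sc br 3 2 3 s)"


section \<open>Lie bialgebras, classical r-matrices and classical Drinfeld twists\<close>

(* \<delta> \<otimes> id and id \<otimes> \<delta>, from the second to the third tensor power *)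
definition delta_id ::
    "('k::field \<Rightarrow> 'g::ab_group_add \<Rightarrow> 'g) \<Rightarrow> ('g \<Rightarrow> 'g \<Rightarrow> 'g) \<Rightarrow> ('g \<Rightarrow> ('k, 'g) tensor) \<Rightarrow>
     ('k, 'g) tensor \<Rightarrow> ('k, 'g) tensor" where
  "delta_id sc br \<delta> = tensor_lift (lie_power sc br 3)
     (\<lambda>xs. tensor_lift (lie_power sc br 3)
        (\<lambda>ys. pure_tensor (lie_module sc br) [ys ! 0, ys ! 1, xs ! 1]) (\<delta> (xs ! 0)))"

definition id_delta ::
    "('k::field \<Rightarrow> 'g::ab_group_add \<Rightarrow> 'g) \<Rightarrow> ('g \<Rightarrow> 'g \<Rightarrow> 'g) \<Rightarrow> ('g \<Rightarrow> ('k, 'g) tensor) \<Rightarrow>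
     ('k, 'g) tensor \<Rightarrow> ('k, 'g) tensor" where
  "id_delta sc br \<delta> = tensor_lift (lie_power sc br 3)
     (\<lambda>xs. tensor_lift (lie_power sc br 3)
        (\<lambda>ys. pure_tensor (lie_module sc br) [xs ! 0, ys ! 0, ys ! 1]) (\<delta> (xs ! 1)))"

abbreviation lie_swap ::
    "('k::field \<Rightarrow> 'g::ab_group_add \<Rightarrow> 'g) \<Rightarrow> ('g \<Rightarrow> 'g \<Rightarrow> 'g) \<Rightarrow> nat \<Rightarrow> nat \<Rightarrow> nat \<Rightarrow>
     ('k, 'g) tensor \<Rightarrow> ('k, 'g) tensor" where
  "lie_swap sc br \<equiv> tensor_swap (lie_module sc br)"

locale lie_bialgebra = lie_algebra sc br
  for sc :: "'k::field_char_0 \<Rightarrow> 'g::ab_group_add \<Rightarrow> 'g" and br :: "'g \<Rightarrow> 'g \<Rightarrow> 'g" +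
  fixes \<delta> :: "'g \<Rightarrow> ('k, 'g) tensor"
  assumes delta_closed: "\<delta> x \<in> carrier (lie_power sc br 2)"
    and delta_add: "\<delta> (x + y) = \<delta> x \<oplus>\<^bsub>lie_power sc br 2\<^esub> \<delta> y"
    and delta_scale: "\<delta> (sc c x) = c \<odot>\<^bsub>lie_power sc br 2\<^esub> \<delta> x"
    and cocycle: "power_incl sc br 2 (\<delta> (br x y)) =
        commutator (env_power sc br 2) (power_incl sc br 2 (\<delta> x)) (comult sc br y)
        \<ominus>\<^bsub>env_power sc br 2\<^esub>
        commutator (env_power sc br 2) (power_incl sc br 2 (\<delta> y)) (comult sc br x)"
    and skew: "lie_swap sc br 2 1 2 (\<delta> x) = \<ominus>\<^bsub>lie_power sc br 2\<^esub> \<delta> x"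
    and co_jacobi: "t = delta_id sc br \<delta> (\<delta> x) \<Longrightarrow>
        t \<oplus>\<^bsub>lie_power sc br 3\<^esub> lie_swap sc br 3 1 2 (lie_swap sc br 3 2 3 t)
          \<oplus>\<^bsub>lie_power sc br 3\<^esub> lie_swap sc br 3 2 3 (lie_swap sc br 3 1 2 t)
        = \<zero>\<^bsub>lie_power sc br 3\<^esub>"

locale classical_r_matrix = lie_bialgebra sc br \<delta>
  for sc :: "'k::field_char_0 \<Rightarrow> 'g::ab_group_add \<Rightarrow> 'g" and br :: "'g \<Rightarrow> 'g \<Rightarrow> 'g"
    and \<delta> :: "'g \<Rightarrow> ('k, 'g) tensor" +
  fixes r :: "('k, 'g) tensor"
  assumes r_closed: "r \<in> carrier (lie_power sc br 2)"
    and delta_eq: "power_incl sc br 2 (\<delta> x) =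
        commutator (env_power sc br 2) (power_incl sc br 2 r) (comult sc br x)"
    and cybe: "cyb sc br r = \<zero>\<^bsub>env_power sc br 3\<^esub>"

(* j^- *)
definition skew_part ::
    "('k::field \<Rightarrow> 'g::ab_group_add \<Rightarrow> 'g) \<Rightarrow> ('g \<Rightarrow> 'g \<Rightarrow> 'g) \<Rightarrow> ('k, 'g) tensor \<Rightarrow> ('k, 'g) tensor" where
  "skew_part sc br j = j \<ominus>\<^bsub>lie_power sc br 2\<^esub> lie_swap sc br 2 1 2 j"

locale classical_drinfeld_twist = lie_bialgebra sc br \<delta>
  for sc :: "'k::field_char_0 \<Rightarrow> 'g::ab_group_add \<Rightarrow> 'g" and br :: "'g \<Rightarrow> 'g \<Rightarrow> 'g"
    and \<delta> :: "'g \<Rightarrow> ('k, 'g) tensor" +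
  fixes j :: "('k, 'g) tensor"
  assumes j_closed: "j \<in> carrier (lie_power sc br 2)"
    and twist: "s = skew_part sc br j \<Longrightarrow>
        power_incl sc br 3
          (delta_id sc br \<delta> s \<ominus>\<^bsub>lie_power sc br 3\<^esub> id_delta sc br \<delta> s
            \<ominus>\<^bsub>lie_power sc br 3\<^esub> lie_swap sc br 3 2 3 (delta_id sc br \<delta> s))
        \<oplus>\<^bsub>env_power sc br 3\<^esub> cyb sc br s = \<zero>\<^bsub>env_power sc br 3\<^esub>"


section \<open>Direct sums of copies of a Lie bialgebra\<close>

(* The direct sum of n copies of 'g is 'g^'n, where 'n is a linearly ordered type with n elements;
   axis i is the inclusion of the i-th summand. *)

definition sum_scale :: "('k \<Rightarrow> 'g \<Rightarrow> 'g) \<Rightarrow> 'k \<Rightarrow> 'g^'n \<Rightarrow> 'g^'n" where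
  "sum_scale sc c x = (\<chi> i. sc c (x $ i))"

definition sum_bracket :: "('g \<Rightarrow> 'g \<Rightarrow> 'g) \<Rightarrow> 'g^'n \<Rightarrow> 'g^'n \<Rightarrow> 'g^'n" where
  "sum_bracket br x y = (\<chi> i. br (x $ i) (y $ i))"

(* t \<mapsto> t_{i, n+k}: in the enveloping algebra of the direct sum, i.e. the n-th tensor power of that
   of 'g, an x in position i is axis i x.  Hence t_{i, n+k} is the image of t under
   axis i \<otimes> axis k. *)
definition axis_tensor ::
    "('k::field \<Rightarrow> 'g::ab_group_add \<Rightarrow> 'g) \<Rightarrow> ('g \<Rightarrow> 'g \<Rightarrow> 'g) \<Rightarrow> 'n::finite \<Rightarrow> 'n \<Rightarrow>
     ('k, 'g) tensor \<Rightarrow> ('k, 'g^'n) tensor" where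
  "axis_tensor sc br i k = tensor_lift (lie_power (sum_scale sc) (sum_bracket br) 2)
     (\<lambda>xs. pure_tensor (lie_module (sum_scale sc) (sum_bracket br))
        [axis i (xs ! 0), axis k (xs ! 1)])"

definition sum_cobracket ::
    "('k::field \<Rightarrow> 'g::ab_group_add \<Rightarrow> 'g) \<Rightarrow> ('g \<Rightarrow> 'g \<Rightarrow> 'g) \<Rightarrow> ('g \<Rightarrow> ('k, 'g) tensor) \<Rightarrow>
     'g^('n::finite) \<Rightarrow> ('k, 'g^'n) tensor" where
  "sum_cobracket sc br \<delta> x =
     finsum (lie_power (sum_scale sc) (sum_bracket br) 2)
       (\<lambda>i. axis_tensor sc br i i (\<delta> (x $ i))) UNIV"

definition transitive_colouring :: "('n::linorder \<Rightarrow> 'n \<Rightarrow> 'c) \<Rightarrow> bool" where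
  "transitive_colouring col \<longleftrightarrow>
     (\<forall>i j k. i < j \<longrightarrow> j < k \<longrightarrow> col i k \<in> {col i j, col j k})"

definition colour_twist ::
    "('k::field \<Rightarrow> 'g::ab_group_add \<Rightarrow> 'g) \<Rightarrow> ('g \<Rightarrow> 'g \<Rightarrow> 'g) \<Rightarrow> ('c \<Rightarrow> ('k, 'g) tensor) \<Rightarrow>
     ('n \<Rightarrow> 'n \<Rightarrow> 'c) \<Rightarrow> ('k, 'g^('n::{finite,linorder})) tensor" where
  "colour_twist sc br r col =
     finsum (lie_power (sum_scale sc) (sum_bracket br) 2)
       (\<lambda>(i, j). axis_tensor sc br j i (r (col i j))) {(i, j). i < j}"

end

(* Fix one r-matrix of the family and let R be the sum over p of its copies in positions (p, n+p), so
   that the cobracket of the direct sum is [R, Delta(-)].  For s = j^- the three cobracket terms of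
   the twist equation are [R12, s13 + s23], [R23, s12 + s13] and [R13, s12 + s32], and since s is skew
   the twist expression is [[R + s, R + s]] - [[R, R]].

   Now R + s is the sum over all (p, q) of sigma_pq in positions (p, n+q), where sigma_pq is
   r^(c(q,p)) for q < p, minus the flip of r^(c(p,q)) for p < q, and the fixed r-matrix for p = q; each
   sigma_pq is an r-matrix for delta.  Commutators of copies in different summands vanish, so
   [[R + s, R + s]] is a sum over triples (p, q, l) of copies of [A12, B13] + [A12, D23] + [B13, D23]
   with A = sigma_pq, B = sigma_pl, D = sigma_ql.  As [A12, B13 + B23] does not depend on the r-matrix
   A (it is the cobracket applied to the first factor of B), and similarly in the other positions,
   this vanishes if A = B, if B = D, or if D is minus the flip of A; transitivity of the colouring
   says that one of the three always holds.

   Tensors are handled through representatives in the free vector space on lists, on which all maps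
   are linear extensions.  Equations in tensor powers of the enveloping algebra become membership in
   the kernel of the canonical map from the tensor power of the Lie algebra. *)

theory Submission
  imports Defs
begin


section \<open>Linear extension to free vector spaces\<close>

text \<open>A representative can vanish in two senses: modulo \<open>tensor_rel\<close>, as an
  element of a tensor power of the Lie algebra, and modulo \<open>incl_kernel\<close>, after mapping
  to the enveloping algebra. Skewness and co-Jacobi are posed in the first sense; the cocycle
  condition, the classical Yang-Baxter equation and the twist equation in the second. This decides
  how the direct sum becomes a bialgebra: linearity, skewness and co-Jacobi are carried over from
  the summands modulo \<open>tensor_rel\<close>, whereas the cocycle condition follows from the
  coboundary form given by the diagonal r-matrix. Membership in \<open>incl_kernel\<close> only
  asserts a relation between images in the enveloping algebra. An operation is shown to preserve it
  by extending the operation to enveloping algebras; for inclusions of summands this is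
  functoriality. The passage from s to R + s is a completion of the square: the three cobracket
  terms are the cross terms of a quadratic expression.\<close>

lemma lookup_fscale [simp]: "Poly_Mapping.lookup (fscale c p) x = c * Poly_Mapping.lookup p x"
  by (simp add: fscale_def Poly_Mapping.map.rep_eq when_def)

interpretation fs: vector_space "fscale :: 'k::field \<Rightarrow> ('x \<Rightarrow>\<^sub>0 'k) \<Rightarrow> ('x \<Rightarrow>\<^sub>0 'k)"
  by unfold_locales
    (auto intro!: poly_mapping_eqI simp: lookup_add algebra_simps)

lemma fscale_single [simp]: "fscale c (Poly_Mapping.single x a) = Poly_Mapping.single x (c * a)"
  by (auto intro!: poly_mapping_eqI simp: lookup_single when_def)

abbreviation basis :: "'x \<Rightarrow> 'x \<Rightarrow>\<^sub>0 'k::field" where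
  "basis x \<equiv> Poly_Mapping.single x 1"

definition lext :: "('x \<Rightarrow> 'y \<Rightarrow>\<^sub>0 'k::field) \<Rightarrow> ('x \<Rightarrow>\<^sub>0 'k) \<Rightarrow> 'y \<Rightarrow>\<^sub>0 'k" where
  "lext f p = (\<Sum>x\<in>Poly_Mapping.keys p. fscale (Poly_Mapping.lookup p x) (f x))"

text \<open>Supports can shrink under addition, so linearity of \<open>lext\<close> is proved by
  summing over a common finite superset.\<close>

lemma lext_superset:
  assumes "finite S" "Poly_Mapping.keys p \<subseteq> S"
  shows "lext f p = (\<Sum>x\<in>S. fscale (Poly_Mapping.lookup p x) (f x))"
  unfolding lext_def
  by (rule sum.mono_neutral_left) (use assms in \<open>auto simp: in_keys_iff\<close>)

lemma lext_add: "lext f (p + q) = lext f p + lext f q"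
proof -
  let ?S = "Poly_Mapping.keys p \<union> Poly_Mapping.keys q"
  have *: "Poly_Mapping.keys (p + q) \<subseteq> ?S" by (rule Poly_Mapping.keys_add)
  show ?thesis
    using * by (simp add: lext_superset[of ?S] lookup_add fs.scale_left_distrib sum.distrib)
qed

lemma lext_fscale: "lext f (fscale c p) = fscale c (lext f p)"
proof -
  have "Poly_Mapping.keys (fscale c p) \<subseteq> Poly_Mapping.keys p"
    by (auto simp: in_keys_iff)
  then show ?thesis
    by (simp add: lext_superset[of "Poly_Mapping.keys p"] fs.scale_sum_right)
qed

lemma lext_0 [simp]: "lext f 0 = 0"
  by (simp add: lext_def)

lemma lext_uminus: "lext f (- p) = - lext f p"
  using lext_add[of f p "- p"] by (simp add: eq_neg_iff_add_eq_0 add.commute)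

lemma lext_diff: "lext f (p - q) = lext f p - lext f q"
  using lext_add[of f p "- q"] by (simp add: lext_uminus)

lemma lext_sum: "lext f (sum g S) = (\<Sum>i\<in>S. lext f (g i))"
  by (induction S rule: infinite_finite_induct) (auto simp: lext_add)

lemmas lext_linear = lext_add lext_fscale lext_uminus lext_diff lext_sum

lemma lext_single [simp]: "lext f (Poly_Mapping.single x c) = fscale c (f x)"
  by (cases "c = 0") (auto simp: lext_def)

lemma lext_cong:
  "(\<And>x. x \<in> Poly_Mapping.keys p \<Longrightarrow> f x = g x) \<Longrightarrow> lext f p = lext g p"
  by (simp add: lext_def)

lemma lext_fun_add: "lext (\<lambda>x. f x + g x) p = lext f p + lext g p"
  by (simp add: lext_def fs.scale_right_distrib sum.distrib)

lemma lext_fun_diff: "lext (\<lambda>x. f x - g x) p = lext f p - lext g p"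
  by (simp add: lext_def fs.scale_right_diff_distrib sum_subtractf)

lemma lext_fun_uminus: "lext (\<lambda>x. - f x) p = - lext f p"
  by (simp add: lext_def sum_negf)

lemma lext_fun_0 [simp]: "lext (\<lambda>x. 0) p = 0"
  by (simp add: lext_def)

lemma lext_fun_fscale: "lext (\<lambda>x. fscale c (f x)) p = fscale c (lext f p)"
  by (simp add: lext_def fs.scale_sum_right mult.commute)

lemma lext_fun_sum: "lext (\<lambda>x. \<Sum>i\<in>S. f i x) p = (\<Sum>i\<in>S. lext (f i) p)"
  by (induction S rule: infinite_finite_induct) (auto simp: lext_fun_add)

lemmas lext_fun = lext_fun_add lext_fun_diff lext_fun_uminus lext_fun_fscale lext_fun_sum

lemma lext_lext: "lext f (lext g p) = lext (\<lambda>x. lext f (g x)) p"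
  by (simp add: lext_def[of g] lext_def[of "\<lambda>x. lext f (g x)"] lext_linear)

lemma lext_basis [simp]: "lext basis p = p"
proof (rule poly_mapping_eqI)
  fix k
  show "Poly_Mapping.lookup (lext basis p) k = Poly_Mapping.lookup p k"
    by (cases "k \<in> Poly_Mapping.keys p")
      (auto simp: lext_def lookup_sum lookup_single when_def in_keys_iff sum.delta cong: if_cong)
qed

lemma lext_commute: "lext (\<lambda>x. lext (\<lambda>y. f x y) q) p = lext (\<lambda>y. lext (\<lambda>x. f x y) p) q"
  unfolding lext_def fs.scale_sum_right
  by (subst sum.swap) (simp add: mult.commute)

lemma lext_mem:
  assumes "fs.subspace S" "\<And>x. x \<in> Poly_Mapping.keys p \<Longrightarrow> f x \<in> S"
  shows "lext f p \<in> S"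
  unfolding lext_def using assms by (auto intro!: fs.subspace_sum fs.subspace_scale)

lemma subspace_lext_vimage:
  "fs.subspace S \<Longrightarrow> fs.subspace {p. lext f p \<in> S}"
  by (rule fs.subspaceI)
    (auto simp: lext_linear intro: fs.subspace_0 fs.subspace_add fs.subspace_scale)

lemma subspace_keys: "fs.subspace {p :: 'x \<Rightarrow>\<^sub>0 'k::field. Poly_Mapping.keys p \<subseteq> S}"
proof (rule fs.subspaceI)
  fix p q :: "'x \<Rightarrow>\<^sub>0 'k::field"
  assume "p \<in> {p. Poly_Mapping.keys p \<subseteq> S}" "q \<in> {p. Poly_Mapping.keys p \<subseteq> S}"
  then show "p + q \<in> {p. Poly_Mapping.keys p \<subseteq> S}"
    using Poly_Mapping.keys_add[of p q] by blast
qed (auto simp: subset_iff in_keys_iff)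


section \<open>Tensor powers through representatives\<close>

definition tensor_sums :: "('k::field, 'v) module \<Rightarrow> nat \<Rightarrow> ('v list \<Rightarrow>\<^sub>0 'k) set" where
  "tensor_sums A m = {p. Poly_Mapping.keys p \<subseteq> tuples A m}"

definition tcls :: "('k::field, 'v) module \<Rightarrow> nat \<Rightarrow> ('v list \<Rightarrow>\<^sub>0 'k) \<Rightarrow> ('v list \<Rightarrow>\<^sub>0 'k) set" where
  "tcls A m p = a_r_coset (formal_sums A m) (tensor_rel A m) p"

lemma subspace_tensor_sums: "fs.subspace (tensor_sums A m)"
  unfolding tensor_sums_def by (rule subspace_keys)

lemma subspace_tensor_rel: "fs.subspace (tensor_rel A m)"
  unfolding tensor_rel_def by (rule fs.subspace_span)

lemma tensor_sums_closed [simp]: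
  "0 \<in> tensor_sums A m"
  "p \<in> tensor_sums A m \<Longrightarrow> q \<in> tensor_sums A m \<Longrightarrow> p + q \<in> tensor_sums A m"
  "p \<in> tensor_sums A m \<Longrightarrow> q \<in> tensor_sums A m \<Longrightarrow> p - q \<in> tensor_sums A m"
  "p \<in> tensor_sums A m \<Longrightarrow> - p \<in> tensor_sums A m"
  "p \<in> tensor_sums A m \<Longrightarrow> fscale c p \<in> tensor_sums A m"
  "(\<And>i. i \<in> I \<Longrightarrow> f i \<in> tensor_sums A m) \<Longrightarrow> sum f I \<in> tensor_sums A m"
  using subspace_tensor_sums[of A m]
  by (auto intro: fs.subspace_0 fs.subspace_add fs.subspace_diff fs.subspace_neg fs.subspace_scale fs.subspace_sum)

lemma single_in_tensor_sums: "xs \<in> tuples A m \<Longrightarrow> Poly_Mapping.single xs c \<in> tensor_sums A m"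
  by (simp add: tensor_sums_def)

lemma lext_in_tensor_sums:
  assumes "p \<in> tensor_sums A m" "\<And>xs. xs \<in> tuples A m \<Longrightarrow> f xs \<in> tensor_sums B n"
  shows "lext f p \<in> tensor_sums B n"
  by (rule lext_mem[OF subspace_tensor_sums]) (use assms in \<open>auto simp: tensor_sums_def\<close>)

lemma tcls_alt: "tcls A m p = {n + p |n. n \<in> tensor_rel A m}"
  by (auto simp: tcls_def a_r_coset_def r_coset_def formal_sums_def)

lemma tcls_eq_iff: "tcls A m p = tcls A m q \<longleftrightarrow> p - q \<in> tensor_rel A m"
proof
  assume "tcls A m p = tcls A m q"
  moreover have "p \<in> tcls A m p"
    using fs.subspace_0[OF subspace_tensor_rel] by (force simp: tcls_alt)
  ultimately show "p - q \<in> tensor_rel A m" by (auto simp: tcls_alt)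
next
  assume *: "p - q \<in> tensor_rel A m"
  have "n + p \<in> tcls A m q" if "n \<in> tensor_rel A m" for n
    using fs.subspace_add[OF subspace_tensor_rel that *]
    unfolding tcls_alt by (auto intro!: exI[of _ "n + (p - q)"])
  moreover have "n + q \<in> tcls A m p" if "n \<in> tensor_rel A m" for n
    using fs.subspace_diff[OF subspace_tensor_rel that *]
    unfolding tcls_alt by (auto intro!: exI[of _ "n - (p - q)"])
  ultimately show "tcls A m p = tcls A m q"
    by (auto simp: tcls_alt[of A m p] tcls_alt[of A m q])
qed

lemma carrier_tensor_power: "carrier (tensor_power A m) = tcls A m ` tensor_sums A m"
  by (auto simp: tensor_power_def FactRing_def A_RCOSETS_def RCOSETS_def Let_def
      tcls_def a_r_coset_def tensor_sums_def formal_sums_def)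

lemma zero_tensor_power: "\<zero>\<^bsub>tensor_power A m\<^esub> = tcls A m 0"
  by (simp add: tensor_power_def FactRing_def Let_def tcls_alt)

lemma add_tcls: "tcls A m p \<oplus>\<^bsub>tensor_power A m\<^esub> tcls A m q = tcls A m (p + q)"
proof -
  have "tcls A m p \<oplus>\<^bsub>tensor_power A m\<^esub> tcls A m q =
    {(n + p) + (n' + q) |n n'. n \<in> tensor_rel A m \<and> n' \<in> tensor_rel A m}"
    by (auto simp: tensor_power_def FactRing_def Let_def set_add_def set_mult_def tcls_alt
        formal_sums_def)
  also have "\<dots> = tcls A m (p + q)"
  proof -
    have "\<exists>n''. (n + p) + (n' + q) = n'' + (p + q) \<and> n'' \<in> tensor_rel A m"
      if "n \<in> tensor_rel A m" "n' \<in> tensor_rel A m" for n n'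
      by (rule exI[of _ "n + n'"])
        (use that fs.subspace_add[OF subspace_tensor_rel] in \<open>auto simp: algebra_simps\<close>)
    moreover have "\<exists>n' n''. n + (p + q) = (n' + p) + (n'' + q) \<and>
        n' \<in> tensor_rel A m \<and> n'' \<in> tensor_rel A m"
      if "n \<in> tensor_rel A m" for n
      by (rule exI[of _ n], rule exI[of _ 0])
        (use that fs.subspace_0[OF subspace_tensor_rel] in \<open>auto simp: algebra_simps\<close>)
    ultimately show ?thesis unfolding tcls_alt by blast
  qed
  finally show ?thesis .
qed

lemma smult_tcls: "c \<odot>\<^bsub>tensor_power A m\<^esub> tcls A m p = tcls A m (fscale c p)"
proof -
  have "c \<odot>\<^bsub>tensor_power A m\<^esub> tcls A m p = (\<Union>p'\<in>tcls A m p. tcls A m (fscale c p'))"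
    by (simp add: tensor_power_def Let_def tcls_def)
  also have "\<dots> = tcls A m (fscale c p)"
  proof -
    have "tcls A m (fscale c p') = tcls A m (fscale c p)" if p': "p' \<in> tcls A m p" for p'
    proof -
      from p' obtain n where "n \<in> tensor_rel A m" "p' = n + p" by (auto simp: tcls_alt)
      then show ?thesis
        using fs.subspace_scale[OF subspace_tensor_rel]
        by (simp add: tcls_eq_iff fs.scale_right_distrib)
    qed
    moreover have "p \<in> tcls A m p"
      using fs.subspace_0[OF subspace_tensor_rel] by (force simp: tcls_alt)
    ultimately show ?thesis by blast
  qed
  finally show ?thesis .
qed

text \<open>The product stored in a Lie module is the bracket, so \<open>formal_sums\<close> need
  not be a ring and the quotient cannot be treated as a quotient ring. The group laws are read off
  from representatives.\<close>

lemma abelian_group_tensor_power: "abelian_group (tensor_power A m)"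
proof (rule abelian_groupI)
  fix x assume "x \<in> carrier (tensor_power A m)"
  then obtain p where p: "p \<in> tensor_sums A m" "x = tcls A m p" by (auto simp: carrier_tensor_power)
  then show "\<exists>y\<in>carrier (tensor_power A m). y \<oplus>\<^bsub>tensor_power A m\<^esub> x = \<zero>\<^bsub>tensor_power A m\<^esub>"
    by (intro bexI[of _ "tcls A m (- p)"])
      (auto simp: carrier_tensor_power zero_tensor_power add_tcls)
qed (auto simp: carrier_tensor_power zero_tensor_power add_tcls algebra_simps)

lemma tcls_in_carrier [simp]: "p \<in> tensor_sums A m \<Longrightarrow> tcls A m p \<in> carrier (tensor_power A m)"
  by (simp add: carrier_tensor_power)

lemma uminus_tcls:
  assumes "p \<in> tensor_sums A m"
  shows "\<ominus>\<^bsub>tensor_power A m\<^esub> tcls A m p = tcls A m (- p)"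
  by (rule abelian_group.minus_equality[OF abelian_group_tensor_power])
    (use assms in \<open>auto simp: zero_tensor_power add_tcls\<close>)

lemma diff_tcls:
  "q \<in> tensor_sums A m \<Longrightarrow>
    tcls A m p \<ominus>\<^bsub>tensor_power A m\<^esub> tcls A m q = tcls A m (p - q)"
  by (simp add: a_minus_def uminus_tcls add_tcls)

lemma finsum_tcls:
  assumes "finite S" "\<And>i. i \<in> S \<Longrightarrow> f i \<in> tensor_sums A m" "\<And>i. i \<in> S \<Longrightarrow> g i = tcls A m (f i)"
  shows "finsum (tensor_power A m) g S = tcls A m (sum f S)"
  using assms
proof (induction S rule: finite_induct)
  case empty
  interpret abelian_group "tensor_power A m" by (rule abelian_group_tensor_power)
  show ?case by (simp add: zero_tensor_power)
next
  case (insert x S)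
  interpret abelian_group "tensor_power A m" by (rule abelian_group_tensor_power)
  have "g \<in> S \<rightarrow> carrier (tensor_power A m)" "g x \<in> carrier (tensor_power A m)"
    using insert.prems by auto
  then have "finsum (tensor_power A m) g (insert x S) =
      g x \<oplus>\<^bsub>tensor_power A m\<^esub> finsum (tensor_power A m) g S"
    by (intro finsum_insert insert.hyps)
  then show ?case using insert by (simp add: add_tcls)
qed

lemma pure_tensor_tcls: "length xs = m \<Longrightarrow> pure_tensor A xs = tcls A m (basis xs)"
  by (simp add: pure_tensor_def tcls_def)

text \<open>Distinct lists are linearly independent in the free vector space, so a map given by
  lists is multilinear at best up to the relations of its target. The subspace \<open>S\<close>
  absorbs this defect.\<close>

definition multilinear_mod ::
    "('k::field, 'v) module \<Rightarrow> nat \<Rightarrow> ('y \<Rightarrow>\<^sub>0 'k) set \<Rightarrow> ('v list \<Rightarrow> 'y \<Rightarrow>\<^sub>0 'k) \<Rightarrow> bool" where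
  "multilinear_mod A m S f \<longleftrightarrow> (\<forall>xs\<in>tuples A m. \<forall>i<m. \<forall>a\<in>carrier A.
     (\<forall>b\<in>carrier A. f (xs[i := a \<oplus>\<^bsub>A\<^esub> b]) - f (xs[i := a]) - f (xs[i := b]) \<in> S) \<and>
     (\<forall>c. f (xs[i := c \<odot>\<^bsub>A\<^esub> a]) - fscale c (f (xs[i := a])) \<in> S))"

lemma lext_tensor_rel:
  assumes "fs.subspace S" "multilinear_mod A m S f" "p \<in> tensor_rel A m"
  shows "lext f p \<in> S"
proof -
  have "tensor_rel A m \<subseteq> {p. lext f p \<in> S}"
    unfolding tensor_rel_def
  proof (rule fs.span_minimal[OF _ subspace_lext_vimage[OF assms(1)]], safe)
    fix xs i a b assume *: "xs \<in> tuples A m" "i < m" "a \<in> carrier A" "b \<in> carrier A"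
    then show "lext f (basis (xs[i := a \<oplus>\<^bsub>A\<^esub> b]) - basis (xs[i := a]) - basis (xs[i := b])) \<in> S"
      using assms(2) by (simp add: lext_diff multilinear_mod_def)
  next
    fix xs i a c assume *: "xs \<in> tuples A m" "i < m" "a \<in> carrier A"
    then show "lext f (basis (xs[i := c \<odot>\<^bsub>A\<^esub> a]) - Poly_Mapping.single (xs[i := a]) c) \<in> S"
      using assms(2) by (simp add: lext_diff multilinear_mod_def)
  qed
  then show ?thesis using assms(3) by blast
qed

lemma tensor_rel_add:
  "xs \<in> tuples A m \<Longrightarrow> i < m \<Longrightarrow> a \<in> carrier A \<Longrightarrow> b \<in> carrier A \<Longrightarrow>
    basis (xs[i := a \<oplus>\<^bsub>A\<^esub> b]) - basis (xs[i := a]) - basis (xs[i := b]) \<in> tensor_rel A m"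
  unfolding tensor_rel_def by (rule fs.span_base) blast

lemma tensor_rel_smult:
  "xs \<in> tuples A m \<Longrightarrow> i < m \<Longrightarrow> a \<in> carrier A \<Longrightarrow>
    basis (xs[i := c \<odot>\<^bsub>A\<^esub> a]) - fscale c (basis (xs[i := a])) \<in> tensor_rel A m"
  unfolding tensor_rel_def by (rule fs.span_base) (simp; blast)

text \<open>The common ground of the two kinds of tensor factor, a Lie algebra as a bare vector
  space and an enveloping algebra. Closure keeps the generators of \<open>tensor_rel\<close> inside
  \<open>tensor_sums\<close>.\<close>

locale k_closed =
  fixes A :: "('k::field, 'v) module"
  assumes add_closed [simp]: "a \<in> carrier A \<Longrightarrow> b \<in> carrier A \<Longrightarrow> a \<oplus>\<^bsub>A\<^esub> b \<in> carrier A"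
    and smult_closed [simp]: "a \<in> carrier A \<Longrightarrow> c \<odot>\<^bsub>A\<^esub> a \<in> carrier A"
begin

lemma tuples_update: "xs \<in> tuples A m \<Longrightarrow> a \<in> carrier A \<Longrightarrow> xs[i := a] \<in> tuples A m"
  using set_update_subset_insert[of xs i a] by (auto simp: tuples_def)

lemma tensor_rel_subset: "tensor_rel A m \<subseteq> tensor_sums A m"
  unfolding tensor_rel_def
  by (rule fs.span_minimal[OF _ subspace_tensor_sums])
    (auto intro!: tensor_sums_closed single_in_tensor_sums tuples_update)

text \<open>The bridge from \<open>tensor_lift\<close>, which evaluates at a chosen representative,
  to \<open>lext\<close> at any given one: the two representatives differ by a relation, and
  \<open>lext f'\<close> sends relations to relations.\<close>

lemma tensor_lift_tcls:
  assumes p: "p \<in> tensor_sums A m"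
    and f': "multilinear_mod A m (tensor_rel B n) f'"
    and f: "\<And>xs. xs \<in> tuples A m \<Longrightarrow> f' xs \<in> tensor_sums B n"
      "\<And>xs. xs \<in> tuples A m \<Longrightarrow> f xs = tcls B n (f' xs)"
  shows "tensor_lift (tensor_power B n) f (tcls A m p) = tcls B n (lext f' p)"
proof -
  define p' where "p' = (SOME p'. p' \<in> tcls A m p)"
  have "p \<in> tcls A m p"
    using fs.subspace_0[OF subspace_tensor_rel] by (force simp: tcls_alt)
  then have "p' \<in> tcls A m p" unfolding p'_def by (rule someI)
  then obtain n' where n': "n' \<in> tensor_rel A m" "p' = n' + p" by (auto simp: tcls_alt)
  \<comment> \<open>Relations are supported on tuples, hence so is the chosen representative; only
    on tuples is \<open>f\<close> known to be represented by \<open>f'\<close>.\<close>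
  then have keys: "Poly_Mapping.keys p' \<subseteq> tuples A m"
    using p tensor_rel_subset tensor_sums_closed(2) by (fastforce simp: tensor_sums_def)
  have "tensor_lift (tensor_power B n) f (tcls A m p) =
      finsum (tensor_power B n)
        (\<lambda>xs. Poly_Mapping.lookup p' xs \<odot>\<^bsub>tensor_power B n\<^esub> f xs) (Poly_Mapping.keys p')"
    by (simp add: tensor_lift_def p'_def Let_def)
  also have "\<dots> = tcls B n (lext f' p')"
    unfolding lext_def
    by (rule finsum_tcls) (use keys f in \<open>auto simp: smult_tcls\<close>)
  also have "\<dots> = tcls B n (lext f' p)"
    using lext_tensor_rel[OF subspace_tensor_rel f' n'(1)] n'(2) by (simp add: tcls_eq_iff lext_linear)
  finally show ?thesis .
qed

end



section \<open>Enveloping algebras\<close>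

lemma ring_of_type_algebra_simps [simp]:
  "carrier (ring_of_type_algebra :: 'a::ring_1 ring) = UNIV"
  "x \<otimes>\<^bsub>(ring_of_type_algebra :: 'a::ring_1 ring)\<^esub> y = x * y"
  "x \<oplus>\<^bsub>(ring_of_type_algebra :: 'a::ring_1 ring)\<^esub> y = x + y"
  "\<one>\<^bsub>(ring_of_type_algebra :: 'a::ring_1 ring)\<^esub> = 1"
  "\<zero>\<^bsub>(ring_of_type_algebra :: 'a::ring_1 ring)\<^esub> = 0"
  by (simp_all add: ring_of_type_algebra_def)

lemma ring_ring_of_type_algebra: "ring (ring_of_type_algebra :: 'a::ring_1 ring)"
proof (rule ringI)
  show "abelian_group (ring_of_type_algebra :: 'a ring)"
    by (rule abelian_groupI) (auto simp: algebra_simps intro: exI[of _ "- x" for x])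
  show "monoid (ring_of_type_algebra :: 'a ring)"
    by (rule monoidI) (auto simp: algebra_simps)
qed (auto simp: algebra_simps)

lemma a_inv_ring_of_type_algebra [simp]:
  "\<ominus>\<^bsub>(ring_of_type_algebra :: 'a::ring_1 ring)\<^esub> x = - x"
  by (rule abelian_group.minus_equality[OF ring.is_abelian_group[OF ring_ring_of_type_algebra]]) auto

lemma ideal_ring_of_type_algebra_iff:
  "ideal I (ring_of_type_algebra :: 'a::ring_1 ring) \<longleftrightarrow>
     0 \<in> I \<and> (\<forall>a\<in>I. \<forall>b\<in>I. a + b \<in> I) \<and> (\<forall>a\<in>I. \<forall>x. x * a \<in> I \<and> a * x \<in> I)"
  (is "?L \<longleftrightarrow> ?R")
proof
  assume ?L
  then interpret ideal I "ring_of_type_algebra :: 'a ring" .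
  show ?R
    using additive_subgroup.zero_closed[OF additive_subgroup_axioms]
      additive_subgroup.a_closed[OF additive_subgroup_axioms] I_l_closed I_r_closed by auto
next
  assume R: ?R
  have "- 1 * a \<in> I" if "a \<in> I" for a
    using R that by blast
  then have neg: "- a \<in> I" if "a \<in> I" for a
    using that by simp
  show ?L
  proof (rule idealI[OF ring_ring_of_type_algebra])
    show "subgroup I (add_monoid (ring_of_type_algebra :: 'a ring))"
    proof (rule group.subgroupI)
      show "group (add_monoid (ring_of_type_algebra :: 'a ring))"
        by (rule abelian_group.a_group[OF ring.is_abelian_group[OF ring_ring_of_type_algebra]])
      show "inv\<^bsub>add_monoid ring_of_type_algebra\<^esub> a \<in> I" if "a \<in> I" for a
        using neg[OF that] a_inv_ring_of_type_algebra[of a] unfolding a_inv_def by simp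
    qed (use R in auto)
  qed (use R in auto)
qed

text \<open>Brings the convolution product under the calculus of \<open>lext\<close>;
  multiplicativity of \<open>free_map\<close> then reduces to words.\<close>

lemma mult_eq_lext:
  fixes p q :: "'x::monoid_add \<Rightarrow>\<^sub>0 'k::field"
  shows "p * q = lext (\<lambda>u. lext (\<lambda>v. basis (u + v)) q) p"
proof -
  have "p * q = lext basis p * lext basis q" by simp
  also have "\<dots> = lext (\<lambda>u. lext (\<lambda>v. basis (u + v)) q) p"
    by (simp add: lext_def sum_distrib_left sum_distrib_right mult_single fs.scale_sum_right
        del: lext_basis) (rule sum.swap)
  finally show ?thesis .
qed

lemma single_0_mult: "Poly_Mapping.single 0 c * p = fscale c p"
  for p :: "'x::monoid_add \<Rightarrow>\<^sub>0 'k::field"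
  using lext_fun_fscale[of c basis p] by (simp add: mult_eq_lext)

lemma mult_single_0: "p * Poly_Mapping.single 0 c = fscale c p"
  for p :: "'x::monoid_add \<Rightarrow>\<^sub>0 'k::field"
  using lext_fun_fscale[of c basis p] by (simp add: mult_eq_lext)

lemma fscale_mult_left: "fscale c p * q = fscale c (p * q)"
  for p q :: "'x::monoid_add \<Rightarrow>\<^sub>0 'k::field"
  by (simp add: mult.assoc flip: single_0_mult)

lemma fscale_mult_right: "p * fscale c q = fscale c (p * q)"
  for p q :: "'x::monoid_add \<Rightarrow>\<^sub>0 'k::field"
  by (simp add: mult.assoc flip: mult_single_0)

context
  fixes sc :: "'k::field \<Rightarrow> 'g::ab_group_add \<Rightarrow> 'g" and br :: "'g \<Rightarrow> 'g \<Rightarrow> 'g"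
begin

lemma ideal_env_ideal: "ideal (env_ideal sc br) ring_of_type_algebra"
  unfolding env_ideal_def
  by (rule ring.genideal_ideal[OF ring_ring_of_type_algebra]) simp

lemmas env_ideal_closed = ideal_env_ideal[unfolded ideal_ring_of_type_algebra_iff]

lemma env_ideal_uminus: "p \<in> env_ideal sc br \<Longrightarrow> - p \<in> env_ideal sc br"
proof -
  assume "p \<in> env_ideal sc br"
  then have "- 1 * p \<in> env_ideal sc br" using env_ideal_closed by blast
  then show ?thesis by simp
qed

lemma env_ideal_gens:
  "free_gen (x + y) - free_gen x - free_gen y \<in> env_ideal sc br"
  "free_gen (sc c x) - Poly_Mapping.single 0 c * free_gen x \<in> env_ideal sc br"
  "free_gen x * free_gen y - free_gen y * free_gen x - free_gen (br x y) \<in> env_ideal sc br"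
  using ring.genideal_self[OF ring_ring_of_type_algebra,
      of "range (\<lambda>(x, y). free_gen (x + y) - free_gen x - free_gen y)
        \<union> range (\<lambda>(c, x). free_gen (sc c x) - Poly_Mapping.single 0 c * free_gen x)
        \<union> range (\<lambda>(x, y). free_gen x * free_gen y - free_gen y * free_gen x - free_gen (br x y))"]
  unfolding env_ideal_def by (simp, blast)+

lemma env_class_alt: "env_class sc br p = {n + p |n. n \<in> env_ideal sc br}"
  by (auto simp: env_class_def a_r_coset_def r_coset_def)

lemma env_class_self: "p \<in> env_class sc br p"
  using env_ideal_closed by (force simp: env_class_alt)

lemma env_class_eq_iff: "env_class sc br p = env_class sc br q \<longleftrightarrow> p - q \<in> env_ideal sc br"
proof
  assume "env_class sc br p = env_class sc br q"
  with env_class_self[of p] have "p \<in> env_class sc br q" by blast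
  then show "p - q \<in> env_ideal sc br" by (auto simp: env_class_alt)
next
  assume *: "p - q \<in> env_ideal sc br"
  have "n + p \<in> env_class sc br q" if "n \<in> env_ideal sc br" for n
    using env_ideal_closed that * unfolding env_class_alt
    by (auto intro!: exI[of _ "n + (p - q)"])
  moreover have "n + q \<in> env_class sc br p" if "n \<in> env_ideal sc br" for n
    using env_ideal_closed that env_ideal_uminus[OF *] unfolding env_class_alt
    by (auto intro!: exI[of _ "n + - (p - q)"] simp del: minus_diff_eq)
  ultimately show "env_class sc br p = env_class sc br q"
    by (auto simp: env_class_alt[of p] env_class_alt[of q])
qed

lemma carrier_env_alg: "carrier (env_alg sc br) = range (env_class sc br)"
  by (auto simp: env_alg_def FactRing_def A_RCOSETS_def RCOSETS_def Let_def
      env_class_def a_r_coset_def)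

lemma env_class_in_carrier [simp]: "env_class sc br p \<in> carrier (env_alg sc br)"
  by (simp add: carrier_env_alg)

lemma one_env_alg: "\<one>\<^bsub>env_alg sc br\<^esub> = env_class sc br 1"
  by (simp add: env_alg_def FactRing_def Let_def env_class_def)

lemma mult_env_class:
  "env_class sc br p \<otimes>\<^bsub>env_alg sc br\<^esub> env_class sc br q = env_class sc br (p * q)"
  using ideal.rcoset_mult_add[OF ideal_env_ideal, of p q]
  by (simp add: env_alg_def FactRing_def Let_def env_class_def)

lemma add_env_class:
  "env_class sc br p \<oplus>\<^bsub>env_alg sc br\<^esub> env_class sc br q = env_class sc br (p + q)"
  using ideal.a_rcos_sum[OF ideal_env_ideal, of p q]
  by (simp add: env_alg_def FactRing_def Let_def env_class_def)

lemma smult_env_class: "c \<odot>\<^bsub>env_alg sc br\<^esub> env_class sc br p = env_class sc br (fscale c p)"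
  using ideal.rcoset_mult_add[OF ideal_env_ideal, of "Poly_Mapping.single 0 c" p]
  by (simp add: env_alg_def FactRing_def Let_def env_class_def single_0_mult)

end

locale k_algebra = k_closed A for A :: "('k::field, 'v) module" +
  assumes one_closed [simp]: "\<one>\<^bsub>A\<^esub> \<in> carrier A"
    and mult_closed [simp]: "a \<in> carrier A \<Longrightarrow> b \<in> carrier A \<Longrightarrow> a \<otimes>\<^bsub>A\<^esub> b \<in> carrier A"
    and l_one [simp]: "a \<in> carrier A \<Longrightarrow> \<one>\<^bsub>A\<^esub> \<otimes>\<^bsub>A\<^esub> a = a"
    and r_one [simp]: "a \<in> carrier A \<Longrightarrow> a \<otimes>\<^bsub>A\<^esub> \<one>\<^bsub>A\<^esub> = a"
    and add_mult: "a \<in> carrier A \<Longrightarrow> b \<in> carrier A \<Longrightarrow> d \<in> carrier A \<Longrightarrow>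
      (a \<oplus>\<^bsub>A\<^esub> b) \<otimes>\<^bsub>A\<^esub> d = a \<otimes>\<^bsub>A\<^esub> d \<oplus>\<^bsub>A\<^esub> b \<otimes>\<^bsub>A\<^esub> d"
    and mult_add: "a \<in> carrier A \<Longrightarrow> b \<in> carrier A \<Longrightarrow> d \<in> carrier A \<Longrightarrow>
      a \<otimes>\<^bsub>A\<^esub> (b \<oplus>\<^bsub>A\<^esub> d) = a \<otimes>\<^bsub>A\<^esub> b \<oplus>\<^bsub>A\<^esub> a \<otimes>\<^bsub>A\<^esub> d"
    and smult_mult: "a \<in> carrier A \<Longrightarrow> b \<in> carrier A \<Longrightarrow>
      (c \<odot>\<^bsub>A\<^esub> a) \<otimes>\<^bsub>A\<^esub> b = c \<odot>\<^bsub>A\<^esub> (a \<otimes>\<^bsub>A\<^esub> b)"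
    and mult_smult: "a \<in> carrier A \<Longrightarrow> b \<in> carrier A \<Longrightarrow>
      a \<otimes>\<^bsub>A\<^esub> (c \<odot>\<^bsub>A\<^esub> b) = c \<odot>\<^bsub>A\<^esub> (a \<otimes>\<^bsub>A\<^esub> b)"

lemma k_algebra_env_alg: "k_algebra (env_alg sc br)"
  by unfold_locales
    (auto simp: carrier_env_alg one_env_alg mult_env_class add_env_class smult_env_class
      algebra_simps fscale_mult_left fscale_mult_right)

lemma env_incl_closed [simp]: "env_incl sc br x \<in> carrier (env_alg sc br)"
  by (simp add: env_incl_def)

lemma env_incl_add:
  "env_incl sc br (x + y) = env_incl sc br x \<oplus>\<^bsub>env_alg sc br\<^esub> env_incl sc br y"
  using env_ideal_gens(1)[of x y sc br]
  by (simp add: env_incl_def add_env_class env_class_eq_iff diff_diff_add)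

lemma env_incl_scale: "env_incl sc br (sc c x) = c \<odot>\<^bsub>env_alg sc br\<^esub> env_incl sc br x"
  using env_ideal_gens(2)[of sc c x br]
  by (simp add: env_incl_def smult_env_class env_class_eq_iff single_0_mult)

text \<open>The commutation relation is written as a sum so that the additivity relation in a single
  tensor slot applies to it directly.\<close>

lemma env_incl_bracket:
  "env_incl sc br x \<otimes>\<^bsub>env_alg sc br\<^esub> env_incl sc br y =
    env_incl sc br (br x y) \<oplus>\<^bsub>env_alg sc br\<^esub> env_incl sc br y \<otimes>\<^bsub>env_alg sc br\<^esub> env_incl sc br x"
  using env_ideal_gens(3)[of x y br sc]
  by (simp add: env_incl_def add_env_class mult_env_class env_class_eq_iff algebra_simps)

definition free_map :: "('g \<Rightarrow> 'h) \<Rightarrow> ('g fmonoid \<Rightarrow>\<^sub>0 'k::field) \<Rightarrow> 'h fmonoid \<Rightarrow>\<^sub>0 'k" where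
  "free_map \<phi> = lext (\<lambda>w. basis (map_fmonoid \<phi> w))"

lemma map_fmonoid_plus: "map_fmonoid \<phi> (u + v) = map_fmonoid \<phi> u + map_fmonoid \<phi> v"
  by (cases u; cases v) simp

lemma free_map_mult: "free_map \<phi> (p * q) = free_map \<phi> p * free_map \<phi> q"
  by (simp add: free_map_def mult_eq_lext lext_lext map_fmonoid_plus)

lemma free_map_linear:
  "free_map \<phi> (a + b) = free_map \<phi> a + free_map \<phi> b"
  "free_map \<phi> (a - b) = free_map \<phi> a - free_map \<phi> b"
  "free_map \<phi> (fscale c a) = fscale c (free_map \<phi> a)"
  "free_map \<phi> 0 = 0"
  by (simp_all add: free_map_def lext_linear)

lemma free_map_free_gen: "free_map \<phi> (free_gen x) = free_gen (\<phi> x)"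
  by (simp add: free_map_def free_gen_def)

text \<open>The preimage of an ideal under the multiplicative linear map
  \<open>free_map \<phi>\<close> is an ideal, and it contains the three families of generators
  because \<phi> respects sums, scalars and brackets.\<close>

lemma free_map_env_ideal:
  assumes add: "\<And>x y. \<phi> (x + y) = \<phi> x + \<phi> y" and scale: "\<And>c x. \<phi> (sc c x) = sc' c (\<phi> x)"
    and bracket: "\<And>x y. \<phi> (br x y) = br' (\<phi> x) (\<phi> y)"
    and p: "p \<in> env_ideal sc br"
  shows "free_map \<phi> p \<in> env_ideal sc' br'"
proof -
  let ?J = "{p. free_map \<phi> p \<in> env_ideal sc' br'}"
  have "ideal ?J ring_of_type_algebra"
    using env_ideal_closed[of sc' br']
    by (auto simp: ideal_ring_of_type_algebra_iff free_map_linear free_map_mult)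
  then have "env_ideal sc br \<subseteq> ?J"
    unfolding env_ideal_def[of sc br]
    by (rule ring.genideal_minimal[OF ring_ring_of_type_algebra])
      (auto simp: free_map_linear free_map_mult free_map_free_gen add scale bracket single_0_mult
        intro: env_ideal_gens env_ideal_gens(2)[unfolded single_0_mult])
  with p show ?thesis by blast
qed

text \<open>Functoriality of the enveloping algebra, to be applied to the inclusion of a summand.
  The properties recorded are those that let \<psi> act in one slot of a tensor power.\<close>

lemma env_functor:
  assumes "\<And>x y. \<phi> (x + y) = \<phi> x + \<phi> y" "\<And>c x. \<phi> (sc c x) = sc' c (\<phi> x)"
    "\<And>x y. \<phi> (br x y) = br' (\<phi> x) (\<phi> y)"
  obtains \<psi> where "\<And>u. u \<in> carrier (env_alg sc br) \<Longrightarrow> \<psi> u \<in> carrier (env_alg sc' br')"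
    "\<And>u v. u \<in> carrier (env_alg sc br) \<Longrightarrow> v \<in> carrier (env_alg sc br) \<Longrightarrow>
      \<psi> (u \<oplus>\<^bsub>env_alg sc br\<^esub> v) = \<psi> u \<oplus>\<^bsub>env_alg sc' br'\<^esub> \<psi> v"
    "\<And>c u. u \<in> carrier (env_alg sc br) \<Longrightarrow>
      \<psi> (c \<odot>\<^bsub>env_alg sc br\<^esub> u) = c \<odot>\<^bsub>env_alg sc' br'\<^esub> \<psi> u"
    "\<And>x. \<psi> (env_incl sc br x) = env_incl sc' br' (\<phi> x)"
proof -
  define \<psi> where "\<psi> u = env_class sc' br' (free_map \<phi> (SOME p. p \<in> u))" for u
  have \<psi>: "\<psi> (env_class sc br p) = env_class sc' br' (free_map \<phi> p)" for p
  proof -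
    have "(SOME p'. p' \<in> env_class sc br p) \<in> env_class sc br p"
      using env_class_self by (rule someI)
    then have "(SOME p'. p' \<in> env_class sc br p) - p \<in> env_ideal sc br"
      by (auto simp: env_class_alt)
    from free_map_env_ideal[OF assms this] show ?thesis
      by (simp add: \<psi>_def env_class_eq_iff flip: free_map_linear)
  qed
  show thesis
    by (rule that[of \<psi>])
      (auto simp: carrier_env_alg add_env_class smult_env_class \<psi> env_incl_def free_map_free_gen
        free_map_linear)
qed



section \<open>Products in tensor powers\<close>

lemma tuples_2E:
  assumes "xs \<in> tuples A 2"
  obtains x y where "xs = [x, y]" "x \<in> carrier A" "y \<in> carrier A"
proof -
  from assms have "length xs = Suc (Suc 0)" "set xs \<subseteq> carrier A"
    by (auto simp: tuples_def)
  then show thesis by (auto simp: length_Suc_conv intro: that)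
qed

lemma tuples_3E:
  assumes "xs \<in> tuples A 3"
  obtains x y z where "xs = [x, y, z]" "x \<in> carrier A" "y \<in> carrier A" "z \<in> carrier A"
proof -
  from assms have "length xs = Suc (Suc (Suc 0))" "set xs \<subseteq> carrier A"
    by (auto simp: tuples_def)
  then show thesis by (auto simp: length_Suc_conv intro: that)
qed

lemma tuples_2 [simp]: "[x, y] \<in> tuples A 2 \<longleftrightarrow> x \<in> carrier A \<and> y \<in> carrier A"
  by (auto simp: tuples_def)

lemma tuples_3 [simp]:
  "[x, y, z] \<in> tuples A 3 \<longleftrightarrow> x \<in> carrier A \<and> y \<in> carrier A \<and> z \<in> carrier A"
  by (auto simp: tuples_def)

lemma multilinear_mod_2I:
  assumes "\<And>a b d. a \<in> carrier A \<Longrightarrow> b \<in> carrier A \<Longrightarrow> d \<in> carrier A \<Longrightarrow>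
      f [a \<oplus>\<^bsub>A\<^esub> b, d] - f [a, d] - f [b, d] \<in> S"
    "\<And>a b d. a \<in> carrier A \<Longrightarrow> b \<in> carrier A \<Longrightarrow> d \<in> carrier A \<Longrightarrow>
      f [d, a \<oplus>\<^bsub>A\<^esub> b] - f [d, a] - f [d, b] \<in> S"
    "\<And>a c d. a \<in> carrier A \<Longrightarrow> d \<in> carrier A \<Longrightarrow> f [c \<odot>\<^bsub>A\<^esub> a, d] - fscale c (f [a, d]) \<in> S"
    "\<And>a c d. a \<in> carrier A \<Longrightarrow> d \<in> carrier A \<Longrightarrow> f [d, c \<odot>\<^bsub>A\<^esub> a] - fscale c (f [d, a]) \<in> S"
  shows "multilinear_mod A 2 S f"
  unfolding multilinear_mod_def
proof (intro ballI allI impI)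
  fix xs and i :: nat and a
  assume "xs \<in> tuples A 2" "i < 2" "a \<in> carrier A"
  then show "(\<forall>b\<in>carrier A. f (xs[i := a \<oplus>\<^bsub>A\<^esub> b]) - f (xs[i := a]) - f (xs[i := b]) \<in> S) \<and>
      (\<forall>c. f (xs[i := c \<odot>\<^bsub>A\<^esub> a]) - fscale c (f (xs[i := a])) \<in> S)"
    by (elim tuples_2E less_2_cases[THEN disjE]) (simp_all add: assms)
qed

lemma multilinear_mod_3I:
  assumes "\<And>a b d e. a \<in> carrier A \<Longrightarrow> b \<in> carrier A \<Longrightarrow> d \<in> carrier A \<Longrightarrow> e \<in> carrier A \<Longrightarrow>
      f [a \<oplus>\<^bsub>A\<^esub> b, d, e] - f [a, d, e] - f [b, d, e] \<in> S"
    "\<And>a b d e. a \<in> carrier A \<Longrightarrow> b \<in> carrier A \<Longrightarrow> d \<in> carrier A \<Longrightarrow> e \<in> carrier A \<Longrightarrow>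
      f [d, a \<oplus>\<^bsub>A\<^esub> b, e] - f [d, a, e] - f [d, b, e] \<in> S"
    "\<And>a b d e. a \<in> carrier A \<Longrightarrow> b \<in> carrier A \<Longrightarrow> d \<in> carrier A \<Longrightarrow> e \<in> carrier A \<Longrightarrow>
      f [d, e, a \<oplus>\<^bsub>A\<^esub> b] - f [d, e, a] - f [d, e, b] \<in> S"
    "\<And>a c d e. a \<in> carrier A \<Longrightarrow> d \<in> carrier A \<Longrightarrow> e \<in> carrier A \<Longrightarrow>
      f [c \<odot>\<^bsub>A\<^esub> a, d, e] - fscale c (f [a, d, e]) \<in> S"
    "\<And>a c d e. a \<in> carrier A \<Longrightarrow> d \<in> carrier A \<Longrightarrow> e \<in> carrier A \<Longrightarrow>
      f [d, c \<odot>\<^bsub>A\<^esub> a, e] - fscale c (f [d, a, e]) \<in> S"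
    "\<And>a c d e. a \<in> carrier A \<Longrightarrow> d \<in> carrier A \<Longrightarrow> e \<in> carrier A \<Longrightarrow>
      f [d, e, c \<odot>\<^bsub>A\<^esub> a] - fscale c (f [d, e, a]) \<in> S"
  shows "multilinear_mod A 3 S f"
  unfolding multilinear_mod_def
proof (intro ballI allI impI)
  fix xs and i :: nat and a
  assume *: "xs \<in> tuples A 3" "i < 3" "a \<in> carrier A"
  then have "i = 0 \<or> i = 1 \<or> i = 2" by linarith
  with * show "(\<forall>b\<in>carrier A. f (xs[i := a \<oplus>\<^bsub>A\<^esub> b]) - f (xs[i := a]) - f (xs[i := b]) \<in> S) \<and>
      (\<forall>c. f (xs[i := c \<odot>\<^bsub>A\<^esub> a]) - fscale c (f (xs[i := a])) \<in> S)"
    by (elim tuples_3E disjE) (simp_all add: assms)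
qed

context
  fixes A :: "('k::field, 'v) module"
begin

lemma tensor_rel_2:
  assumes "a \<in> carrier A" "d \<in> carrier A"
  shows "b \<in> carrier A \<Longrightarrow> basis [a \<oplus>\<^bsub>A\<^esub> b, d] - basis [a, d] - basis [b, d] \<in> tensor_rel A 2"
    "b \<in> carrier A \<Longrightarrow> basis [d, a \<oplus>\<^bsub>A\<^esub> b] - basis [d, a] - basis [d, b] \<in> tensor_rel A 2"
    "basis [c \<odot>\<^bsub>A\<^esub> a, d] - Poly_Mapping.single [a, d] c \<in> tensor_rel A 2"
    "basis [d, c \<odot>\<^bsub>A\<^esub> a] - Poly_Mapping.single [d, a] c \<in> tensor_rel A 2"
  using assms tensor_rel_add[of "[a, d]" A 2 0 a b] tensor_rel_add[of "[d, a]" A 2 1 a b]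
    tensor_rel_smult[of "[a, d]" A 2 0 a c] tensor_rel_smult[of "[d, a]" A 2 1 a c]
  by simp_all

lemma tensor_rel_3:
  assumes "a \<in> carrier A" "d \<in> carrier A" "e \<in> carrier A"
  shows "b \<in> carrier A \<Longrightarrow>
      basis [a \<oplus>\<^bsub>A\<^esub> b, d, e] - basis [a, d, e] - basis [b, d, e] \<in> tensor_rel A 3"
    "b \<in> carrier A \<Longrightarrow>
      basis [d, a \<oplus>\<^bsub>A\<^esub> b, e] - basis [d, a, e] - basis [d, b, e] \<in> tensor_rel A 3"
    "b \<in> carrier A \<Longrightarrow>
      basis [d, e, a \<oplus>\<^bsub>A\<^esub> b] - basis [d, e, a] - basis [d, e, b] \<in> tensor_rel A 3"
    "basis [c \<odot>\<^bsub>A\<^esub> a, d, e] - Poly_Mapping.single [a, d, e] c \<in> tensor_rel A 3"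
    "basis [d, c \<odot>\<^bsub>A\<^esub> a, e] - Poly_Mapping.single [d, a, e] c \<in> tensor_rel A 3"
    "basis [d, e, c \<odot>\<^bsub>A\<^esub> a] - Poly_Mapping.single [d, e, a] c \<in> tensor_rel A 3"
  using assms tensor_rel_add[of "[a, d, e]" A 3 0 a b] tensor_rel_add[of "[d, a, e]" A 3 1 a b]
    tensor_rel_add[of "[d, e, a]" A 3 2 a b]
    tensor_rel_smult[of "[a, d, e]" A 3 0 a c] tensor_rel_smult[of "[d, a, e]" A 3 1 a c]
    tensor_rel_smult[of "[d, e, a]" A 3 2 a c]
  by simp_all

definition tmult :: "('v list \<Rightarrow>\<^sub>0 'k) \<Rightarrow> ('v list \<Rightarrow>\<^sub>0 'k) \<Rightarrow> 'v list \<Rightarrow>\<^sub>0 'k" where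
  "tmult p q = lext (\<lambda>xs. lext (\<lambda>ys. basis (map2 (\<lambda>a b. a \<otimes>\<^bsub>A\<^esub> b) xs ys)) q) p"

lemma tmult_linear:
  "tmult (p + p') q = tmult p q + tmult p' q" "tmult p (q + q') = tmult p q + tmult p q'"
  "tmult (p - p') q = tmult p q - tmult p' q" "tmult p (q - q') = tmult p q - tmult p q'"
  by (simp_all add: tmult_def lext_linear lext_fun)

end

context k_algebra
begin

lemma map2_in_tuples:
  assumes "xs \<in> tuples A m" "ys \<in> tuples A m"
  shows "map2 (\<lambda>a b. a \<otimes>\<^bsub>A\<^esub> b) xs ys \<in> tuples A m"
  using assms by (auto simp: tuples_def intro!: mult_closed dest: set_zip_leftD set_zip_rightD)

lemma tmult_in_tensor_sums:
  assumes "p \<in> tensor_sums A m" "q \<in> tensor_sums A m"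
  shows "tmult A p q \<in> tensor_sums A m"
  unfolding tmult_def
  by (intro lext_in_tensor_sums[OF assms(1)] lext_in_tensor_sums[OF assms(2)]
      single_in_tensor_sums map2_in_tuples)

lemma map2_update:
  assumes "xs \<in> tuples A m" "ys \<in> tuples A m" "i < m"
  shows "map2 (\<lambda>a b. a \<otimes>\<^bsub>A\<^esub> b) (xs[i := a]) ys =
      (map2 (\<lambda>a b. a \<otimes>\<^bsub>A\<^esub> b) xs ys)[i := a \<otimes>\<^bsub>A\<^esub> (ys ! i)]"
    "map2 (\<lambda>a b. a \<otimes>\<^bsub>A\<^esub> b) ys (xs[i := a]) =
      (map2 (\<lambda>a b. a \<otimes>\<^bsub>A\<^esub> b) ys xs)[i := (ys ! i) \<otimes>\<^bsub>A\<^esub> a]"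
  using assms by (auto intro!: nth_equalityI simp: tuples_def nth_list_update)

text \<open>Changing slot \<open>i\<close> of one factor changes only slot \<open>i\<close> of a
  slotwise product, and multiplication by a fixed element is linear there. So relations absorb
  products from both sides, and products of classes may be computed on any representatives.\<close>

lemma tmult_tensor_rel:
  assumes p: "p \<in> tensor_rel A m" and q: "q \<in> tensor_sums A m"
  shows "tmult A p q \<in> tensor_rel A m" "tmult A q p \<in> tensor_rel A m"
proof -
  have nth: "ys ! i \<in> carrier A" if "ys \<in> tuples A m" "i < m" for ys i
    using that by (auto simp: tuples_def)
  have keys: "ys \<in> tuples A m" if "ys \<in> Poly_Mapping.keys q" for ys
    using q that by (auto simp: tensor_sums_def)
  show "tmult A p q \<in> tensor_rel A m"
    unfolding tmult_def
  proof (rule lext_tensor_rel[OF subspace_tensor_rel _ p], unfold multilinear_mod_def, intro ballI allI impI conjI)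
    fix xs i a b assume *: "xs \<in> tuples A m" "i < m" "a \<in> carrier A" "b \<in> carrier A"
    show "lext (\<lambda>ys. basis (map2 (\<lambda>a b. a \<otimes>\<^bsub>A\<^esub> b) (xs[i := a \<oplus>\<^bsub>A\<^esub> b]) ys)) q -
        lext (\<lambda>ys. basis (map2 (\<lambda>a b. a \<otimes>\<^bsub>A\<^esub> b) (xs[i := a]) ys)) q -
        lext (\<lambda>ys. basis (map2 (\<lambda>a b. a \<otimes>\<^bsub>A\<^esub> b) (xs[i := b]) ys)) q \<in> tensor_rel A m"
      unfolding lext_fun_diff[symmetric]
      by (rule lext_mem[OF subspace_tensor_rel])
        (use * in \<open>auto dest!: keys simp: map2_update add_mult nth
          intro!: tensor_rel_add map2_in_tuples\<close>)
  next
    fix xs i a c assume *: "xs \<in> tuples A m" "i < m" "a \<in> carrier A"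
    show "lext (\<lambda>ys. basis (map2 (\<lambda>a b. a \<otimes>\<^bsub>A\<^esub> b) (xs[i := c \<odot>\<^bsub>A\<^esub> a]) ys)) q -
        fscale c (lext (\<lambda>ys. basis (map2 (\<lambda>a b. a \<otimes>\<^bsub>A\<^esub> b) (xs[i := a]) ys)) q) \<in> tensor_rel A m"
      unfolding lext_fun_diff[symmetric] lext_fun_fscale[symmetric]
      by (rule lext_mem[OF subspace_tensor_rel])
        (use * in \<open>auto dest!: keys simp: map2_update smult_mult nth simp del: fscale_single
          intro!: tensor_rel_smult map2_in_tuples\<close>)
  qed
  show "tmult A q p \<in> tensor_rel A m"
    \<comment> \<open>Exchanging the two extensions puts the relation \<open>p\<close> outermost,
      where \<open>lext_tensor_rel\<close> applies.\<close>
    unfolding tmult_def lext_commute[of _ p q]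
  proof (rule lext_tensor_rel[OF subspace_tensor_rel _ p], unfold multilinear_mod_def, intro ballI allI impI conjI)
    fix xs i a b assume *: "xs \<in> tuples A m" "i < m" "a \<in> carrier A" "b \<in> carrier A"
    show "lext (\<lambda>ys. basis (map2 (\<lambda>a b. a \<otimes>\<^bsub>A\<^esub> b) ys (xs[i := a \<oplus>\<^bsub>A\<^esub> b]))) q -
        lext (\<lambda>ys. basis (map2 (\<lambda>a b. a \<otimes>\<^bsub>A\<^esub> b) ys (xs[i := a]))) q -
        lext (\<lambda>ys. basis (map2 (\<lambda>a b. a \<otimes>\<^bsub>A\<^esub> b) ys (xs[i := b]))) q \<in> tensor_rel A m"
      unfolding lext_fun_diff[symmetric]
      by (rule lext_mem[OF subspace_tensor_rel])
        (use * in \<open>auto dest!: keys simp: map2_update mult_add nth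
          intro!: tensor_rel_add map2_in_tuples\<close>)
  next
    fix xs i a c assume *: "xs \<in> tuples A m" "i < m" "a \<in> carrier A"
    show "lext (\<lambda>ys. basis (map2 (\<lambda>a b. a \<otimes>\<^bsub>A\<^esub> b) ys (xs[i := c \<odot>\<^bsub>A\<^esub> a]))) q -
        fscale c (lext (\<lambda>ys. basis (map2 (\<lambda>a b. a \<otimes>\<^bsub>A\<^esub> b) ys (xs[i := a]))) q) \<in> tensor_rel A m"
      unfolding lext_fun_diff[symmetric] lext_fun_fscale[symmetric]
      by (rule lext_mem[OF subspace_tensor_rel])
        (use * in \<open>auto dest!: keys simp: map2_update mult_smult nth simp del: fscale_single
          intro!: tensor_rel_smult map2_in_tuples\<close>)
  qed
qed

lemma mult_tcls:
  assumes p: "p \<in> tensor_sums A m" and q: "q \<in> tensor_sums A m"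
  shows "tcls A m p \<otimes>\<^bsub>tensor_power A m\<^esub> tcls A m q = tcls A m (tmult A p q)"
proof -
  have mult: "a \<otimes>\<^bsub>formal_sums A m\<^esub> b = tmult A a b" for a b
    by (simp add: formal_sums_def tmult_def lext_def fs.scale_sum_right)
  have "tcls A m p \<otimes>\<^bsub>tensor_power A m\<^esub> tcls A m q =
      (\<Union>a\<in>tcls A m p. \<Union>b\<in>tcls A m q. tcls A m (tmult A a b))"
    by (simp add: tensor_power_def Let_def FactRing_def rcoset_mult_def mult tcls_def)
  also have "\<dots> = tcls A m (tmult A p q)"
  proof -
    have "tcls A m (tmult A a b) = tcls A m (tmult A p q)"
      if ab: "a \<in> tcls A m p" "b \<in> tcls A m q" for a b
    proof -
      from ab obtain n n' where n: "n \<in> tensor_rel A m" "a = n + p" "n' \<in> tensor_rel A m" "b = n' + q"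
        by (auto simp: tcls_alt)
      have "tmult A a b - tmult A p q = tmult A n (n' + q) + tmult A p n'"
        by (simp add: n tmult_linear)
      also have "\<dots> \<in> tensor_rel A m"
        using n p q tensor_rel_subset[of m]
        by (intro fs.subspace_add[OF subspace_tensor_rel] tmult_tensor_rel) auto
      finally show ?thesis by (simp add: tcls_eq_iff)
    qed
    moreover have "p \<in> tcls A m p" "q \<in> tcls A m q"
      using fs.subspace_0[OF subspace_tensor_rel] by (force simp: tcls_alt)+
    ultimately show ?thesis by blast
  qed
  finally show ?thesis .
qed

lemma commutator_tcls:
  assumes "p \<in> tensor_sums A m" "q \<in> tensor_sums A m"
  shows "commutator (tensor_power A m) (tcls A m p) (tcls A m q) =
    tcls A m (tmult A p q - tmult A q p)"
  using assms by (simp add: commutator_def mult_tcls diff_tcls tmult_in_tensor_sums)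

end


section \<open>Tensors over a Lie algebra modulo the kernel of the inclusion\<close>

lemma lie_module_simps [simp]:
  "carrier (lie_module sc br) = UNIV"
  "x \<oplus>\<^bsub>lie_module sc br\<^esub> y = x + y"
  "c \<odot>\<^bsub>lie_module sc br\<^esub> x = sc c x"
  by (simp_all add: lie_module_def)

lemma k_closed_lie_module: "k_closed (lie_module sc br)"
  by unfold_locales auto

lemma tuples_lie_module: "tuples (lie_module sc br) m = {xs. length xs = m}"
  by (simp add: tuples_def)

definition pow_incl ::
    "('k::field \<Rightarrow> 'g::ab_group_add \<Rightarrow> 'g) \<Rightarrow> ('g \<Rightarrow> 'g \<Rightarrow> 'g) \<Rightarrow> ('g list \<Rightarrow>\<^sub>0 'k) \<Rightarrow>
     ('k, 'g) env list \<Rightarrow>\<^sub>0 'k" where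
  "pow_incl sc br = lext (\<lambda>xs. basis (map (env_incl sc br) xs))"

text \<open>Two Lie tensors have the same image under \<open>power_incl\<close> exactly when their
  representatives differ by an element of this subspace, so it is the form taken here by every
  equation posed in the enveloping algebra.\<close>

definition incl_kernel ::
    "('k::field \<Rightarrow> 'g::ab_group_add \<Rightarrow> 'g) \<Rightarrow> ('g \<Rightarrow> 'g \<Rightarrow> 'g) \<Rightarrow> nat \<Rightarrow> ('g list \<Rightarrow>\<^sub>0 'k) set" where
  "incl_kernel sc br m =
     {p \<in> tensor_sums (lie_module sc br) m. pow_incl sc br p \<in> tensor_rel (env_alg sc br) m}"

context
  fixes sc :: "'k::field \<Rightarrow> 'g::ab_group_add \<Rightarrow> 'g" and br :: "'g \<Rightarrow> 'g \<Rightarrow> 'g"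
begin

interpretation U: k_algebra "env_alg sc br" by (rule k_algebra_env_alg)
interpretation G: k_closed "lie_module sc br" by (rule k_closed_lie_module)

lemma pow_incl_linear:
  "pow_incl sc br (p + q) = pow_incl sc br p + pow_incl sc br q"
  "pow_incl sc br (p - q) = pow_incl sc br p - pow_incl sc br q"
  "pow_incl sc br (- p) = - pow_incl sc br p"
  "pow_incl sc br (fscale c p) = fscale c (pow_incl sc br p)"
  "pow_incl sc br 0 = 0"
  by (simp_all add: pow_incl_def lext_linear)

lemma pow_incl_in_tensor_sums:
  "p \<in> tensor_sums (lie_module sc br) m \<Longrightarrow> pow_incl sc br p \<in> tensor_sums (env_alg sc br) m"
  unfolding pow_incl_def
  by (erule lext_in_tensor_sums) (auto intro!: single_in_tensor_sums simp: tuples_def)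

lemma subspace_incl_kernel: "fs.subspace (incl_kernel sc br m)"
  by (rule fs.subspaceI)
    (auto simp: incl_kernel_def pow_incl_linear
      intro: fs.subspace_0 fs.subspace_add fs.subspace_scale subspace_tensor_rel)

lemma multilinear_incl:
  "multilinear_mod (lie_module sc br) m (tensor_rel (env_alg sc br) m)
     (\<lambda>xs. basis (map (env_incl sc br) xs))"
  unfolding multilinear_mod_def
  by (auto simp: map_update env_incl_add env_incl_scale tuples_def simp del: fscale_single
      intro!: tensor_rel_add tensor_rel_smult)

lemma tensor_rel_in_incl_kernel: "p \<in> tensor_rel (lie_module sc br) m \<Longrightarrow> p \<in> incl_kernel sc br m"
  using lext_tensor_rel[OF subspace_tensor_rel multilinear_incl, of p m] G.tensor_rel_subset[of m]
  by (auto simp: incl_kernel_def pow_incl_def)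

lemma power_incl_tcls:
  assumes "p \<in> tensor_sums (lie_module sc br) m"
  shows "power_incl sc br m (tcls (lie_module sc br) m p) =
    tcls (env_alg sc br) m (pow_incl sc br p)"
  unfolding power_incl_def env_power_def pow_incl_def
  by (rule G.tensor_lift_tcls[OF assms multilinear_incl])
    (auto intro!: single_in_tensor_sums pure_tensor_tcls simp: tuples_def)

lemma tcls_pow_incl_eq_iff:
  assumes "p \<in> tensor_sums (lie_module sc br) m" "q \<in> tensor_sums (lie_module sc br) m"
  shows "tcls (env_alg sc br) m (pow_incl sc br p) = tcls (env_alg sc br) m (pow_incl sc br q) \<longleftrightarrow>
    p - q \<in> incl_kernel sc br m"
  using assms by (simp add: incl_kernel_def tcls_eq_iff pow_incl_linear)

text \<open>An element of the kernel yields a relation only between its images in the enveloping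
  algebra. An operation \<open>f'\<close> on Lie tensors therefore has to be matched by an operation
  \<open>f\<close> on enveloping tensors that respects the relations there.\<close>

lemma lext_incl_kernel:
  assumes p: "p \<in> incl_kernel sc br m"
    and f: "multilinear_mod (env_alg sc br) m (tensor_rel (env_alg sc' br') n) f"
    and f': "\<And>xs. length xs = m \<Longrightarrow> f (map (env_incl sc br) xs) = pow_incl sc' br' (f' xs)"
      "\<And>xs. length xs = m \<Longrightarrow> f' xs \<in> tensor_sums (lie_module sc' br') n"
  shows "lext f' p \<in> incl_kernel sc' br' n"
proof -
  have keys: "length xs = m" if "xs \<in> Poly_Mapping.keys p" for xs
    using p that by (auto simp: incl_kernel_def tensor_sums_def tuples_lie_module)
  have "pow_incl sc' br' (lext f' p) = lext (\<lambda>xs. pow_incl sc' br' (f' xs)) p"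
    by (simp add: pow_incl_def lext_lext)
  also have "\<dots> = lext (\<lambda>xs. f (map (env_incl sc br) xs)) p"
    by (rule lext_cong) (simp add: f' keys)
  also have "\<dots> = lext f (pow_incl sc br p)"
    by (simp add: pow_incl_def lext_lext)
  also have "\<dots> \<in> tensor_rel (env_alg sc' br') n"
    using p by (intro lext_tensor_rel[OF subspace_tensor_rel f]) (simp add: incl_kernel_def)
  finally show ?thesis
    using p f'(2) unfolding incl_kernel_def
    by (auto intro!: lext_in_tensor_sums[of p "lie_module sc br" m] simp: tuples_lie_module)
qed

lemma env_bracket_3:
  assumes "u \<in> carrier (env_alg sc br)" "v \<in> carrier (env_alg sc br)"
  shows "basis [env_incl sc br x \<otimes>\<^bsub>env_alg sc br\<^esub> env_incl sc br y, u, v] -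
      basis [env_incl sc br y \<otimes>\<^bsub>env_alg sc br\<^esub> env_incl sc br x, u, v] -
      basis [env_incl sc br (br x y), u, v] \<in> tensor_rel (env_alg sc br) 3"
    "basis [u, env_incl sc br x \<otimes>\<^bsub>env_alg sc br\<^esub> env_incl sc br y, v] -
      basis [u, env_incl sc br y \<otimes>\<^bsub>env_alg sc br\<^esub> env_incl sc br x, v] -
      basis [u, env_incl sc br (br x y), v] \<in> tensor_rel (env_alg sc br) 3"
    "basis [u, v, env_incl sc br x \<otimes>\<^bsub>env_alg sc br\<^esub> env_incl sc br y] -
      basis [u, v, env_incl sc br y \<otimes>\<^bsub>env_alg sc br\<^esub> env_incl sc br x] -
      basis [u, v, env_incl sc br (br x y)] \<in> tensor_rel (env_alg sc br) 3"
  using tensor_rel_3(1-3)[of "env_incl sc br (br x y)" "env_alg sc br" u v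
      "env_incl sc br y \<otimes>\<^bsub>env_alg sc br\<^esub> env_incl sc br x"] assms
  by (simp_all add: env_incl_bracket[of sc br x y] algebra_simps)

lemma env_bracket_2:
  assumes "u \<in> carrier (env_alg sc br)"
  shows "basis [env_incl sc br x \<otimes>\<^bsub>env_alg sc br\<^esub> env_incl sc br y, u] -
      basis [env_incl sc br y \<otimes>\<^bsub>env_alg sc br\<^esub> env_incl sc br x, u] -
      basis [env_incl sc br (br x y), u] \<in> tensor_rel (env_alg sc br) 2"
    "basis [u, env_incl sc br x \<otimes>\<^bsub>env_alg sc br\<^esub> env_incl sc br y] -
      basis [u, env_incl sc br y \<otimes>\<^bsub>env_alg sc br\<^esub> env_incl sc br x] -
      basis [u, env_incl sc br (br x y)] \<in> tensor_rel (env_alg sc br) 2"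
  using tensor_rel_2(1-2)[of "env_incl sc br (br x y)" "env_alg sc br" u
      "env_incl sc br y \<otimes>\<^bsub>env_alg sc br\<^esub> env_incl sc br x"] assms
  by (simp_all add: env_incl_bracket[of sc br x y] algebra_simps)

end



section \<open>Operations on tensor slots and the terms of the Yang-Baxter equation\<close>

definition tmap2 :: "('g \<Rightarrow> 'h) \<Rightarrow> ('g \<Rightarrow> 'h) \<Rightarrow> ('g list \<Rightarrow>\<^sub>0 'k::field) \<Rightarrow> 'h list \<Rightarrow>\<^sub>0 'k" where
  "tmap2 \<phi> \<psi> = lext (\<lambda>xs. basis [\<phi> (xs ! 0), \<psi> (xs ! 1)])"

definition tmap3 ::
    "('g \<Rightarrow> 'h) \<Rightarrow> ('g \<Rightarrow> 'h) \<Rightarrow> ('g \<Rightarrow> 'h) \<Rightarrow> ('g list \<Rightarrow>\<^sub>0 'k::field) \<Rightarrow> 'h list \<Rightarrow>\<^sub>0 'k" where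
  "tmap3 \<phi> \<psi> \<omega> = lext (\<lambda>xs. basis [\<phi> (xs ! 0), \<psi> (xs ! 1), \<omega> (xs ! 2)])"

definition flip :: "('g list \<Rightarrow>\<^sub>0 'k::field) \<Rightarrow> 'g list \<Rightarrow>\<^sub>0 'k" where
  "flip = lext (\<lambda>xs. basis [xs ! 1, xs ! 0])"

definition flip12 :: "('g list \<Rightarrow>\<^sub>0 'k::field) \<Rightarrow> 'g list \<Rightarrow>\<^sub>0 'k" where
  "flip12 = lext (\<lambda>xs. basis [xs ! 1, xs ! 0, xs ! 2])"

definition flip23 :: "('g list \<Rightarrow>\<^sub>0 'k::field) \<Rightarrow> 'g list \<Rightarrow>\<^sub>0 'k" where
  "flip23 = lext (\<lambda>xs. basis [xs ! 0, xs ! 2, xs ! 1])"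

definition tail_by :: "'g \<Rightarrow> ('g list \<Rightarrow>\<^sub>0 'k::field) \<Rightarrow> 'g list \<Rightarrow>\<^sub>0 'k" where
  "tail_by b = lext (\<lambda>xs. basis [xs ! 0, xs ! 1, b])"

definition head_by :: "'g \<Rightarrow> ('g list \<Rightarrow>\<^sub>0 'k::field) \<Rightarrow> 'g list \<Rightarrow>\<^sub>0 'k" where
  "head_by b = lext (\<lambda>xs. basis [b, xs ! 0, xs ! 1])"

text \<open>Represents \<open>[p, \<Delta>(x)]\<close>, with \<open>x\<close> as right argument of
  each bracket, matching the convention \<delta>(x) = [r, \<Delta>(x)].\<close>

definition ad2 :: "('g \<Rightarrow> 'g \<Rightarrow> 'g) \<Rightarrow> 'g \<Rightarrow> ('g list \<Rightarrow>\<^sub>0 'k::field) \<Rightarrow> 'g list \<Rightarrow>\<^sub>0 'k" where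
  "ad2 br x = lext (\<lambda>xs. basis [br (xs ! 0) x, xs ! 1] + basis [xs ! 0, br (xs ! 1) x])"

definition yb1 ::
    "('g \<Rightarrow> 'g \<Rightarrow> 'g) \<Rightarrow> ('g list \<Rightarrow>\<^sub>0 'k::field) \<Rightarrow> ('g list \<Rightarrow>\<^sub>0 'k) \<Rightarrow> 'g list \<Rightarrow>\<^sub>0 'k" where
  "yb1 br p q = lext (\<lambda>xs. lext (\<lambda>ys. basis [br (xs ! 0) (ys ! 0), xs ! 1, ys ! 1]) q) p"

definition yb2 ::
    "('g \<Rightarrow> 'g \<Rightarrow> 'g) \<Rightarrow> ('g list \<Rightarrow>\<^sub>0 'k::field) \<Rightarrow> ('g list \<Rightarrow>\<^sub>0 'k) \<Rightarrow> 'g list \<Rightarrow>\<^sub>0 'k" where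
  "yb2 br p q = lext (\<lambda>xs. lext (\<lambda>ys. basis [xs ! 0, br (xs ! 1) (ys ! 0), ys ! 1]) q) p"

definition yb3 ::
    "('g \<Rightarrow> 'g \<Rightarrow> 'g) \<Rightarrow> ('g list \<Rightarrow>\<^sub>0 'k::field) \<Rightarrow> ('g list \<Rightarrow>\<^sub>0 'k) \<Rightarrow> 'g list \<Rightarrow>\<^sub>0 'k" where
  "yb3 br p q = lext (\<lambda>xs. lext (\<lambda>ys. basis [xs ! 0, ys ! 0, br (xs ! 1) (ys ! 1)]) q) p"

text \<open>The polarization
  \<open>[a\<^sub>1\<^sub>2, b\<^sub>1\<^sub>3] + [a\<^sub>1\<^sub>2, d\<^sub>2\<^sub>3] + [b\<^sub>1\<^sub>3, d\<^sub>2\<^sub>3]\<close> of \<^const>\<open>cyb\<close>;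
  \<open>yb1\<close>, \<open>yb2\<close> and \<open>yb3\<close> are its three commutators.\<close>

definition yang ::
    "('g \<Rightarrow> 'g \<Rightarrow> 'g) \<Rightarrow> ('g list \<Rightarrow>\<^sub>0 'k::field) \<Rightarrow> ('g list \<Rightarrow>\<^sub>0 'k) \<Rightarrow> ('g list \<Rightarrow>\<^sub>0 'k) \<Rightarrow>
     'g list \<Rightarrow>\<^sub>0 'k" where
  "yang br a b d = yb1 br a b + yb2 br a d + yb3 br b d"

definition delta_id_repr ::
    "('g \<Rightarrow> 'g list \<Rightarrow>\<^sub>0 'k::field) \<Rightarrow> ('g list \<Rightarrow>\<^sub>0 'k) \<Rightarrow> 'g list \<Rightarrow>\<^sub>0 'k" where
  "delta_id_repr d = lext (\<lambda>xs. tail_by (xs ! 1) (d (xs ! 0)))"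

definition id_delta_repr ::
    "('g \<Rightarrow> 'g list \<Rightarrow>\<^sub>0 'k::field) \<Rightarrow> ('g list \<Rightarrow>\<^sub>0 'k) \<Rightarrow> 'g list \<Rightarrow>\<^sub>0 'k" where
  "id_delta_repr d = lext (\<lambda>xs. head_by (xs ! 0) (d (xs ! 1)))"

lemma pure_tensor_lists:
  "pure_tensor A [x, y] = tcls A 2 (basis [x, y])"
  "pure_tensor A [x, y, z] = tcls A 3 (basis [x, y, z])"
  by (simp_all add: pure_tensor_def tcls_def numeral_2_eq_2 numeral_3_eq_3)

context
  fixes sc :: "'k::field \<Rightarrow> 'g::ab_group_add \<Rightarrow> 'g" and br :: "'g \<Rightarrow> 'g \<Rightarrow> 'g"
begin

interpretation U: k_algebra "env_alg sc br" by (rule k_algebra_env_alg)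
interpretation G: k_closed "lie_module sc br" by (rule k_closed_lie_module)

lemma multilinear_slots:
  "multilinear_mod (lie_module sc br) 2 (tensor_rel (lie_module sc br) 2) (\<lambda>xs. basis [xs ! 1, xs ! 0])"
  "multilinear_mod (lie_module sc br) 3 (tensor_rel (lie_module sc br) 3)
     (\<lambda>xs. basis [xs ! 1, xs ! 0, xs ! 2])"
  "multilinear_mod (lie_module sc br) 3 (tensor_rel (lie_module sc br) 3)
     (\<lambda>xs. basis [xs ! 0, xs ! 2, xs ! 1])"
  "multilinear_mod (lie_module sc br) 2 (tensor_rel (lie_module sc br) 3)
     (\<lambda>xs. basis [xs ! 0, xs ! 1, b])"
  "multilinear_mod (lie_module sc br) 2 (tensor_rel (lie_module sc br) 3)
     (\<lambda>xs. basis [b, xs ! 0, xs ! 1])"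
  using tensor_rel_2[where A = "lie_module sc br"] tensor_rel_3[where A = "lie_module sc br"]
  by (auto intro!: multilinear_mod_2I multilinear_mod_3I)

lemma multilinear_env_slots:
  "multilinear_mod (env_alg sc br) 2 (tensor_rel (env_alg sc br) 2) (\<lambda>xs. basis [xs ! 1, xs ! 0])"
  "multilinear_mod (env_alg sc br) 3 (tensor_rel (env_alg sc br) 3)
     (\<lambda>xs. basis [xs ! 0, xs ! 2, xs ! 1])"
  "u \<in> carrier (env_alg sc br) \<Longrightarrow>
     multilinear_mod (env_alg sc br) 2 (tensor_rel (env_alg sc br) 3) (\<lambda>xs. basis [xs ! 0, xs ! 1, u])"
  "u \<in> carrier (env_alg sc br) \<Longrightarrow>
     multilinear_mod (env_alg sc br) 2 (tensor_rel (env_alg sc br) 3) (\<lambda>xs. basis [u, xs ! 0, xs ! 1])"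
  using tensor_rel_2[where A = "env_alg sc br"] tensor_rel_3[where A = "env_alg sc br"]
  by (auto intro!: multilinear_mod_2I multilinear_mod_3I)

lemma lists_in_lie_sums:
  "Poly_Mapping.single [x, y] c \<in> tensor_sums (lie_module sc br) 2"
  "Poly_Mapping.single [x, y, z] c \<in> tensor_sums (lie_module sc br) 3"
  by (auto intro!: single_in_tensor_sums)

lemma slots_in_tensor_sums [simp]:
  assumes "p \<in> tensor_sums (lie_module sc br) m"
  shows "flip p \<in> tensor_sums (lie_module sc br) 2"
    "flip12 p \<in> tensor_sums (lie_module sc br) 3"
    "flip23 p \<in> tensor_sums (lie_module sc br) 3"
    "tail_by b p \<in> tensor_sums (lie_module sc br) 3"
    "head_by b p \<in> tensor_sums (lie_module sc br) 3"
    "ad2 br' x p \<in> tensor_sums (lie_module sc br) 2"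
  unfolding flip_def flip12_def flip23_def tail_by_def head_by_def ad2_def
  by (rule lext_in_tensor_sums[OF assms]; simp add: lists_in_lie_sums)+

lemma yb_in_tensor_sums [simp]:
  assumes "p \<in> tensor_sums (lie_module sc br) m" "q \<in> tensor_sums (lie_module sc br) m"
  shows "yb1 br' p q \<in> tensor_sums (lie_module sc br) 3"
    "yb2 br' p q \<in> tensor_sums (lie_module sc br) 3"
    "yb3 br' p q \<in> tensor_sums (lie_module sc br) 3"
  unfolding yb1_def yb2_def yb3_def
  by (rule lext_in_tensor_sums[OF assms(1)], rule lext_in_tensor_sums[OF assms(2)],
      simp add: lists_in_lie_sums)+

lemma lie_swap_tcls:
  "p \<in> tensor_sums (lie_module sc br) 2 \<Longrightarrow>
    lie_swap sc br 2 1 2 (tcls (lie_module sc br) 2 p) = tcls (lie_module sc br) 2 (flip p)"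
  "p \<in> tensor_sums (lie_module sc br) 3 \<Longrightarrow>
    lie_swap sc br 3 1 2 (tcls (lie_module sc br) 3 p) = tcls (lie_module sc br) 3 (flip12 p)"
  "p \<in> tensor_sums (lie_module sc br) 3 \<Longrightarrow>
    lie_swap sc br 3 2 3 (tcls (lie_module sc br) 3 p) = tcls (lie_module sc br) 3 (flip23 p)"
  unfolding tensor_swap_def flip_def flip12_def flip23_def
  by (erule G.tensor_lift_tcls, rule multilinear_slots, simp add: lists_in_lie_sums,
      (erule tuples_2E | erule tuples_3E), simp add: pure_tensor_lists)+

text \<open>A choice \<open>d\<close> of representatives for the values of the cobracket is linear
  only modulo relations. Since \<open>tail_by b\<close> and \<open>head_by b\<close> preserve
  relations and are linear in \<open>b\<close> modulo relations, both composites are bilinear in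
  that sense and descend to classes.\<close>

lemma delta_id_tcls:
  assumes "\<And>x. \<delta> x = tcls (lie_module sc br) 2 (d x)" "\<And>x. d x \<in> tensor_sums (lie_module sc br) 2"
    and add: "\<And>x y. d (x + y) - d x - d y \<in> tensor_rel (lie_module sc br) 2"
    and scale: "\<And>c x. d (sc c x) - fscale c (d x) \<in> tensor_rel (lie_module sc br) 2"
    and p: "p \<in> tensor_sums (lie_module sc br) 2"
  shows "delta_id sc br \<delta> (tcls (lie_module sc br) 2 p) = tcls (lie_module sc br) 3 (delta_id_repr d p)"
    "id_delta sc br \<delta> (tcls (lie_module sc br) 2 p) = tcls (lie_module sc br) 3 (id_delta_repr d p)"
    "delta_id_repr d p \<in> tensor_sums (lie_module sc br) 3"
    "id_delta_repr d p \<in> tensor_sums (lie_module sc br) 3"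
proof -
  note R = tensor_rel_3[where A = "lie_module sc br", simplified]
  have lift: "tensor_lift (lie_power sc br 3) (\<lambda>ys. pure_tensor (lie_module sc br) [ys ! 0, ys ! 1, b]) (\<delta> x)
      = tcls (lie_module sc br) 3 (tail_by b (d x))"
    "tensor_lift (lie_power sc br 3) (\<lambda>ys. pure_tensor (lie_module sc br) [b, ys ! 0, ys ! 1]) (\<delta> x)
      = tcls (lie_module sc br) 3 (head_by b (d x))" for b x
    unfolding assms(1) lie_power_def tail_by_def head_by_def
    by (rule G.tensor_lift_tcls[OF assms(2)], rule multilinear_slots,
        simp add: lists_in_lie_sums, simp add: pure_tensor_lists)+
  have S: "fs.subspace (tensor_rel (lie_module sc br) 3)" by (rule subspace_tensor_rel)
  have A: "tail_by b (d (x + y)) - tail_by b (d x) - tail_by b (d y) \<in> tensor_rel (lie_module sc br) 3"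
    "head_by b (d (x + y)) - head_by b (d x) - head_by b (d y) \<in> tensor_rel (lie_module sc br) 3"
    for b x y
    using lext_tensor_rel[OF S multilinear_slots(4) add] lext_tensor_rel[OF S multilinear_slots(5) add]
    by (auto simp: tail_by_def head_by_def lext_linear)
  have B: "tail_by b (d (sc c x)) - fscale c (tail_by b (d x)) \<in> tensor_rel (lie_module sc br) 3"
    "head_by b (d (sc c x)) - fscale c (head_by b (d x)) \<in> tensor_rel (lie_module sc br) 3"
    for b c x
    using lext_tensor_rel[OF S multilinear_slots(4) scale] lext_tensor_rel[OF S multilinear_slots(5) scale]
    by (auto simp: tail_by_def head_by_def lext_linear)
  \<comment> \<open>The facts \<open>A\<close> and \<open>B\<close> concern the slot fed to
    \<open>d\<close>; these concern the slot left alone.\<close>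
  have C: "tail_by (b + b') q - tail_by b q - tail_by b' q \<in> tensor_rel (lie_module sc br) 3"
    "head_by (b + b') q - head_by b q - head_by b' q \<in> tensor_rel (lie_module sc br) 3"
    "tail_by (sc c b) q - fscale c (tail_by b q) \<in> tensor_rel (lie_module sc br) 3"
    "head_by (sc c b) q - fscale c (head_by b q) \<in> tensor_rel (lie_module sc br) 3"
    for b b' c q
    unfolding tail_by_def head_by_def lext_fun_diff[symmetric] lext_fun_fscale[symmetric]
    by (rule lext_mem[OF S]; simp add: R)+
  show "delta_id_repr d p \<in> tensor_sums (lie_module sc br) 3" "id_delta_repr d p \<in> tensor_sums (lie_module sc br) 3"
    unfolding delta_id_repr_def id_delta_repr_def by (rule lext_in_tensor_sums[OF p]; simp add: assms(2) slots_in_tensor_sums[OF assms(2)])+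
  show "delta_id sc br \<delta> (tcls (lie_module sc br) 2 p) = tcls (lie_module sc br) 3 (delta_id_repr d p)"
    unfolding delta_id_def lift delta_id_repr_def unfolding lie_power_def
    by (rule G.tensor_lift_tcls[OF p])
      (auto intro!: multilinear_mod_2I A B C slots_in_tensor_sums[OF assms(2)])
  show "id_delta sc br \<delta> (tcls (lie_module sc br) 2 p) = tcls (lie_module sc br) 3 (id_delta_repr d p)"
    unfolding id_delta_def lift id_delta_repr_def unfolding lie_power_def
    by (rule G.tensor_lift_tcls[OF p])
      (auto intro!: multilinear_mod_2I A B C slots_in_tensor_sums[OF assms(2)])
qed

lemma incl_kernel_slots:
  shows "p \<in> incl_kernel sc br 2 \<Longrightarrow> flip p \<in> incl_kernel sc br 2"
    "p \<in> incl_kernel sc br 3 \<Longrightarrow> flip23 p \<in> incl_kernel sc br 3"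
    "p \<in> incl_kernel sc br 2 \<Longrightarrow> tail_by b p \<in> incl_kernel sc br 3"
    "p \<in> incl_kernel sc br 2 \<Longrightarrow> head_by b p \<in> incl_kernel sc br 3"
proof -
  have pow: "pow_incl sc br (basis xs) = basis (map (env_incl sc br) xs)" for xs
    by (simp add: pow_incl_def)
  note L = lext_incl_kernel[where sc' = sc and br' = br]
  show "p \<in> incl_kernel sc br 2 \<Longrightarrow> flip p \<in> incl_kernel sc br 2"
    unfolding flip_def by (erule L[OF _ multilinear_env_slots(1)]) (auto simp: pow lists_in_lie_sums)
  show "p \<in> incl_kernel sc br 3 \<Longrightarrow> flip23 p \<in> incl_kernel sc br 3"
    unfolding flip23_def by (erule L[OF _ multilinear_env_slots(2)]) (auto simp: pow lists_in_lie_sums)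
  show "p \<in> incl_kernel sc br 2 \<Longrightarrow> tail_by b p \<in> incl_kernel sc br 3"
    unfolding tail_by_def
    by (erule L[OF _ multilinear_env_slots(3)[of "env_incl sc br b"]]) (auto simp: pow lists_in_lie_sums)
  show "p \<in> incl_kernel sc br 2 \<Longrightarrow> head_by b p \<in> incl_kernel sc br 3"
    unfolding head_by_def
    by (erule L[OF _ multilinear_env_slots(4)[of "env_incl sc br b"]]) (auto simp: pow lists_in_lie_sums)
qed

definition place12 :: "('g list \<Rightarrow>\<^sub>0 'k) \<Rightarrow> ('k, 'g) env list \<Rightarrow>\<^sub>0 'k" where
  "place12 = lext (\<lambda>xs. basis [env_incl sc br (xs ! 0), env_incl sc br (xs ! 1), \<one>\<^bsub>env_alg sc br\<^esub>])"

definition place13 :: "('g list \<Rightarrow>\<^sub>0 'k) \<Rightarrow> ('k, 'g) env list \<Rightarrow>\<^sub>0 'k" where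
  "place13 = lext (\<lambda>xs. basis [env_incl sc br (xs ! 0), \<one>\<^bsub>env_alg sc br\<^esub>, env_incl sc br (xs ! 1)])"

definition place23 :: "('g list \<Rightarrow>\<^sub>0 'k) \<Rightarrow> ('k, 'g) env list \<Rightarrow>\<^sub>0 'k" where
  "place23 = lext (\<lambda>xs. basis [\<one>\<^bsub>env_alg sc br\<^esub>, env_incl sc br (xs ! 0), env_incl sc br (xs ! 1)])"

lemma place_in_tensor_sums:
  assumes "p \<in> tensor_sums (lie_module sc br) 2"
  shows "place12 p \<in> tensor_sums (env_alg sc br) 3"
    "place13 p \<in> tensor_sums (env_alg sc br) 3"
    "place23 p \<in> tensor_sums (env_alg sc br) 3"
  unfolding place12_def place13_def place23_def
  by (rule lext_in_tensor_sums[OF assms]; simp add: single_in_tensor_sums)+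

lemma place_tcls:
  assumes "p \<in> tensor_sums (lie_module sc br) 2"
  shows "place sc br 3 1 2 (tcls (lie_module sc br) 2 p) = tcls (env_alg sc br) 3 (place12 p)"
    "place sc br 3 1 3 (tcls (lie_module sc br) 2 p) = tcls (env_alg sc br) 3 (place13 p)"
    "place sc br 3 2 3 (tcls (lie_module sc br) 2 p) = tcls (env_alg sc br) 3 (place23 p)"
proof -
  have upt: "[1..<Suc 3] = [1, 2, 3]" by (simp add: upt_rec)
  note R = tensor_rel_3[where A = "env_alg sc br"]
  show "place sc br 3 1 2 (tcls (lie_module sc br) 2 p) = tcls (env_alg sc br) 3 (place12 p)"
    "place sc br 3 1 3 (tcls (lie_module sc br) 2 p) = tcls (env_alg sc br) 3 (place13 p)"
    "place sc br 3 2 3 (tcls (lie_module sc br) 2 p) = tcls (env_alg sc br) 3 (place23 p)"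
    unfolding place_def env_power_def place12_def place13_def place23_def upt
    by (rule G.tensor_lift_tcls[OF assms multilinear_mod_2I];
        simp add: env_incl_add env_incl_scale R pure_tensor_lists single_in_tensor_sums)+
qed

text \<open>Of the three slots exactly one carries Lie elements of both factors. In the other two
  one factor is the unit, so both orders of multiplication agree there and only the bracket in the
  shared slot remains.\<close>

lemma place_commutators:
  "tmult (env_alg sc br) (place12 p) (place13 q) - tmult (env_alg sc br) (place13 q) (place12 p) -
    pow_incl sc br (yb1 br p q) \<in> tensor_rel (env_alg sc br) 3"
  "tmult (env_alg sc br) (place12 p) (place23 q) - tmult (env_alg sc br) (place23 q) (place12 p) -
    pow_incl sc br (yb2 br p q) \<in> tensor_rel (env_alg sc br) 3"
  "tmult (env_alg sc br) (place13 p) (place23 q) - tmult (env_alg sc br) (place23 q) (place13 p) -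
    pow_incl sc br (yb3 br p q) \<in> tensor_rel (env_alg sc br) 3"
  unfolding tmult_def place12_def place13_def place23_def lext_lext pow_incl_def yb1_def yb2_def yb3_def
    lext_single fs.scale_one
  unfolding lext_commute[of _ p q]
  unfolding lext_fun_diff[symmetric]
  by (rule lext_mem[OF subspace_tensor_rel], rule lext_mem[OF subspace_tensor_rel],
      simp add: env_bracket_3)+

lemma cyb_tcls:
  assumes p: "p \<in> tensor_sums (lie_module sc br) 2"
  shows "cyb sc br (tcls (lie_module sc br) 2 p) =
    tcls (env_alg sc br) 3 (pow_incl sc br (yang br p p p))"
proof -
  let ?U = "env_alg sc br"
  let ?c = "\<lambda>a b. tmult ?U a b - tmult ?U b a"
  note S = subspace_tensor_rel[of ?U 3]
  have "cyb sc br (tcls (lie_module sc br) 2 p) =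
      tcls ?U 3 (?c (place12 p + place13 p) (place13 p + place23 p))"
    by (simp add: cyb_def env_power_def place_tcls[OF p] add_tcls U.commutator_tcls
        place_in_tensor_sums[OF p] del: One_nat_def)
  \<comment> \<open>The fourth commutator is that of \<open>place13 p\<close> with itself and
    cancels.\<close>
  also have "?c (place12 p + place13 p) (place13 p + place23 p) =
      ?c (place12 p) (place13 p) + ?c (place12 p) (place23 p) + ?c (place13 p) (place23 p)"
    by (simp add: tmult_linear algebra_simps)
  also have "tcls ?U 3 \<dots> = tcls ?U 3 (pow_incl sc br (yang br p p p))"
    using fs.subspace_add[OF S fs.subspace_add[OF S place_commutators(1)[of p p]
        place_commutators(2)[of p p]] place_commutators(3)[of p p]]
    by (simp add: tcls_eq_iff yang_def pow_incl_linear algebra_simps)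
  finally show ?thesis .
qed

text \<open>Each summand of \<Delta>(x) is the unit in one slot, so the commutator brackets one slot
  at a time.\<close>

lemma commutator_comult:
  assumes p: "p \<in> tensor_sums (lie_module sc br) 2"
  shows "commutator (env_power sc br 2) (power_incl sc br 2 (tcls (lie_module sc br) 2 p))
      (comult sc br x) = tcls (env_alg sc br) 2 (pow_incl sc br (ad2 br x p))"
proof -
  let ?U = "env_alg sc br"
  let ?x = "basis [env_incl sc br x, \<one>\<^bsub>?U\<^esub>] + basis [\<one>\<^bsub>?U\<^esub>, env_incl sc br x] :: _ \<Rightarrow>\<^sub>0 'k"
  have x: "?x \<in> tensor_sums ?U 2"
    by (simp add: single_in_tensor_sums)
  have comult: "comult sc br x = tcls ?U 2 ?x"
    by (simp add: comult_def Let_def env_power_def pure_tensor_lists add_tcls)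
  have keys: "length xs = 2" if "xs \<in> Poly_Mapping.keys p" for xs
    using p that by (auto simp: tensor_sums_def tuples_lie_module)
  have "tmult ?U (pow_incl sc br p) ?x - tmult ?U ?x (pow_incl sc br p) -
      pow_incl sc br (ad2 br x p) \<in> tensor_rel ?U 2"
    unfolding tmult_linear
    unfolding tmult_def pow_incl_def ad2_def lext_lext lext_single fs.scale_one lext_add
    unfolding lext_fun_diff[symmetric] lext_fun_add[symmetric]
  proof (rule lext_mem[OF subspace_tensor_rel], goal_cases)
    case (1 xs)
    then have "length xs = Suc (Suc 0)" using keys by simp
    then obtain a b where [simp]: "xs = [a, b]" by (auto simp: length_Suc_conv)
    show ?case
      using fs.subspace_add[OF subspace_tensor_rel env_bracket_2(1)[of "env_incl sc br b" sc br a x]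
          env_bracket_2(2)[of "env_incl sc br a" sc br b x]]
      by (simp add: lext_add algebra_simps)
  qed
  then show ?thesis
    by (simp add: env_power_def power_incl_tcls[OF p] comult
        U.commutator_tcls[OF pow_incl_in_tensor_sums[OF p] x] tcls_eq_iff)
qed

end



section \<open>Calculus of r-matrices\<close>

lemma tensor_ops_linear:
  "flip (p + q) = flip p + flip q" "flip (p - q) = flip p - flip q" "flip (- p) = - flip p"
  "flip (fscale c p) = fscale c (flip p)" "flip (sum f S) = (\<Sum>i\<in>S. flip (f i))"
  "flip12 (- p) = - flip12 p" "flip12 (p + q) = flip12 p + flip12 q" "flip12 (p - q) = flip12 p - flip12 q"
  "flip12 (sum f S) = (\<Sum>i\<in>S. flip12 (f i))"
  "flip23 (- p) = - flip23 p" "flip23 (p + q) = flip23 p + flip23 q" "flip23 (p - q) = flip23 p - flip23 q"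
  "flip23 (sum f S) = (\<Sum>i\<in>S. flip23 (f i))"
  "tail_by b (p + q) = tail_by b p + tail_by b q" "tail_by b (p - q) = tail_by b p - tail_by b q"
  "tail_by b (sum f S) = (\<Sum>i\<in>S. tail_by b (f i))"
  "head_by b (p + q) = head_by b p + head_by b q" "head_by b (p - q) = head_by b p - head_by b q"
  "head_by b (sum f S) = (\<Sum>i\<in>S. head_by b (f i))"
  "ad2 br x (p + q) = ad2 br x p + ad2 br x q" "ad2 br x (- p) = - ad2 br x p"
  "ad2 br x (p - q) = ad2 br x p - ad2 br x q"
  "ad2 br x (sum f S) = (\<Sum>i\<in>S. ad2 br x (f i))"
  "delta_id_repr d (p + q) = delta_id_repr d p + delta_id_repr d q" "delta_id_repr d (sum f S) = (\<Sum>i\<in>S. delta_id_repr d (f i))"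
  by (simp_all add: flip_def flip12_def flip23_def tail_by_def head_by_def ad2_def delta_id_repr_def lext_linear)

lemma yb_linear:
  "yb1 br (p + p') q = yb1 br p q + yb1 br p' q" "yb1 br p (q + q') = yb1 br p q + yb1 br p q'"
  "yb2 br (p + p') q = yb2 br p q + yb2 br p' q" "yb2 br p (q + q') = yb2 br p q + yb2 br p q'"
  "yb3 br (p + p') q = yb3 br p q + yb3 br p' q" "yb3 br p (q + q') = yb3 br p q + yb3 br p q'"
  "yb1 br p (- q) = - yb1 br p q" "yb2 br p (- q) = - yb2 br p q" "yb3 br p (- q) = - yb3 br p q"
  "yb1 br (sum f S) q = (\<Sum>i\<in>S. yb1 br (f i) q)" "yb1 br p (sum f S) = (\<Sum>i\<in>S. yb1 br p (f i))"
  "yb2 br (sum f S) q = (\<Sum>i\<in>S. yb2 br (f i) q)" "yb2 br p (sum f S) = (\<Sum>i\<in>S. yb2 br p (f i))"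
  "yb3 br (sum f S) q = (\<Sum>i\<in>S. yb3 br (f i) q)" "yb3 br p (sum f S) = (\<Sum>i\<in>S. yb3 br p (f i))"
  by (simp_all add: yb1_def yb2_def yb3_def lext_linear lext_fun)

context
  fixes sc :: "'k::field \<Rightarrow> 'g::ab_group_add \<Rightarrow> 'g" and br :: "'g \<Rightarrow> 'g \<Rightarrow> 'g"
begin

lemmas incl_kernel_closed =
  fs.subspace_0[OF subspace_incl_kernel[of sc br]]
  fs.subspace_add[OF subspace_incl_kernel[of sc br]]
  fs.subspace_diff[OF subspace_incl_kernel[of sc br]]
  fs.subspace_neg[OF subspace_incl_kernel[of sc br]]
  fs.subspace_sum[OF subspace_incl_kernel[of sc br]]

text \<open>Additivity at 0 + 0 leaves minus the list itself as a relation. This disposes of the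
  brackets between different summands of the direct sum.\<close>

lemma basis_zero_in_kernel:
  "basis [0, y] \<in> incl_kernel sc br 2" "basis [x, 0] \<in> incl_kernel sc br 2"
  "basis [0, y, z] \<in> incl_kernel sc br 3" "basis [x, 0, z] \<in> incl_kernel sc br 3"
  "basis [x, y, 0] \<in> incl_kernel sc br 3"
proof -
  have *: "basis w \<in> incl_kernel sc br m"
    if "basis w - basis w - basis w \<in> tensor_rel (lie_module sc br) m" for w m
    using incl_kernel_closed(4)[OF tensor_rel_in_incl_kernel[OF that]] by simp
  note R = tensor_rel_2(1,2)[where A = "lie_module sc br" and a = 0 and b = 0, simplified]
    tensor_rel_3(1-3)[where A = "lie_module sc br" and a = 0 and b = 0, simplified]
  show "basis [0, y] \<in> incl_kernel sc br 2" "basis [x, 0] \<in> incl_kernel sc br 2"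
    "basis [0, y, z] \<in> incl_kernel sc br 3" "basis [x, 0, z] \<in> incl_kernel sc br 3"
    "basis [x, y, 0] \<in> incl_kernel sc br 3"
    by (rule *, simp add: R)+
qed

lemma basis_neg_in_kernel:
  "basis [x, y] + basis [- x, y] \<in> incl_kernel sc br 2"
  "basis [x, y] + basis [x, - y] \<in> incl_kernel sc br 2"
  "basis [x, y, z] + basis [- x, y, z] \<in> incl_kernel sc br 3"
  "basis [x, y, z] + basis [x, - y, z] \<in> incl_kernel sc br 3"
  "basis [x, y, z] + basis [x, y, - z] \<in> incl_kernel sc br 3"
proof -
  have *: "a + b \<in> incl_kernel sc br m"
    if "z - a - b \<in> tensor_rel (lie_module sc br) m" "z \<in> incl_kernel sc br m" for z a b m
    using incl_kernel_closed(3)[OF that(2) tensor_rel_in_incl_kernel[OF that(1)]]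
    by (simp add: algebra_simps)
  show "basis [x, y] + basis [- x, y] \<in> incl_kernel sc br 2"
    "basis [x, y] + basis [x, - y] \<in> incl_kernel sc br 2"
    using tensor_rel_2(1,2)[where A = "lie_module sc br" and a = x and b = "- x" and d = y]
      tensor_rel_2(1,2)[where A = "lie_module sc br" and a = y and b = "- y" and d = x]
    by (auto intro: * basis_zero_in_kernel)
  show "basis [x, y, z] + basis [- x, y, z] \<in> incl_kernel sc br 3"
    "basis [x, y, z] + basis [x, - y, z] \<in> incl_kernel sc br 3"
    "basis [x, y, z] + basis [x, y, - z] \<in> incl_kernel sc br 3"
    using tensor_rel_3(1)[where A = "lie_module sc br" and a = x and b = "- x" and d = y and e = z]
      tensor_rel_3(2)[where A = "lie_module sc br" and a = y and b = "- y" and d = x and e = z]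
      tensor_rel_3(3)[where A = "lie_module sc br" and a = z and b = "- z" and d = x and e = y]
    by (auto intro: * basis_zero_in_kernel)
qed

lemma flip_flip: "p \<in> tensor_sums (lie_module sc br) 2 \<Longrightarrow> flip (flip p) = p"
proof -
  assume p: "p \<in> tensor_sums (lie_module sc br) 2"
  have "flip (flip p) = lext (\<lambda>xs. basis [xs ! 0, xs ! 1]) p"
    by (simp add: flip_def lext_lext)
  also have "\<dots> = lext basis p"
    by (rule lext_cong) (use p in \<open>auto simp: tensor_sums_def elim!: tuples_2E dest!: subsetD\<close>)
  finally show ?thesis by simp
qed

lemma flip_ad2: "flip (ad2 br x p) = ad2 br x (flip p)"
  by (simp add: flip_def ad2_def lext_lext lext_add add.commute)

end

context lie_algebra
begin

lemma br_anti: "br y x = - br x y"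
proof -
  have "br (x + y) (x + y) = br x x + br y y + (br x y + br y x)"
    by (simp only: br_add_left br_add_right ac_simps)
  then have "br x y + br y x = 0" by (simp add: br_self)
  then show ?thesis by (metis add.commute eq_neg_iff_add_eq_0)
qed

lemma br_zero [simp]: "br 0 y = 0" "br x 0 = 0"
  using br_add_left[of 0 0 y] br_add_right[of x 0 0] by simp_all

lemma br_minus_right: "br x (- y) = - br x y"
  using br_add_right[of x y "- y"] by (simp add: eq_neg_iff_add_eq_0 add.commute)

text \<open>The Jacobi identity as the statement that bracketing with \<open>y\<close> on the right
  is a derivation, arranged as a sum so that it matches the additivity relation in a slot.\<close>

lemma br_br_left: "br (br a x) y = br a (br x y) + br (br a y) x"
proof -
  have 1: "br (br a x) y = - br y (br a x)" by (rule br_anti)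
  have "br (br a y) x = - br x (br a y)" by (rule br_anti)
  moreover have "br x (br a y) = - br x (br y a)"
    by (subst br_anti[of a y]) (rule br_minus_right)
  ultimately have 2: "br (br a y) x = br x (br y a)" by simp
  have "br a (br x y) + br x (br y a) = - br y (br a x)"
    using jacobi[of a x y] by (simp only: eq_neg_iff_add_eq_0)
  then show ?thesis by (simp only: 1 2)
qed

end

section \<open>Identities between r-matrices sharing a cobracket, on representatives\<close>

definition r_mat ::
    "('k::field \<Rightarrow> 'g::ab_group_add \<Rightarrow> 'g) \<Rightarrow> ('g \<Rightarrow> 'g \<Rightarrow> 'g) \<Rightarrow> ('g \<Rightarrow> 'g list \<Rightarrow>\<^sub>0 'k) \<Rightarrow>
     ('g list \<Rightarrow>\<^sub>0 'k) \<Rightarrow> bool" where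
  "r_mat sc br d R \<longleftrightarrow> R \<in> tensor_sums (lie_module sc br) 2 \<and>
     (\<forall>x. d x - ad2 br x R \<in> incl_kernel sc br 2) \<and> yang br R R R \<in> incl_kernel sc br 3"

text \<open>Interpreted both for the given Lie algebra and for the direct sum. Skewness is asked
  modulo \<open>tensor_rel\<close> because \<open>lie_bialgebra\<close> poses it in the tensor
  square of the Lie algebra.\<close>

locale cobracket_repr = lie_algebra sc br
  for sc :: "'k::field_char_0 \<Rightarrow> 'g::ab_group_add \<Rightarrow> 'g" and br :: "'g \<Rightarrow> 'g \<Rightarrow> 'g" +
  fixes d :: "'g \<Rightarrow> 'g list \<Rightarrow>\<^sub>0 'k"
  assumes d_sums [simp]: "d x \<in> tensor_sums (lie_module sc br) 2"
    and d_skew: "d x + flip (d x) \<in> tensor_rel (lie_module sc br) 2"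
begin

lemma bracket_anti_in_kernel:
  "basis [br a b, u, v] + basis [br b a, u, v] \<in> incl_kernel sc br 3"
  "basis [u, br a b, v] + basis [u, br b a, v] \<in> incl_kernel sc br 3"
  "basis [u, v, br a b] + basis [u, v, br b a] \<in> incl_kernel sc br 3"
  using basis_neg_in_kernel(3)[of "br a b" u v] basis_neg_in_kernel(4)[of u "br a b" v]
    basis_neg_in_kernel(5)[of u v "br a b"]
  by (simp_all add: br_anti[of b a])

lemmas kernel_add = incl_kernel_closed(2)[of _ sc br]
lemmas kernel_diff = incl_kernel_closed(3)[of _ sc br]

lemma r_matD:
  assumes "r_mat sc br d R"
  shows "R \<in> tensor_sums (lie_module sc br) 2" "d x - ad2 br x R \<in> incl_kernel sc br 2"
    "yang br R R R \<in> incl_kernel sc br 3"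
  using assms by (auto simp: r_mat_def)

text \<open>The three terms of the twist equation, expressed through \<open>[r\<^sub>1\<^sub>2, s\<^sub>1\<^sub>3 + s\<^sub>2\<^sub>3]\<close>,
  \<open>[r\<^sub>2\<^sub>3, s\<^sub>1\<^sub>2 + s\<^sub>1\<^sub>3]\<close> and \<open>[r\<^sub>1\<^sub>3, s\<^sub>1\<^sub>2 + s\<^sub>3\<^sub>2]\<close> with any r-matrix \<open>r\<close>.\<close>

lemma delta_commutator_forms:
  assumes R: "\<And>x. d x - ad2 br x R \<in> incl_kernel sc br 2"
  shows "delta_id_repr d s - (yb1 br R s + yb2 br R s) \<in> incl_kernel sc br 3"
    "id_delta_repr d s + (yb2 br s R + yb3 br s R) \<in> incl_kernel sc br 3"
    "flip23 (delta_id_repr d s) + (yb1 br s R - yb3 br R (flip s)) \<in> incl_kernel sc br 3"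
proof -
  \<comment> \<open>With the extension over \<open>s\<close> outermost, the two commutators are the
    two halves of the action of the first leg of \<open>s\<close> on \<open>R\<close>, and the
    second leg of \<open>s\<close> is the tail.\<close>
  have yb12: "yb1 br R s + yb2 br R s = lext (\<lambda>xs. tail_by (xs ! 1) (ad2 br (xs ! 0) R)) s"
    unfolding yb1_def yb2_def lext_commute[of _ s R] tail_by_def ad2_def lext_lext
    by (simp add: lext_add lext_fun_add)
  have "delta_id_repr d s - (yb1 br R s + yb2 br R s) =
      lext (\<lambda>xs. tail_by (xs ! 1) (d (xs ! 0) - ad2 br (xs ! 0) R)) s"
    unfolding yb12 by (simp add: delta_id_repr_def tensor_ops_linear lext_fun_diff)
  also have "\<dots> \<in> incl_kernel sc br 3"
    by (rule lext_mem[OF subspace_incl_kernel]) (intro incl_kernel_slots R)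
  finally show first: "delta_id_repr d s - (yb1 br R s + yb2 br R s) \<in> incl_kernel sc br 3" .

  \<comment> \<open>Here the legs of \<open>s\<close> stand on the left of the brackets, while
    \<open>ad2\<close> has them on the right; the second summand collects the corrections from
    antisymmetry.\<close>
  have "id_delta_repr d s + (yb2 br s R + yb3 br s R) =
      lext (\<lambda>xs. head_by (xs ! 0) (d (xs ! 1) - ad2 br (xs ! 1) R)) s +
      lext (\<lambda>xs. lext (\<lambda>ys. (basis [xs ! 0, br (xs ! 1) (ys ! 0), ys ! 1] +
          basis [xs ! 0, br (ys ! 0) (xs ! 1), ys ! 1]) +
        (basis [xs ! 0, ys ! 0, br (xs ! 1) (ys ! 1)] + basis [xs ! 0, ys ! 0, br (ys ! 1) (xs ! 1)])) R) s"
    by (simp add: id_delta_repr_def tensor_ops_linear yb2_def yb3_def head_by_def ad2_def lext_lext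
        lext_linear lext_fun algebra_simps)
  also have "\<dots> \<in> incl_kernel sc br 3"
  proof (rule incl_kernel_closed(2))
    show "lext (\<lambda>xs. head_by (xs ! 0) (d (xs ! 1) - ad2 br (xs ! 1) R)) s \<in> incl_kernel sc br 3"
      by (rule lext_mem[OF subspace_incl_kernel]) (intro incl_kernel_slots R)
    show "lext (\<lambda>xs. lext (\<lambda>ys. (basis [xs ! 0, br (xs ! 1) (ys ! 0), ys ! 1] +
          basis [xs ! 0, br (ys ! 0) (xs ! 1), ys ! 1]) +
        (basis [xs ! 0, ys ! 0, br (xs ! 1) (ys ! 1)] +
          basis [xs ! 0, ys ! 0, br (ys ! 1) (xs ! 1)])) R) s \<in> incl_kernel sc br 3"
      by (rule lext_mem[OF subspace_incl_kernel], rule lext_mem[OF subspace_incl_kernel],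
          rule incl_kernel_closed(2))
        (rule bracket_anti_in_kernel)+
  qed
  finally show "id_delta_repr d s + (yb2 br s R + yb3 br s R) \<in> incl_kernel sc br 3" .

  \<comment> \<open>This is the first form carried along by \<open>flip23\<close>: the
    \<open>yb2\<close> term becomes the \<open>yb3\<close> term with \<open>flip s\<close> exactly,
    and the \<open>yb1\<close> term up to exchanging the arguments of a bracket.\<close>
  have "flip23 (delta_id_repr d s) + (yb1 br s R - yb3 br R (flip s)) =
      flip23 (delta_id_repr d s - (yb1 br R s + yb2 br R s)) +
      (flip23 (yb1 br R s) + yb1 br s R) + (flip23 (yb2 br R s) - yb3 br R (flip s))"
    by (simp add: tensor_ops_linear)
  also have "flip23 (yb2 br R s) - yb3 br R (flip s) = 0"
    by (simp add: flip23_def flip_def yb2_def yb3_def lext_lext)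
  also have "flip23 (yb1 br R s) + yb1 br s R =
      lext (\<lambda>xs. lext (\<lambda>ys. basis [br (xs ! 0) (ys ! 0), xs ! 1, ys ! 1] +
        basis [br (ys ! 0) (xs ! 0), xs ! 1, ys ! 1]) R) s"
    unfolding yb1_def lext_commute[of _ s R]
    by (simp add: flip23_def lext_lext lext_fun)
  also have "flip23 (delta_id_repr d s - (yb1 br R s + yb2 br R s)) + \<dots> + 0 \<in> incl_kernel sc br 3"
  proof (intro incl_kernel_closed(1,2) incl_kernel_slots(2) first)
    show "lext (\<lambda>xs. lext (\<lambda>ys. basis [br (xs ! 0) (ys ! 0), xs ! 1, ys ! 1] +
        basis [br (ys ! 0) (xs ! 0), xs ! 1, ys ! 1]) R) s \<in> incl_kernel sc br 3"
      by (rule lext_mem[OF subspace_incl_kernel], rule lext_mem[OF subspace_incl_kernel])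
        (rule bracket_anti_in_kernel)
  qed
  finally show "flip23 (delta_id_repr d s) + (yb1 br s R - yb3 br R (flip s)) \<in> incl_kernel sc br 3" .
qed

text \<open>Modulo the kernel \<open>yb2 br A D + yb3 br A D\<close> is minus
  \<open>id_delta_repr d A\<close>, whichever r-matrix \<open>D\<close> is. So \<open>D\<close> may
  be replaced by \<open>A\<close>, where the Yang-Baxter equation holds.\<close>

lemma yang_first_eq_second:
  assumes A: "r_mat sc br d A" and D: "r_mat sc br d D"
  shows "yang br A A D \<in> incl_kernel sc br 3"
proof -
  have "yang br A A D = yang br A A A +
      (id_delta_repr d A + (yb2 br A D + yb3 br A D)) - (id_delta_repr d A + (yb2 br A A + yb3 br A A))"
    by (simp add: yang_def)
  also have "\<dots> \<in> incl_kernel sc br 3"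
    by (rule kernel_diff[OF kernel_add[OF r_matD(3)[OF A] delta_commutator_forms(2)[OF r_matD(2)[OF D]]]
          delta_commutator_forms(2)[OF r_matD(2)[OF A]]])
  finally show ?thesis .
qed

text \<open>Both \<open>yb1 br A B + yb2 br A B\<close> and the same sum with \<open>B\<close> for
  \<open>A\<close> represent the cobracket applied to the first leg of \<open>B\<close>. Only the
  coboundary condition is asked of \<open>B\<close>, so that the lemma can serve to establish the
  Yang-Baxter equation for \<open>B\<close>.\<close>

lemma yang_second_eq_third:
  assumes A: "r_mat sc br d A" and B: "\<And>x. d x - ad2 br x B \<in> incl_kernel sc br 2"
  shows "yang br A B B - yang br B B B \<in> incl_kernel sc br 3"
proof -
  have "yang br A B B - yang br B B B =
      (delta_id_repr d B - (yb1 br B B + yb2 br B B)) - (delta_id_repr d B - (yb1 br A B + yb2 br A B))"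
    by (simp add: yang_def)
  also have "\<dots> \<in> incl_kernel sc br 3"
    by (rule kernel_diff[OF delta_commutator_forms(1)[OF B] delta_commutator_forms(1)[OF r_matD(2)[OF A]]])
  finally show ?thesis .
qed

text \<open>For \<open>D = - flip A\<close> the terms involving \<open>B\<close> are
  \<open>yb1 br A B - yb3 br B (flip A)\<close>, the third commutator form for \<open>A\<close>, so
  \<open>B\<close> may be replaced by \<open>A\<close>. What is left has equal first two arguments,
  and there \<open>D\<close> may be replaced by \<open>A\<close> as well.\<close>

lemma yang_third_eq_neg_flip_first:
  assumes A: "r_mat sc br d A" and B: "\<And>x. d x - ad2 br x B \<in> incl_kernel sc br 2"
    and D: "\<And>x. d x - ad2 br x (- flip A) \<in> incl_kernel sc br 2"
  shows "yang br A B (- flip A) \<in> incl_kernel sc br 3"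
proof -
  let ?D = "- flip A"
  have "yang br A B ?D = yang br A A A
      + (id_delta_repr d A + (yb2 br A ?D + yb3 br A ?D)) - (id_delta_repr d A + (yb2 br A A + yb3 br A A))
      + (flip23 (delta_id_repr d A) + (yb1 br A B - yb3 br B (flip A)))
      - (flip23 (delta_id_repr d A) + (yb1 br A A - yb3 br A (flip A)))"
    by (simp add: yang_def yb_linear)
  also have "\<dots> \<in> incl_kernel sc br 3"
    by (rule kernel_diff[OF kernel_add[OF kernel_diff[OF kernel_add[OF r_matD(3)[OF A]
              delta_commutator_forms(2)[OF D]] delta_commutator_forms(2)[OF r_matD(2)[OF A]]]
            delta_commutator_forms(3)[OF B]] delta_commutator_forms(3)[OF r_matD(2)[OF A]]])
  finally show ?thesis .
qed

text \<open>The coboundary condition for \<open>- flip A\<close> comes from skewness of the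
  cobracket. Given that, the two preceding lemmas apply with \<open>B = D = - flip A\<close>: one
  makes \<open>yang br A B B\<close> vanish, the other identifies it with
  \<open>yang br B B B\<close>.\<close>

lemma r_mat_neg_flip:
  assumes A: "r_mat sc br d A"
  shows "r_mat sc br d (- flip A)"
proof -
  have D: "d x - ad2 br x (- flip A) \<in> incl_kernel sc br 2" for x
  proof -
    have "d x - ad2 br x (- flip A) = (d x + flip (d x)) - flip (d x - ad2 br x A)"
      by (simp add: tensor_ops_linear flip_ad2)
    also have "\<dots> \<in> incl_kernel sc br 2"
      by (rule kernel_diff[OF tensor_rel_in_incl_kernel[OF d_skew] incl_kernel_slots(1)[OF r_matD(2)[OF A]]])
    finally show ?thesis .
  qed
  have "yang br (- flip A) (- flip A) (- flip A) = yang br A (- flip A) (- flip A)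
      - (yang br A (- flip A) (- flip A) - yang br (- flip A) (- flip A) (- flip A))"
    by simp
  also have "\<dots> \<in> incl_kernel sc br 3"
    by (rule kernel_diff[OF yang_third_eq_neg_flip_first[OF A D D] yang_second_eq_third[OF A D]])
  finally show ?thesis
    using D slots_in_tensor_sums(1)[OF r_matD(1)[OF A]] by (simp add: r_mat_def)
qed

lemma yang_in_kernel:
  assumes "r_mat sc br d A" "r_mat sc br d B" "r_mat sc br d D" "A = B \<or> B = D \<or> D = - flip A"
  shows "yang br A B D \<in> incl_kernel sc br 3"
  using assms(4)
proof (elim disjE)
  assume "A = B"
  then show ?thesis using yang_first_eq_second assms by simp
next
  assume BD: "B = D"
  have "yang br A B B = (yang br A B B - yang br B B B) + yang br B B B" by simp
  also have "\<dots> \<in> incl_kernel sc br 3"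
    using assms(2) by (intro kernel_add yang_second_eq_third[OF assms(1)]) (auto dest: r_matD)
  finally show ?thesis using BD by simp
next
  assume "D = - flip A"
  then show ?thesis using yang_third_eq_neg_flip_first[OF assms(1) r_matD(2)[OF assms(2)]]
      r_matD(2)[OF assms(3)] by simp
qed

text \<open>The twist expression of \<open>s\<close> is \<open>[[R + s, R + s]] - [[R, R]]\<close>.\<close>

lemma twist_in_kernel:
  assumes R: "r_mat sc br d R" and s: "flip s = - s" and T: "yang br (R + s) (R + s) (R + s) \<in> incl_kernel sc br 3"
  shows "delta_id_repr d s - id_delta_repr d s - flip23 (delta_id_repr d s) + yang br s s s \<in> incl_kernel sc br 3"
proof -
  \<comment> \<open>Skewness of \<open>s\<close> turns \<open>- yb3 br R (flip s)\<close> into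
    \<open>yb3 br R s\<close>, the last cross term that the expansion at \<open>R + s\<close>
    requires.\<close>
  have "delta_id_repr d s - id_delta_repr d s - flip23 (delta_id_repr d s) + yang br s s s =
      (delta_id_repr d s - (yb1 br R s + yb2 br R s)) - (id_delta_repr d s + (yb2 br s R + yb3 br s R))
      - (flip23 (delta_id_repr d s) + (yb1 br s R - yb3 br R (flip s)))
      + yang br (R + s) (R + s) (R + s) - yang br R R R"
    by (simp add: s yang_def yb_linear algebra_simps)
  also have "\<dots> \<in> incl_kernel sc br 3"
    by (rule kernel_diff[OF kernel_add[OF kernel_diff[OF kernel_diff[OF
              delta_commutator_forms(1)[OF r_matD(2)[OF R]] delta_commutator_forms(2)[OF r_matD(2)[OF R]]]
            delta_commutator_forms(3)[OF r_matD(2)[OF R]]] T] r_matD(3)[OF R]])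
  finally show ?thesis .
qed

end



section \<open>Direct sums\<close>

lemma tmap_linear:
  "tmap2 \<phi> \<psi> (p + q) = tmap2 \<phi> \<psi> p + tmap2 \<phi> \<psi> q" "tmap2 \<phi> \<psi> (p - q) = tmap2 \<phi> \<psi> p - tmap2 \<phi> \<psi> q"
  "tmap2 \<phi> \<psi> (- p) = - tmap2 \<phi> \<psi> p" "tmap2 \<phi> \<psi> (fscale c p) = fscale c (tmap2 \<phi> \<psi> p)"
  "tmap2 \<phi> \<psi> 0 = 0"
  "tmap3 \<phi> \<psi> \<omega> (p + q) = tmap3 \<phi> \<psi> \<omega> p + tmap3 \<phi> \<psi> \<omega> q"
  by (simp_all add: tmap2_def tmap3_def lext_linear)

lemma flip_tmap:
  "flip (tmap2 \<phi> \<psi> p) = tmap2 \<psi> \<phi> (flip p)"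
  "flip12 (tmap3 \<phi> \<psi> \<omega> p) = tmap3 \<psi> \<phi> \<omega> (flip12 p)"
  "flip23 (tmap3 \<phi> \<psi> \<omega> p) = tmap3 \<phi> \<omega> \<psi> (flip23 p)"
  by (simp_all add: flip_def flip12_def flip23_def tmap2_def tmap3_def lext_lext)

lemma axis_add: "axis i (x + y) = axis i x + (axis i y :: 'a::monoid_add ^ 'n)"
  by (simp add: axis_def vec_eq_iff)

lemma vec_nth_axis_if: "(axis i x :: 'a::zero ^ 'n) $ k = (if k = i then x else 0)"
  by (simp add: axis_def)

context lie_algebra
begin

lemma lie_algebra_sum: "lie_algebra (sum_scale sc) (sum_bracket br :: 'g^'n::finite \<Rightarrow> _)"
  by unfold_locales
    (auto simp: vec_eq_iff sum_scale_def sum_bracket_def scale_right_distrib scale_left_distrib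
      br_add_left br_add_right br_scale_left br_scale_right br_self jacobi)

lemma sum_scale_axis: "sum_scale sc c (axis i x) = axis i (sc c x)"
  by (simp add: sum_scale_def axis_def vec_eq_iff)

lemma sum_bracket_axis_left: "sum_bracket br (axis i x) y = axis i (br x (y $ i))"
  by (simp add: sum_bracket_def axis_def vec_eq_iff)

lemma sum_bracket_axis:
  "sum_bracket br (axis i x) (axis j y) = (if i = j then axis i (br x y) else 0)"
  by (auto simp: sum_bracket_def axis_def vec_eq_iff)

lemma tmap_axis_in_tensor_sums [simp]:
  assumes "p \<in> tensor_sums (lie_module sc br) m"
  shows "tmap2 \<phi> \<psi> p \<in> tensor_sums (lie_module sc' br') 2"
    "tmap3 \<phi> \<psi> \<omega> p \<in> tensor_sums (lie_module sc' br') 3"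
  unfolding tmap2_def tmap3_def
  by (rule lext_in_tensor_sums[OF assms]; simp add: lists_in_lie_sums)+

lemma multilinear_axis:
  fixes i j k :: "'n::finite"
  shows "multilinear_mod (lie_module sc br) 2 (tensor_rel (lie_module (sum_scale sc) (sum_bracket br)) 2)
     (\<lambda>xs. basis [axis i (xs ! 0), axis j (xs ! 1)])"
    "multilinear_mod (lie_module sc br) 3 (tensor_rel (lie_module (sum_scale sc) (sum_bracket br)) 3)
     (\<lambda>xs. basis [axis i (xs ! 0), axis j (xs ! 1), axis k (xs ! 2)])"
  using tensor_rel_2[where A = "lie_module (sum_scale sc) (sum_bracket br :: 'g^'n \<Rightarrow> _)"]
    tensor_rel_3[where A = "lie_module (sum_scale sc) (sum_bracket br :: 'g^'n \<Rightarrow> _)"]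
  by (auto intro!: multilinear_mod_2I multilinear_mod_3I simp: axis_add simp flip: sum_scale_axis)

lemma tmap_axis_tensor_rel:
  "p \<in> tensor_rel (lie_module sc br) 2 \<Longrightarrow>
    tmap2 (axis i) (axis j) p \<in> tensor_rel (lie_module (sum_scale sc) (sum_bracket br)) 2"
  "p \<in> tensor_rel (lie_module sc br) 3 \<Longrightarrow>
    tmap3 (axis i) (axis j) (axis k) p \<in> tensor_rel (lie_module (sum_scale sc) (sum_bracket br)) 3"
  unfolding tmap2_def tmap3_def
  by (rule lext_tensor_rel[OF subspace_tensor_rel multilinear_axis(1)], assumption)
    (rule lext_tensor_rel[OF subspace_tensor_rel multilinear_axis(2)], assumption)

lemma axis_tensor_tcls:
  assumes "p \<in> tensor_sums (lie_module sc br) 2"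
  shows "axis_tensor sc br i j (tcls (lie_module sc br) 2 p) =
    tcls (lie_module (sum_scale sc) (sum_bracket br)) 2 (tmap2 (axis i) (axis j) p)"
  unfolding axis_tensor_def lie_power_def tmap2_def
  by (rule k_closed.tensor_lift_tcls[OF k_closed_lie_module assms multilinear_axis(1)])
    (simp_all add: lists_in_lie_sums pure_tensor_lists)

text \<open>Each \<open>axis i\<close> is a morphism of Lie algebras and induces a linear map of
  enveloping algebras. Using the induced maps slot by slot, possibly with different summands,
  extends the operation to enveloping tensors.\<close>

lemma tmap_axis_incl_kernel:
  fixes i j k :: "'n::finite"
  shows "p \<in> incl_kernel sc br 2 \<Longrightarrow>
      tmap2 (axis i) (axis j) p \<in> incl_kernel (sum_scale sc) (sum_bracket br) 2"
    "p \<in> incl_kernel sc br 3 \<Longrightarrow>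
      tmap3 (axis i) (axis j) (axis k) p \<in> incl_kernel (sum_scale sc) (sum_bracket br) 3"
proof -
  let ?U = "env_alg sc br"
  let ?V = "env_alg (sum_scale sc) (sum_bracket br :: 'g^'n \<Rightarrow> _)"
  let ?inc = "\<lambda>\<psi> i. (\<forall>u\<in>carrier ?U. \<psi> u \<in> carrier ?V \<and>
      (\<forall>v\<in>carrier ?U. \<psi> (u \<oplus>\<^bsub>?U\<^esub> v) = \<psi> u \<oplus>\<^bsub>?V\<^esub> \<psi> v) \<and>
      (\<forall>c. \<psi> (c \<odot>\<^bsub>?U\<^esub> u) = c \<odot>\<^bsub>?V\<^esub> \<psi> u)) \<and>
      (\<forall>x. \<psi> (env_incl sc br x) = env_incl (sum_scale sc) (sum_bracket br) (axis i x))"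
  have "\<exists>\<psi>. ?inc \<psi> i" for i
  proof (rule env_functor[of "axis i :: _ \<Rightarrow> 'g^'n" sc "sum_scale sc" br "sum_bracket br"], goal_cases)
    case (4 \<psi>)
    then show ?case by (intro exI[of _ \<psi>]) simp
  qed (auto simp: axis_add sum_scale_axis sum_bracket_axis)
  then obtain \<psi> where \<psi>: "\<And>i. ?inc (\<psi> i) i" by metis
  have pow: "pow_incl (sum_scale sc) (sum_bracket br) (basis xs) =
      basis (map (env_incl (sum_scale sc) (sum_bracket br)) xs)" for xs :: "('g^'n) list"
    by (simp add: pow_incl_def)
  have "multilinear_mod ?U 2 (tensor_rel ?V 2) (\<lambda>us. basis [\<psi> i (us ! 0), \<psi> j (us ! 1)])"
    using tensor_rel_2[where A = ?V] \<psi> by (auto intro!: multilinear_mod_2I)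
  then show "p \<in> incl_kernel sc br 2 \<Longrightarrow>
      tmap2 (axis i) (axis j) p \<in> incl_kernel (sum_scale sc) (sum_bracket br) 2"
    unfolding tmap2_def
    by (rule lext_incl_kernel[rotated]) (use \<psi> in \<open>auto simp: pow lists_in_lie_sums\<close>)
  have "multilinear_mod ?U 3 (tensor_rel ?V 3)
      (\<lambda>us. basis [\<psi> i (us ! 0), \<psi> j (us ! 1), \<psi> k (us ! 2)])"
    using tensor_rel_3[where A = ?V] \<psi> by (auto intro!: multilinear_mod_3I)
  then show "p \<in> incl_kernel sc br 3 \<Longrightarrow>
      tmap3 (axis i) (axis j) (axis k) p \<in> incl_kernel (sum_scale sc) (sum_bracket br) 3"
    unfolding tmap3_def
    by (rule lext_incl_kernel[rotated]) (use \<psi> in \<open>auto simp: pow lists_in_lie_sums\<close>)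
qed

text \<open>Elements of different summands have bracket 0, but a list with a zero entry is zero only
  modulo relations; hence the formulation modulo the kernel.\<close>

lemma yb_axis:
  fixes i j k l :: "'n::finite"
  shows "yb1 (sum_bracket br) (tmap2 (axis i) (axis j) p) (tmap2 (axis k) (axis l) q) -
      (if i = k then tmap3 (axis i) (axis j) (axis l) (yb1 br p q) else 0)
      \<in> incl_kernel (sum_scale sc) (sum_bracket br) 3"
    "yb2 (sum_bracket br) (tmap2 (axis i) (axis j) p) (tmap2 (axis k) (axis l) q) -
      (if j = k then tmap3 (axis i) (axis j) (axis l) (yb2 br p q) else 0)
      \<in> incl_kernel (sum_scale sc) (sum_bracket br) 3"
    "yb3 (sum_bracket br) (tmap2 (axis i) (axis j) p) (tmap2 (axis k) (axis l) q) -
      (if j = l then tmap3 (axis i) (axis k) (axis l) (yb3 br p q) else 0)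
      \<in> incl_kernel (sum_scale sc) (sum_bracket br) 3"
  by (auto simp: yb1_def yb2_def yb3_def tmap2_def tmap3_def lext_lext sum_bracket_axis
      fs.subspace_0[OF subspace_incl_kernel]
      intro!: lext_mem[OF subspace_incl_kernel] basis_zero_in_kernel)

lemma yang_sum_axis:
  fixes \<sigma> :: "'n::finite \<Rightarrow> 'n \<Rightarrow> 'g list \<Rightarrow>\<^sub>0 'k"
  assumes \<sigma>: "\<And>p q l. yang br (\<sigma> p q) (\<sigma> p l) (\<sigma> q l) \<in> incl_kernel sc br 3"
    and T: "T = (\<Sum>p\<in>UNIV. \<Sum>q\<in>UNIV. tmap2 (axis p) (axis q) (\<sigma> p q))"
  shows "yang (sum_bracket br) T T T \<in> incl_kernel (sum_scale sc) (sum_bracket br) 3"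
proof -
  let ?K = "incl_kernel (sum_scale sc) (sum_bracket br :: 'g^'n \<Rightarrow> _) 3"
  let ?m = "\<lambda>p q l. tmap3 (axis p) (axis q) (axis l) :: _ \<Rightarrow> ('g^'n) list \<Rightarrow>\<^sub>0 'k"
  have collapse: "(\<Sum>p'\<in>UNIV. \<Sum>l\<in>UNIV. if p = p' then f p' l else 0) = (\<Sum>l\<in>UNIV. f p l)"
    for p :: 'n and f :: "'n \<Rightarrow> 'n \<Rightarrow> ('g^'n) list \<Rightarrow>\<^sub>0 'k"
  proof -
    have "(\<Sum>p'\<in>UNIV. \<Sum>l\<in>UNIV. if p = p' then f p' l else 0) =
        (\<Sum>p'\<in>UNIV. if p = p' then (\<Sum>l\<in>UNIV. f p' l) else 0)"
      by (rule sum.cong) auto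
    then show ?thesis by simp
  qed
  have "yb1 (sum_bracket br) T T - (\<Sum>p\<in>UNIV. \<Sum>q\<in>UNIV. \<Sum>p'\<in>UNIV. \<Sum>l\<in>UNIV.
      (if p = p' then ?m p q l (yb1 br (\<sigma> p q) (\<sigma> p' l)) else 0)) \<in> ?K"
    unfolding T yb_linear(10) unfolding yb_linear(11) sum_subtractf[symmetric]
    by (intro fs.subspace_sum[OF subspace_incl_kernel] yb_axis)
  also have "(\<Sum>p\<in>UNIV. \<Sum>q\<in>UNIV. \<Sum>p'\<in>UNIV. \<Sum>l\<in>UNIV.
      (if p = p' then ?m p q l (yb1 br (\<sigma> p q) (\<sigma> p' l)) else 0)) =
      (\<Sum>p\<in>UNIV. \<Sum>q\<in>UNIV. \<Sum>l\<in>UNIV. ?m p q l (yb1 br (\<sigma> p q) (\<sigma> p l)))"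
    by (simp only: collapse)
  finally have 1: "yb1 (sum_bracket br) T T -
      (\<Sum>p\<in>UNIV. \<Sum>q\<in>UNIV. \<Sum>l\<in>UNIV. ?m p q l (yb1 br (\<sigma> p q) (\<sigma> p l))) \<in> ?K" .
  have "yb2 (sum_bracket br) T T - (\<Sum>p\<in>UNIV. \<Sum>q\<in>UNIV. \<Sum>q'\<in>UNIV. \<Sum>l\<in>UNIV.
      (if q = q' then ?m p q l (yb2 br (\<sigma> p q) (\<sigma> q' l)) else 0)) \<in> ?K"
    unfolding T yb_linear(12) unfolding yb_linear(13) sum_subtractf[symmetric]
    by (intro fs.subspace_sum[OF subspace_incl_kernel] yb_axis)
  also have "(\<Sum>p\<in>UNIV. \<Sum>q\<in>UNIV. \<Sum>q'\<in>UNIV. \<Sum>l\<in>UNIV.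
      (if q = q' then ?m p q l (yb2 br (\<sigma> p q) (\<sigma> q' l)) else 0)) =
      (\<Sum>p\<in>UNIV. \<Sum>q\<in>UNIV. \<Sum>l\<in>UNIV. ?m p q l (yb2 br (\<sigma> p q) (\<sigma> q l)))"
    by (simp only: collapse)
  finally have 2: "yb2 (sum_bracket br) T T -
      (\<Sum>p\<in>UNIV. \<Sum>q\<in>UNIV. \<Sum>l\<in>UNIV. ?m p q l (yb2 br (\<sigma> p q) (\<sigma> q l))) \<in> ?K" .
  \<comment> \<open>The shared slot is now the third, so it is the last indices of the two copies
    that must agree, and the remaining sums come in the order \<open>p\<close>, \<open>l\<close>,
    \<open>q\<close>.\<close>
  have "yb3 (sum_bracket br) T T - (\<Sum>p\<in>UNIV. \<Sum>l'\<in>UNIV. \<Sum>q\<in>UNIV. \<Sum>l\<in>UNIV.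
      (if l' = l then ?m p q l (yb3 br (\<sigma> p l') (\<sigma> q l)) else 0)) \<in> ?K"
    unfolding T yb_linear(14) unfolding yb_linear(15) sum_subtractf[symmetric]
    by (intro fs.subspace_sum[OF subspace_incl_kernel] yb_axis)
  also have "(\<Sum>p\<in>UNIV. \<Sum>l'\<in>UNIV. \<Sum>q\<in>UNIV. \<Sum>l\<in>UNIV.
      (if l' = l then ?m p q l (yb3 br (\<sigma> p l') (\<sigma> q l)) else 0)) =
      (\<Sum>p\<in>UNIV. \<Sum>q\<in>UNIV. \<Sum>l\<in>UNIV. ?m p q l (yb3 br (\<sigma> p l) (\<sigma> q l)))"
    by (simp, rule sum.cong[OF refl], rule sum.swap)
  finally have 3: "yb3 (sum_bracket br) T T -
      (\<Sum>p\<in>UNIV. \<Sum>q\<in>UNIV. \<Sum>l\<in>UNIV. ?m p q l (yb3 br (\<sigma> p l) (\<sigma> q l))) \<in> ?K" .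
  have S: "(\<Sum>p\<in>UNIV. \<Sum>q\<in>UNIV. \<Sum>l\<in>UNIV. ?m p q l (yang br (\<sigma> p q) (\<sigma> p l) (\<sigma> q l))) \<in> ?K"
    by (intro fs.subspace_sum[OF subspace_incl_kernel] tmap_axis_incl_kernel \<sigma>)
  have "yang (sum_bracket br) T T T - (\<Sum>p\<in>UNIV. \<Sum>q\<in>UNIV. \<Sum>l\<in>UNIV. ?m p q l (yang br (\<sigma> p q) (\<sigma> p l) (\<sigma> q l))) \<in> ?K"
    using incl_kernel_closed(2)[OF incl_kernel_closed(2)[OF 1 2] 3]
    by (simp add: yang_def tmap_linear sum.distrib algebra_simps)
  from incl_kernel_closed(2)[OF this S] show ?thesis by simp
qed

text \<open>The commutator with \<Delta>(x) is formed from the image in the enveloping algebra,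
  which is the same for \<open>p\<close> and for 0.\<close>

lemma ad2_incl_kernel:
  assumes p: "p \<in> incl_kernel sc br 2"
  shows "ad2 br x p \<in> incl_kernel sc br 2"
proof -
  have sums: "p \<in> tensor_sums (lie_module sc br) 2" using p by (simp add: incl_kernel_def)
  have "tcls (env_alg sc br) 2 (pow_incl sc br p) = tcls (env_alg sc br) 2 (pow_incl sc br 0)"
    using p sums by (subst tcls_pow_incl_eq_iff) auto
  then have "power_incl sc br 2 (tcls (lie_module sc br) 2 p) =
      power_incl sc br 2 (tcls (lie_module sc br) 2 0)"
    by (simp add: power_incl_tcls sums)
  then have "tcls (env_alg sc br) 2 (pow_incl sc br (ad2 br x p)) =
      tcls (env_alg sc br) 2 (pow_incl sc br (ad2 br x 0))"
    using commutator_comult[OF sums, of x] commutator_comult[of 0 sc br x] by simp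
  moreover have "ad2 br x (0 :: 'g list \<Rightarrow>\<^sub>0 'k) = 0" by (simp add: ad2_def)
  ultimately show ?thesis
    using sums by (subst (asm) tcls_pow_incl_eq_iff) auto
qed

text \<open>In the double commutators the terms with one bracket in each slot are symmetric in
  \<open>x\<close> and \<open>y\<close> and cancel. The terms with both brackets in one slot are
  handled by the Jacobi identity there.\<close>

lemma ad2_bracket:
  assumes p: "p \<in> tensor_sums (lie_module sc br) 2"
  shows "ad2 br (br x y) p - (ad2 br y (ad2 br x p) - ad2 br x (ad2 br y p)) \<in> incl_kernel sc br 2"
proof -
  have R: "basis [u + v, w] - basis [u, w] - basis [v, w] \<in> incl_kernel sc br 2"
    "basis [w, u + v] - basis [w, u] - basis [w, v] \<in> incl_kernel sc br 2" for u v w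
    using tensor_rel_2(1,2)[where A = "lie_module sc br" and a = u and b = v and d = w]
    by (auto intro: tensor_rel_in_incl_kernel)
  have "ad2 br (br x y) p - (ad2 br y (ad2 br x p) - ad2 br x (ad2 br y p)) =
      lext (\<lambda>xs. - (basis [br (br (xs ! 0) x) y, xs ! 1] - basis [br (xs ! 0) (br x y), xs ! 1] -
          basis [br (br (xs ! 0) y) x, xs ! 1]) -
        (basis [xs ! 0, br (br (xs ! 1) x) y] - basis [xs ! 0, br (xs ! 1) (br x y)] -
          basis [xs ! 0, br (br (xs ! 1) y) x])) p"
    by (simp add: ad2_def lext_lext lext_linear lext_fun algebra_simps)
  also have "\<dots> \<in> incl_kernel sc br 2"
    unfolding br_br_left[of _ x y] by (intro lext_mem[OF subspace_incl_kernel] incl_kernel_closed R)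
  finally show ?thesis .
qed

end



section \<open>Translation between the bialgebra locales and representatives\<close>

context lie_bialgebra
begin

lemma cobracket_representative:
  obtains d where "\<And>x. \<delta> x = tcls (lie_module sc br) 2 (d x)" "d 0 = 0"
    "\<And>x y. d (x + y) - d x - d y \<in> tensor_rel (lie_module sc br) 2"
    "\<And>c x. d (sc c x) - fscale c (d x) \<in> tensor_rel (lie_module sc br) 2"
    "cobracket_repr sc br d"
    "\<And>x. delta_id_repr d (d x) + flip12 (flip23 (delta_id_repr d (d x))) + flip23 (flip12 (delta_id_repr d (d x)))
      \<in> tensor_rel (lie_module sc br) 3"
proof -
  let ?G = "lie_module sc br"
  have "\<exists>p. p \<in> tensor_sums ?G 2 \<and> \<delta> x = tcls ?G 2 p" for x
    using delta_closed[of x] by (auto simp: lie_power_def carrier_tensor_power)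
  then obtain e where e: "\<And>x. e x \<in> tensor_sums ?G 2" "\<And>x. \<delta> x = tcls ?G 2 (e x)"
    by metis
  \<comment> \<open>From \<delta>(0) = \<delta>(0) + \<delta>(0) the representative
    \<open>e 0\<close> is itself a relation, so exchanging it for 0 does not change its
    class.\<close>
  have "tcls ?G 2 (e 0) = tcls ?G 2 (e 0 + e 0)"
    using delta_add[of 0 0] by (simp add: e(2) lie_power_def add_tcls)
  then have "tcls ?G 2 (e 0) = tcls ?G 2 0"
    using fs.subspace_neg[OF subspace_tensor_rel, of "- e 0"] by (simp add: tcls_eq_iff)
  \<comment> \<open>Normalized at \<open>0\<close> so that the cobracket of the direct sum has, on a vector supported in one
    summand, no representatives from the others.\<close>
  define d where "d x = (if x = 0 then 0 else e x)" for x
  have d: "d x \<in> tensor_sums ?G 2" "\<delta> x = tcls ?G 2 (d x)" for x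
    using e \<open>tcls ?G 2 (e 0) = tcls ?G 2 0\<close> by (simp_all add: d_def)
  have add: "d (x + y) - d x - d y \<in> tensor_rel ?G 2" for x y
    using delta_add[of x y] by (simp add: d(2) lie_power_def add_tcls tcls_eq_iff diff_diff_add)
  have scale: "d (sc c x) - fscale c (d x) \<in> tensor_rel ?G 2" for c x
    using delta_scale[of c x] by (simp add: d(2) lie_power_def smult_tcls tcls_eq_iff)
  have skew': "d x + flip (d x) \<in> tensor_rel ?G 2" for x
    using skew[of x]
    by (simp add: d lie_power_def lie_swap_tcls uminus_tcls tcls_eq_iff add.commute del: One_nat_def)
  note D = delta_id_tcls[of \<delta> sc br d, OF d(2) d(1) add scale]
  have "delta_id_repr d (d x) + flip12 (flip23 (delta_id_repr d (d x))) + flip23 (flip12 (delta_id_repr d (d x)))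
      \<in> tensor_rel ?G 3" for x
    using co_jacobi[OF refl, of x]
    unfolding d(2)[of x] D(1)[OF d(1)]
    by (simp add: lie_power_def lie_swap_tcls slots_in_tensor_sums[OF D(3)[OF d(1)]] D(3)[OF d(1)]
        slots_in_tensor_sums[OF slots_in_tensor_sums(2)[OF D(3)[OF d(1)]]]
        slots_in_tensor_sums[OF slots_in_tensor_sums(3)[OF D(3)[OF d(1)]]]
        add_tcls zero_tensor_power tcls_eq_iff del: One_nat_def)
  moreover have "cobracket_repr sc br d"
    by unfold_locales (use d skew' in auto)
  ultimately show thesis
    using that[of d] d add scale by (simp add: d_def)
qed

end

context cobracket_repr
begin

text \<open>The cocycle condition is posed in the enveloping algebra, where \<open>d x\<close> may
  be replaced by \<open>ad2 br x R\<close>; it then says that commutators with \<Delta> respect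
  brackets. The other identities are supplied modulo \<open>tensor_rel\<close>.\<close>

lemma lie_bialgebra_of_coboundary:
  assumes \<delta>: "\<And>x. \<delta> x = tcls (lie_module sc br) 2 (d x)"
    and add: "\<And>x y. d (x + y) - d x - d y \<in> tensor_rel (lie_module sc br) 2"
    and scale: "\<And>c x. d (sc c x) - fscale c (d x) \<in> tensor_rel (lie_module sc br) 2"
    and R: "R \<in> tensor_sums (lie_module sc br) 2" "\<And>x. d x - ad2 br x R \<in> incl_kernel sc br 2"
    and coj: "\<And>x. delta_id_repr d (d x) + flip12 (flip23 (delta_id_repr d (d x))) + flip23 (flip12 (delta_id_repr d (d x)))
      \<in> tensor_rel (lie_module sc br) 3"
  shows "lie_bialgebra sc br \<delta>"
proof
  let ?G = "lie_module sc br"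
  note D = delta_id_tcls[of \<delta> sc br d, OF \<delta> d_sums add scale]
  fix x y c
  show "\<delta> x \<in> carrier (lie_power sc br 2)"
    by (simp add: \<delta> lie_power_def)
  show "\<delta> (x + y) = \<delta> x \<oplus>\<^bsub>lie_power sc br 2\<^esub> \<delta> y"
    using add[of x y] by (simp add: \<delta> lie_power_def add_tcls tcls_eq_iff diff_diff_add)
  show "\<delta> (sc c x) = c \<odot>\<^bsub>lie_power sc br 2\<^esub> \<delta> x"
    using scale[of c x] by (simp add: \<delta> lie_power_def smult_tcls tcls_eq_iff)
  show "lie_swap sc br 2 1 2 (\<delta> x) = \<ominus>\<^bsub>lie_power sc br 2\<^esub> \<delta> x"
    using d_skew[of x]
    by (simp add: \<delta> lie_power_def lie_swap_tcls uminus_tcls tcls_eq_iff add.commute del: One_nat_def)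
  show "t \<oplus>\<^bsub>lie_power sc br 3\<^esub> lie_swap sc br 3 1 2 (lie_swap sc br 3 2 3 t)
          \<oplus>\<^bsub>lie_power sc br 3\<^esub> lie_swap sc br 3 2 3 (lie_swap sc br 3 1 2 t)
        = \<zero>\<^bsub>lie_power sc br 3\<^esub>" if "t = delta_id sc br \<delta> (\<delta> x)" for t
    using coj[of x]
    unfolding that \<delta>[of x] D(1)[OF d_sums]
    by (simp add: lie_power_def lie_swap_tcls slots_in_tensor_sums[OF D(3)[OF d_sums]] D(3)[OF d_sums]
        slots_in_tensor_sums[OF slots_in_tensor_sums(2)[OF D(3)[OF d_sums]]]
        slots_in_tensor_sums[OF slots_in_tensor_sums(3)[OF D(3)[OF d_sums]]]
        add_tcls zero_tensor_power tcls_eq_iff del: One_nat_def)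
  \<comment> \<open>All three occurrences of \<open>d\<close> are traded for \<open>R\<close>; the
    last two replacements happen under \<open>ad2\<close>, which preserves the kernel.\<close>
  have "d (br x y) - (ad2 br y (d x) - ad2 br x (d y)) =
      (d (br x y) - ad2 br (br x y) R)
      + (ad2 br (br x y) R - (ad2 br y (ad2 br x R) - ad2 br x (ad2 br y R)))
      - ad2 br y (d x - ad2 br x R) + ad2 br x (d y - ad2 br y R)"
    by (simp add: tensor_ops_linear)
  also have "\<dots> \<in> incl_kernel sc br 2"
    by (rule kernel_add[OF kernel_diff[OF kernel_add[OF R(2) ad2_bracket[OF R(1)]]
            ad2_incl_kernel[OF R(2)]] ad2_incl_kernel[OF R(2)]])
  finally have K: "d (br x y) - (ad2 br y (d x) - ad2 br x (d y)) \<in> incl_kernel sc br 2" .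
  have sums: "ad2 br y (d x) \<in> tensor_sums ?G 2" for x y
    by (rule slots_in_tensor_sums[OF d_sums])
  show "power_incl sc br 2 (\<delta> (br x y)) =
        commutator (env_power sc br 2) (power_incl sc br 2 (\<delta> x)) (comult sc br y)
        \<ominus>\<^bsub>env_power sc br 2\<^esub>
        commutator (env_power sc br 2) (power_incl sc br 2 (\<delta> y)) (comult sc br x)"
    unfolding \<delta> commutator_comult[OF d_sums]
    unfolding power_incl_tcls[OF d_sums] env_power_def
      diff_tcls[OF pow_incl_in_tensor_sums[OF sums]] pow_incl_linear(2)[symmetric]
    by (subst tcls_pow_incl_eq_iff) (use sums K in auto)
qed

lemma r_mat_representative:
  assumes \<delta>: "\<And>x. \<delta> x = tcls (lie_module sc br) 2 (d x)" and r: "classical_r_matrix sc br \<delta> r"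
  shows "\<exists>\<rho>. r = tcls (lie_module sc br) 2 \<rho> \<and> r_mat sc br d \<rho>"
proof -
  interpret r: classical_r_matrix sc br \<delta> r by (rule r)
  obtain \<rho> where \<rho>: "\<rho> \<in> tensor_sums (lie_module sc br) 2" "r = tcls (lie_module sc br) 2 \<rho>"
    using r.r_closed by (auto simp: lie_power_def carrier_tensor_power)
  have "d x - ad2 br x \<rho> \<in> incl_kernel sc br 2" for x
    using r.delta_eq[of x] slots_in_tensor_sums(6)[OF \<rho>(1)]
    unfolding \<rho>(2) \<delta> commutator_comult[OF \<rho>(1)] unfolding power_incl_tcls[OF d_sums]
    by (subst (asm) tcls_pow_incl_eq_iff) auto
  moreover have yang: "yang br \<rho> \<rho> \<rho> \<in> tensor_sums (lie_module sc br) 3"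
    using \<rho>(1) by (simp add: yang_def yb_in_tensor_sums[of _ sc br 2])
  have "tcls (env_alg sc br) 3 (pow_incl sc br (yang br \<rho> \<rho> \<rho>)) =
      tcls (env_alg sc br) 3 (pow_incl sc br 0)"
    using r.cybe by (simp add: \<rho>(2) cyb_tcls[OF \<rho>(1)] env_power_def zero_tensor_power pow_incl_linear)
  then have "yang br \<rho> \<rho> \<rho> \<in> incl_kernel sc br 3"
    using yang by (subst (asm) tcls_pow_incl_eq_iff) auto
  ultimately show ?thesis using \<rho> by (auto simp: r_mat_def)
qed

text \<open>Completing the square leaves a Yang-Baxter condition on \<open>T\<close> alone; the rest
  is the translation from representatives back to classes.\<close>

lemma classical_drinfeld_twistI:
  assumes \<delta>: "\<And>x. \<delta> x = tcls (lie_module sc br) 2 (d x)"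
    and add: "\<And>x y. d (x + y) - d x - d y \<in> tensor_rel (lie_module sc br) 2"
    and scale: "\<And>c x. d (sc c x) - fscale c (d x) \<in> tensor_rel (lie_module sc br) 2"
    and bialg: "lie_bialgebra sc br \<delta>"
    and R: "r_mat sc br d R" and p: "p \<in> tensor_sums (lie_module sc br) 2"
    and T: "T = R + (p - flip p)" "yang br T T T \<in> incl_kernel sc br 3"
  shows "classical_drinfeld_twist sc br \<delta> (tcls (lie_module sc br) 2 p)"
proof -
  let ?G = "lie_module sc br"
  let ?U = "env_alg sc br"
  interpret lie_bialgebra sc br \<delta> by (rule bialg)
  define s where "s = p - flip p"
  have s: "s \<in> tensor_sums ?G 2" using p by (simp add: s_def slots_in_tensor_sums[OF p])
  have anti: "flip s = - s" by (simp add: s_def tensor_ops_linear flip_flip[OF p])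
  have skew_part: "skew_part sc br (tcls ?G 2 p) = tcls ?G 2 s"
    by (simp add: skew_part_def s_def lie_power_def lie_swap_tcls p diff_tcls
        slots_in_tensor_sums[OF p] del: One_nat_def)
  note D = delta_id_tcls[of \<delta> sc br d, OF \<delta> d_sums add scale s]
  let ?t = "delta_id_repr d s - id_delta_repr d s - flip23 (delta_id_repr d s)"
  have t: "?t \<in> tensor_sums ?G 3"
    using D slots_in_tensor_sums(3)[OF D(3)] by simp
  have y: "yang br s s s \<in> tensor_sums ?G 3"
    using s by (simp add: yang_def yb_in_tensor_sums[of _ sc br 2])
  have "?t + yang br s s s \<in> incl_kernel sc br 3"
    by (rule twist_in_kernel[OF R anti]) (use T s_def in simp)
  then have K: "tcls ?U 3 (pow_incl sc br (?t + yang br s s s)) = tcls ?U 3 (pow_incl sc br 0)"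
    using t y by (subst tcls_pow_incl_eq_iff) auto
  have "power_incl sc br 3
          (delta_id sc br \<delta> (tcls ?G 2 s) \<ominus>\<^bsub>lie_power sc br 3\<^esub> id_delta sc br \<delta> (tcls ?G 2 s)
            \<ominus>\<^bsub>lie_power sc br 3\<^esub> lie_swap sc br 3 2 3 (delta_id sc br \<delta> (tcls ?G 2 s)))
        = tcls ?U 3 (pow_incl sc br ?t)"
    unfolding D(1,2) lie_power_def diff_tcls[OF D(4)] lie_swap_tcls(3)[OF D(3)]
      diff_tcls[OF slots_in_tensor_sums(3)[OF D(3)]] power_incl_tcls[OF t] ..
  then have "power_incl sc br 3
          (delta_id sc br \<delta> (tcls ?G 2 s) \<ominus>\<^bsub>lie_power sc br 3\<^esub> id_delta sc br \<delta> (tcls ?G 2 s)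
            \<ominus>\<^bsub>lie_power sc br 3\<^esub> lie_swap sc br 3 2 3 (delta_id sc br \<delta> (tcls ?G 2 s)))
        \<oplus>\<^bsub>env_power sc br 3\<^esub> cyb sc br (tcls ?G 2 s) = \<zero>\<^bsub>env_power sc br 3\<^esub>"
    using K by (simp add: cyb_tcls[OF s] env_power_def add_tcls zero_tensor_power pow_incl_linear)
  then show ?thesis
    by unfold_locales (use p skew_part in \<open>auto simp: lie_power_def\<close>)
qed

end


section \<open>The cobracket of the direct sum\<close>

definition sum_repr :: "('g \<Rightarrow> 'g list \<Rightarrow>\<^sub>0 'k::field) \<Rightarrow> ('g::zero)^'n::finite \<Rightarrow> ('g^'n) list \<Rightarrow>\<^sub>0 'k" where
  "sum_repr d x = (\<Sum>i\<in>UNIV. tmap2 (axis i) (axis i) (d (x $ i)))"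

lemma (in lie_algebra) cobracket_repr_sum:
  fixes d :: "'g \<Rightarrow> 'g list \<Rightarrow>\<^sub>0 'k"
  defines "dL \<equiv> sum_repr d :: 'g^'n::finite \<Rightarrow> _"
  assumes d: "cobracket_repr sc br d" "d 0 = 0"
    and \<delta>: "\<And>x. \<delta> x = tcls (lie_module sc br) 2 (d x)"
    and add: "\<And>x y. d (x + y) - d x - d y \<in> tensor_rel (lie_module sc br) 2"
    and scale: "\<And>c x. d (sc c x) - fscale c (d x) \<in> tensor_rel (lie_module sc br) 2"
    and coj: "\<And>x. delta_id_repr d (d x) + flip12 (flip23 (delta_id_repr d (d x))) + flip23 (flip12 (delta_id_repr d (d x)))
      \<in> tensor_rel (lie_module sc br) 3"
  shows "sum_cobracket sc br \<delta> x = tcls (lie_module (sum_scale sc) (sum_bracket br)) 2 (dL x)"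
    "cobracket_repr (sum_scale sc) (sum_bracket br) dL"
    "dL (x + y) - dL x - dL y \<in> tensor_rel (lie_module (sum_scale sc) (sum_bracket br)) 2"
    "dL (sum_scale sc c x) - fscale c (dL x) \<in> tensor_rel (lie_module (sum_scale sc) (sum_bracket br)) 2"
    "delta_id_repr dL (dL x) + flip12 (flip23 (delta_id_repr dL (dL x))) + flip23 (flip12 (delta_id_repr dL (dL x)))
      \<in> tensor_rel (lie_module (sum_scale sc) (sum_bracket br)) 3"
    "(\<And>x. d x - ad2 br x R \<in> incl_kernel sc br 2) \<Longrightarrow>
      dL x - ad2 (sum_bracket br) x (\<Sum>i\<in>UNIV. tmap2 (axis i) (axis i) R)
      \<in> incl_kernel (sum_scale sc) (sum_bracket br) 2"
proof -
  have dL_eq: "dL x = (\<Sum>i\<in>UNIV. tmap2 (axis i) (axis i) (d (x $ i)))" for x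
    by (simp add: dL_def sum_repr_def)
  interpret d: cobracket_repr sc br d by (rule d(1))
  let ?L = "lie_module (sum_scale sc) (sum_bracket br :: 'g^'n \<Rightarrow> _)"
  let ?m = "\<lambda>i. tmap2 (axis i) (axis i) :: _ \<Rightarrow> ('g^'n) list \<Rightarrow>\<^sub>0 'k"
  note sum_rel = fs.subspace_sum[OF subspace_tensor_rel]
  show "sum_cobracket sc br \<delta> x = tcls ?L 2 (dL x)"
    unfolding sum_cobracket_def dL_eq lie_power_def
    by (rule finsum_tcls)
      (simp_all add: \<delta> axis_tensor_tcls tmap_axis_in_tensor_sums(1)[OF d.d_sums])
  have "dL x + flip (dL x) \<in> tensor_rel ?L 2" for x
  proof -
    have "dL x + flip (dL x) = (\<Sum>i\<in>UNIV. ?m i (d (x $ i) + flip (d (x $ i))))"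
      by (simp add: dL_eq tensor_ops_linear flip_tmap tmap_linear sum.distrib)
    also have "\<dots> \<in> tensor_rel ?L 2"
      by (intro sum_rel tmap_axis_tensor_rel d.d_skew)
    finally show ?thesis .
  qed
  moreover have "dL x \<in> tensor_sums ?L 2" for x
    unfolding dL_eq by (intro tensor_sums_closed tmap_axis_in_tensor_sums(1)[OF d.d_sums])
  ultimately show "cobracket_repr (sum_scale sc) (sum_bracket br) dL"
    by (intro cobracket_repr.intro cobracket_repr_axioms.intro lie_algebra_sum)
  have "dL (x + y) - dL x - dL y =
      (\<Sum>i\<in>UNIV. ?m i (d (x $ i + y $ i) - d (x $ i) - d (y $ i)))"
    by (simp add: dL_eq tmap_linear sum_subtractf)
  also have "\<dots> \<in> tensor_rel ?L 2"
    by (intro sum_rel tmap_axis_tensor_rel add)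
  finally show "dL (x + y) - dL x - dL y \<in> tensor_rel ?L 2" .
  have "dL (sum_scale sc c x) - fscale c (dL x) =
      (\<Sum>i\<in>UNIV. ?m i (d (sc c (x $ i)) - fscale c (d (x $ i))))"
    by (simp add: dL_eq tmap_linear sum_subtractf sum_scale_def fs.scale_sum_right)
  also have "\<dots> \<in> tensor_rel ?L 2"
    by (intro sum_rel tmap_axis_tensor_rel scale)
  finally show "dL (sum_scale sc c x) - fscale c (dL x) \<in> tensor_rel ?L 2" .
  have dL_axis: "dL (axis i a) = ?m i (d a)" for i a
  proof -
    have "dL (axis i a) = (\<Sum>k\<in>UNIV. if k = i then ?m i (d a) else 0)"
      unfolding dL_eq by (rule sum.cong) (auto simp: vec_nth_axis_if d(2) tmap_linear)
    then show ?thesis by simp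
  qed
  \<comment> \<open>On a copy inside summand \<open>i\<close> the operation never leaves that
    summand, so co-Jacobi can be checked one summand at a time.\<close>
  have delta_id_repr_axis: "delta_id_repr dL (?m i p) = tmap3 (axis i) (axis i) (axis i) (delta_id_repr d p)" for i p
    by (simp add: delta_id_repr_def tmap2_def lext_lext dL_axis tail_by_def tmap3_def)
  have delta_id_repr_dL: "delta_id_repr dL (dL x) =
      (\<Sum>i\<in>UNIV. tmap3 (axis i) (axis i) (axis i) (delta_id_repr d (d (x $ i))))"
    by (subst dL_eq) (simp add: tensor_ops_linear delta_id_repr_axis)
  have "delta_id_repr dL (dL x) + flip12 (flip23 (delta_id_repr dL (dL x))) + flip23 (flip12 (delta_id_repr dL (dL x))) =
      (\<Sum>i\<in>UNIV. tmap3 (axis i) (axis i) (axis i) (delta_id_repr d (d (x $ i)) +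
        flip12 (flip23 (delta_id_repr d (d (x $ i)))) + flip23 (flip12 (delta_id_repr d (d (x $ i))))))"
    by (simp add: delta_id_repr_dL tensor_ops_linear flip_tmap tmap_linear sum.distrib)
  also have "\<dots> \<in> tensor_rel ?L 3"
    by (intro sum_rel tmap_axis_tensor_rel coj)
  finally show "delta_id_repr dL (dL x) + flip12 (flip23 (delta_id_repr dL (dL x))) + flip23 (flip12 (delta_id_repr dL (dL x)))
      \<in> tensor_rel ?L 3" .
  assume R: "\<And>x. d x - ad2 br x R \<in> incl_kernel sc br 2"
  \<comment> \<open>A bracket with an element of summand \<open>i\<close> sees only the component
    \<open>x $ i\<close>.\<close>
  have "ad2 (sum_bracket br) x (?m i p) = ?m i (ad2 br (x $ i) p)" for i p
    by (simp add: ad2_def tmap2_def lext_lext lext_linear sum_bracket_axis_left)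
  then have "dL x - ad2 (sum_bracket br) x (\<Sum>i\<in>UNIV. ?m i R) =
      (\<Sum>i\<in>UNIV. ?m i (d (x $ i) - ad2 br (x $ i) R))"
    by (simp add: dL_eq tensor_ops_linear tmap_linear sum_subtractf)
  also have "\<dots> \<in> incl_kernel (sum_scale sc) (sum_bracket br) 2"
    by (intro fs.subspace_sum[OF subspace_incl_kernel] tmap_axis_incl_kernel R)
  finally show "dL x - ad2 (sum_bracket br) x (\<Sum>i\<in>UNIV. ?m i R)
      \<in> incl_kernel (sum_scale sc) (sum_bracket br) 2" .
qed

theorem theorem4p4:
  fixes sc :: "'k::field_char_0 \<Rightarrow> 'g::ab_group_add \<Rightarrow> 'g"
    and br :: "'g \<Rightarrow> 'g \<Rightarrow> 'g"
    and \<delta> :: "'g \<Rightarrow> ('k, 'g) tensor"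
    and C :: "'c set"
    and r :: "'c \<Rightarrow> ('k, 'g) tensor"
    and col :: "'n::{finite,linorder} \<Rightarrow> 'n \<Rightarrow> 'c"
  assumes "lie_bialgebra sc br \<delta>"
    and "\<And>c. c \<in> C \<Longrightarrow> classical_r_matrix sc br \<delta> (r c)"
    and "CARD('n) \<ge> 2"
    and "\<And>i j. i < j \<Longrightarrow> col i j \<in> C"
    and "transitive_colouring col"
  shows "classical_drinfeld_twist (sum_scale sc) (sum_bracket br)
           (sum_cobracket sc br \<delta>)
           (colour_twist sc br r col)"
proof -
  let ?G = "lie_module sc br"
  let ?L = "lie_module (sum_scale sc) (sum_bracket br :: ('g, 'n) vec \<Rightarrow> _)"
  let ?m = "\<lambda>p q. tmap2 (axis p) (axis q) :: _ \<Rightarrow> ('g, 'n) vec list \<Rightarrow>\<^sub>0 'k"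
  interpret lie_bialgebra sc br \<delta> by (rule assms(1))
  obtain d where d: "\<And>x. \<delta> x = tcls ?G 2 (d x)" "d 0 = 0"
    "\<And>x y. d (x + y) - d x - d y \<in> tensor_rel ?G 2"
    "\<And>c x. d (sc c x) - fscale c (d x) \<in> tensor_rel ?G 2"
    "cobracket_repr sc br d"
    "\<And>x. delta_id_repr d (d x) + flip12 (flip23 (delta_id_repr d (d x))) + flip23 (flip12 (delta_id_repr d (d x)))
      \<in> tensor_rel ?G 3"
    using cobracket_representative by blast
  interpret d: cobracket_repr sc br d by (rule d(5))
  let ?dL = "sum_repr d :: ('g, 'n) vec \<Rightarrow> _"
  note dL = cobracket_repr_sum[OF d(5,2,1,3,4,6)]
  interpret L: cobracket_repr "sum_scale sc" "sum_bracket br" ?dL by (rule dL(2))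

  have "\<exists>\<rho>. r c = tcls ?G 2 \<rho> \<and> r_mat sc br d \<rho>" if "c \<in> C" for c
    by (rule d.r_mat_representative[OF d(1) assms(2)[OF that]])
  then obtain \<rho> where \<rho>: "\<And>c. c \<in> C \<Longrightarrow> r c = tcls ?G 2 (\<rho> c)" "\<And>c. c \<in> C \<Longrightarrow> r_mat sc br d (\<rho> c)"
    by metis
  note \<rho>_sums = d.r_matD(1)[OF \<rho>(2)]
  \<comment> \<open>Two distinct indices provide a pair \<open>a < b\<close>, hence a colour in
    \<open>C\<close> and with it an r-matrix for the diagonal.\<close>
  have "\<exists>a b :: 'n. a \<noteq> b"
    using assms(3) card_le_Suc0_iff_eq[of "UNIV :: 'n set"] by auto
  then obtain a b :: 'n where "a < b" using linorder_less_linear by blast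
  define R where "R = \<rho> (col a b)"
  have R: "r_mat sc br d R" unfolding R_def by (rule \<rho>(2)) (rule assms(4)[OF \<open>a < b\<close>])

  define RL where "RL = (\<Sum>i\<in>UNIV. ?m i i R)"
  have RL_sums: "RL \<in> tensor_sums ?L 2"
    unfolding RL_def by (intro tensor_sums_closed tmap_axis_in_tensor_sums(1)[OF d.r_matD(1)[OF R]])
  have RL_cob: "?dL x - ad2 (sum_bracket br) x RL \<in> incl_kernel (sum_scale sc) (sum_bracket br) 2" for x
    unfolding RL_def by (rule dL(6)[OF d.r_matD(2)[OF R]])
  \<comment> \<open>Filling the matrix with zeros off the diagonal makes
    \<open>yang_sum_axis\<close> applicable: unless all three indices agree, every commutator in the
    triple has a zero argument.\<close>
  have "RL = (\<Sum>p\<in>UNIV. \<Sum>q\<in>UNIV. ?m p q (if p = q then R else 0))"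
    unfolding RL_def
  proof (rule sum.cong[OF refl])
    fix p :: 'n
    have "(\<Sum>q\<in>UNIV. ?m p q (if p = q then R else 0)) = (\<Sum>q\<in>UNIV. if p = q then ?m p p R else 0)"
      by (rule sum.cong) (auto simp: tmap_linear)
    then show "?m p p R = (\<Sum>q\<in>UNIV. ?m p q (if p = q then R else 0))" by simp
  qed
  then have "yang (sum_bracket br) RL RL RL \<in> incl_kernel (sum_scale sc) (sum_bracket br) 3"
    by (rule yang_sum_axis[rotated])
      (use d.r_matD(3)[OF R] fs.subspace_0[OF subspace_incl_kernel] in
        \<open>auto simp: yang_def yb1_def yb2_def yb3_def\<close>)
  with RL_sums RL_cob have RL: "r_mat (sum_scale sc) (sum_bracket br) ?dL RL"
    by (simp add: r_mat_def)

  have bialg: "lie_bialgebra (sum_scale sc) (sum_bracket br) (sum_cobracket sc br \<delta> :: ('g, 'n) vec \<Rightarrow> _)"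
    by (rule L.lie_bialgebra_of_coboundary[OF dL(1,3,4) RL_sums RL_cob dL(5)])

  define J where "J = (\<Sum>(i, j)\<in>{(i, j). i < j}. ?m j i (\<rho> (col i j)))"
  have J_sums: "J \<in> tensor_sums ?L 2"
    unfolding J_def
    by (intro tensor_sums_closed) (auto intro!: tmap_axis_in_tensor_sums(1)[OF \<rho>_sums] assms(4))
  have J: "colour_twist sc br r col = tcls ?L 2 J"
    unfolding colour_twist_def J_def lie_power_def
    by (rule finsum_tcls)
      (auto intro!: tmap_axis_in_tensor_sums(1)[OF \<rho>_sums] assms(4)
        simp: \<rho>(1)[OF assms(4)] axis_tensor_tcls[OF \<rho>_sums[OF assms(4)]])

  define \<sigma> where "\<sigma> p q = (if q < p then \<rho> (col q p)
      else if p < q then - flip (\<rho> (col p q)) else R)" for p q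
  have \<sigma>: "r_mat sc br d (\<sigma> p q)" for p q
    by (auto simp: \<sigma>_def intro!: d.r_mat_neg_flip \<rho>(2) assms(4) R)
  have ff: "flip (flip (\<rho> (col i j))) = \<rho> (col i j)" if "i < j" for i j
    by (rule flip_flip[OF \<rho>_sums[OF assms(4)[OF that]]])
  have trans: "col i k = col i j \<or> col i k = col j k" if "i < j" "j < k" for i j k
    using assms(5) that by (auto simp: transitive_colouring_def)
  have cases: "\<sigma> p q = \<sigma> p l \<or> \<sigma> p l = \<sigma> q l \<or> \<sigma> q l = - flip (\<sigma> p q)" for p q l
  proof -
    \<comment> \<open>If \<open>p = q\<close> the second alternative holds, if \<open>q = l\<close>
      the first, and if \<open>p = l\<close> with \<open>p \<noteq> q\<close> the third. For
      distinct indices transitivity, applied to the sorted triple, leaves two alternatives: the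
      first two if \<open>q\<close> is the middle index, the first and third if \<open>l\<close> is,
      the last two if \<open>p\<close> is.\<close>
    consider "p = q" | "q = l" | "p = l" "p < q" | "p = l" "q < p" | "p < q" "q < l" | "p < l" "l < q"
      | "q < p" "p < l" | "q < l" "l < p" | "l < p" "p < q" | "l < q" "q < p"
      by (metis linorder_less_linear)
    then show ?thesis
    proof cases
      case 5 then show ?thesis using trans[of p q l] by (auto simp: \<sigma>_def)
    next
      case 6 then show ?thesis using trans[of p l q] by (auto simp: \<sigma>_def ff tensor_ops_linear)
    next
      case 7 then show ?thesis using trans[of q p l] by (auto simp: \<sigma>_def)
    next
      case 8 then show ?thesis using trans[of q l p] by (auto simp: \<sigma>_def)
    next
      case 9 then show ?thesis using trans[of l p q] by (auto simp: \<sigma>_def ff tensor_ops_linear)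
    next
      case 10 then show ?thesis using trans[of l q p] by (auto simp: \<sigma>_def)
    qed (auto simp: \<sigma>_def ff tensor_ops_linear)
  qed
  have T: "RL + (J - flip J) = (\<Sum>p\<in>UNIV. \<Sum>q\<in>UNIV. ?m p q (\<sigma> p q))"
  proof -
    let ?f = "\<lambda>p q. (if q = p then ?m p q R else 0) + (if q < p then ?m p q (\<rho> (col q p)) else 0) -
      (if p < q then ?m p q (flip (\<rho> (col p q))) else 0)"
    have f: "?m p q (\<sigma> p q) = ?f p q" for p q
      by (auto simp: \<sigma>_def tmap_linear)
    \<comment> \<open>Padding with zeros gives a full double sum, so that \<open>J\<close>, its flip
      and the diagonal can be compared entry by entry with \<sigma>.\<close>
    have J': "J = (\<Sum>i\<in>UNIV. \<Sum>j\<in>UNIV. if i < j then ?m j i (\<rho> (col i j)) else 0)"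
      unfolding J_def sum.cartesian_product
      by (rule sum.mono_neutral_cong_left) (auto split: if_splits)
    have "flip J = (\<Sum>i\<in>UNIV. \<Sum>j\<in>UNIV. if i < j then ?m i j (flip (\<rho> (col i j))) else 0)"
      unfolding J' tensor_ops_linear
      by (intro sum.cong refl) (auto simp: flip_tmap lext_0[of "\<lambda>xs. basis [xs ! 1, xs ! 0]", folded flip_def])
    moreover have "J = (\<Sum>p\<in>UNIV. \<Sum>q\<in>UNIV. if q < p then ?m p q (\<rho> (col q p)) else 0)"
      unfolding J' by (rule sum.swap)
    moreover have "RL = (\<Sum>p\<in>UNIV. \<Sum>q\<in>UNIV. if q = p then ?m p q R else 0)"
      by (simp add: RL_def)
    ultimately show ?thesis
      unfolding f by (simp only: sum.distrib sum_subtractf add_diff_eq)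
  qed
  have "yang (sum_bracket br) (RL + (J - flip J)) (RL + (J - flip J)) (RL + (J - flip J))
      \<in> incl_kernel (sum_scale sc) (sum_bracket br) 3"
    by (rule yang_sum_axis[OF _ T]) (rule d.yang_in_kernel[OF \<sigma> \<sigma> \<sigma> cases])
  then show ?thesis
    unfolding J by (intro L.classical_drinfeld_twistI[OF dL(1,3,4) bialg RL J_sums refl])
qed


end
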